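(* Let $k$ be a perfect field, let $S=k[x_0,\ldots,x_{N-1}]$ be a standard graded polynomial ring in $N\ge 3$ variables, and let $\mathbf m=(x_0,\ldots,x_{N-1})$. Let $I$ be a radical homogeneous ideal of $S$ with $\operatorname{ht}(I)=N-1$ that is minimally generated by $\binom N2$ quadrics (homogeneous forms of degree $2$). Then, for every positive integer $m$, one has $$\operatorname{ann}_S\bigl(I^{(m)}/I^m\bigr)=\mathbf m^{\left\lfloor\frac{m(N-2)}{N-1}\right\rfloor}.$$
   Context: The $m$-th symbolic power of $I$ is $I^{(m)}=\bigcap_{p\in\operatorname{Ass}_S(S/I)}(I^mS_p\cap S)$, where $I^mS_p\cap S$ denotes the preimage in $S$ of $I^mS_p$ under $S\to S_p$. The boldface $\mathbf m$ is the homogeneous maximal ideal, while $m$ is an integer; $\mathbf m^0=S$. *)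

theory Defs
  imports
    "HOL-Algebra.Ideal_Product"
    "HOL-Algebra.QuotRing"
    "HOL-Algebra.Module"
    "HOL-Library.Poly_Mapping"
    "HOL-Library.Extended_Nat"
    "HOL-Computational_Algebra.Primes"
begin

section \<open>Perfect fields\<close>

definition perfect_field :: "'k::field itself \<Rightarrow> bool" where
  "perfect_field _ \<longleftrightarrow> CHAR('k) = 0 \<or> surj (\<lambda>a::'k. a ^ CHAR('k))"


section \<open>Ideals of a commutative ring\<close>

text \<open>\<open>ideals_set R\<close> is the library's semiring of ideals; its multiplicative unit is
  \<open>carrier R\<close>, so that the zeroth power of an ideal is the whole ring.\<close>

abbreviation ideal_power :: "('a, 'b) ring_scheme \<Rightarrow> 'a set \<Rightarrow> nat \<Rightarrow> 'a set" where
  "ideal_power R I n \<equiv> I [^]\<^bsub>ideals_set R\<^esub> n"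

definition ideal_radical :: "('a, 'b) ring_scheme \<Rightarrow> 'a set \<Rightarrow> 'a set" where
  "ideal_radical R I = {a \<in> carrier R. \<exists>n::nat. a [^]\<^bsub>R\<^esub> n \<in> I}"

definition radical_ideal :: "'a set \<Rightarrow> ('a, 'b) ring_scheme \<Rightarrow> bool" where
  "radical_ideal I R \<longleftrightarrow> ideal I R \<and> ideal_radical R I = I"

text \<open>The height of a prime \<open>P\<close> is the supremum of the lengths \<open>n\<close> of chains of primes
  \<open>c 0 \<subset> c 1 \<subset> \<dots> \<subset> c n = P\<close>; the height of an ideal is the infimum of the heights of
  the primes containing it (so the unit ideal has height \<open>\<infinity>\<close>).\<close>

definition prime_height :: "('a, 'b) ring_scheme \<Rightarrow> 'a set \<Rightarrow> enat" where
  "prime_height R P = Sup {enat n | n. \<exists>c::nat \<Rightarrow> 'a set.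
     (\<forall>i\<le>n. primeideal (c i) R) \<and> (\<forall>i<n. c i \<subset> c (Suc i)) \<and> c n = P}"

definition ideal_height :: "('a, 'b) ring_scheme \<Rightarrow> 'a set \<Rightarrow> enat" where
  "ideal_height R I = (INF P \<in> {P. primeideal P R \<and> I \<subseteq> P}. prime_height R P)"

definition minimal_generating_set :: "('a, 'b) ring_scheme \<Rightarrow> 'a set \<Rightarrow> 'a set \<Rightarrow> bool" where
  "minimal_generating_set R G I \<longleftrightarrow>
     G \<subseteq> carrier R \<and> Idl\<^bsub>R\<^esub> G = I \<and> (\<forall>H. H \<subset> G \<longrightarrow> Idl\<^bsub>R\<^esub> H \<noteq> I)"


section \<open>Quotients of ideals as modules\<close>

text \<open>The \<open>R\<close>-module \<open>J / K\<close> for ideals \<open>K \<subseteq> J\<close>. The fields \<open>mult\<close> and \<open>one\<close> are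
  present only because module records extend ring records; they play no role for modules.\<close>

definition quotient_module ::
  "('a, 'b) ring_scheme \<Rightarrow> 'a set \<Rightarrow> 'a set \<Rightarrow> ('a, 'a set) module" where
  "quotient_module R J K =
     \<lparr>carrier = (\<lambda>x. K +>\<^bsub>R\<^esub> x) ` J, monoid.mult = undefined, one = undefined,
      zero = K, add = set_add R, smult = (\<lambda>r X. \<Union>x\<in>X. K +>\<^bsub>R\<^esub> (r \<otimes>\<^bsub>R\<^esub> x))\<rparr>"

definition annihilator ::
  "('a, 'b) ring_scheme \<Rightarrow> ('a, 'm, 'c) module_scheme \<Rightarrow> 'a set" where
  "annihilator R M = {r \<in> carrier R. \<forall>x \<in> carrier M. r \<odot>\<^bsub>M\<^esub> x = \<zero>\<^bsub>M\<^esub>}"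

definition associated_primes ::
  "('a, 'b) ring_scheme \<Rightarrow> ('a, 'm, 'c) module_scheme \<Rightarrow> 'a set set" where
  "associated_primes R M = {P. primeideal P R \<and>
     (\<exists>x \<in> carrier M. P = {r \<in> carrier R. r \<odot>\<^bsub>M\<^esub> x = \<zero>\<^bsub>M\<^esub>})}"


section \<open>Localization and symbolic powers\<close>

text \<open>The ring of fractions with denominators in a multiplicative set \<open>W\<close>; its elements are the
  classes of pairs (numerator, denominator).\<close>

definition fraction_rel ::
  "('a, 'b) ring_scheme \<Rightarrow> 'a set \<Rightarrow> (('a \<times> 'a) \<times> ('a \<times> 'a)) set" where
  "fraction_rel R W = {((a, s), (b, t)). a \<in> carrier R \<and> s \<in> W \<and> b \<in> carrier R \<and> t \<in> W \<and>
     (\<exists>u \<in> W. u \<otimes>\<^bsub>R\<^esub> (a \<otimes>\<^bsub>R\<^esub> t) = u \<otimes>\<^bsub>R\<^esub> (b \<otimes>\<^bsub>R\<^esub> s))}"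

definition fraction :: "('a, 'b) ring_scheme \<Rightarrow> 'a set \<Rightarrow> 'a \<Rightarrow> 'a \<Rightarrow> ('a \<times> 'a) set" where
  "fraction R W a s = fraction_rel R W `` {(a, s)}"

definition fraction_ring :: "('a, 'b) ring_scheme \<Rightarrow> 'a set \<Rightarrow> ('a \<times> 'a) set ring" where
  "fraction_ring R W =
     \<lparr>carrier = (carrier R \<times> W) // fraction_rel R W,
      monoid.mult = (\<lambda>X Y. \<Union>(a, s)\<in>X. \<Union>(b, t)\<in>Y. fraction R W (a \<otimes>\<^bsub>R\<^esub> b) (s \<otimes>\<^bsub>R\<^esub> t)),
      one = fraction R W \<one>\<^bsub>R\<^esub> \<one>\<^bsub>R\<^esub>,
      zero = fraction R W \<zero>\<^bsub>R\<^esub> \<one>\<^bsub>R\<^esub>,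
      add = (\<lambda>X Y. \<Union>(a, s)\<in>X. \<Union>(b, t)\<in>Y.
               fraction R W (a \<otimes>\<^bsub>R\<^esub> t \<oplus>\<^bsub>R\<^esub> b \<otimes>\<^bsub>R\<^esub> s) (s \<otimes>\<^bsub>R\<^esub> t))\<rparr>"

definition localization :: "('a, 'b) ring_scheme \<Rightarrow> 'a set \<Rightarrow> ('a \<times> 'a) set ring" where
  "localization R P = fraction_ring R (carrier R - P)"

definition localization_map :: "('a, 'b) ring_scheme \<Rightarrow> 'a set \<Rightarrow> 'a \<Rightarrow> ('a \<times> 'a) set" where
  "localization_map R P a = fraction R (carrier R - P) a \<one>\<^bsub>R\<^esub>"

text \<open>\<open>extend_contract R P J\<close> is the preimage in \<open>R\<close> of the extension of \<open>J\<close> to the localization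
  at \<open>P\<close>.\<close>

definition extend_contract :: "('a, 'b) ring_scheme \<Rightarrow> 'a set \<Rightarrow> 'a set \<Rightarrow> 'a set" where
  "extend_contract R P J = {a \<in> carrier R.
     localization_map R P a \<in> Idl\<^bsub>localization R P\<^esub> (localization_map R P ` J)}"

text \<open>The intersection with \<open>carrier R\<close> only matters when there are no associated primes.\<close>

definition symbolic_power :: "('a, 'b) ring_scheme \<Rightarrow> 'a set \<Rightarrow> nat \<Rightarrow> 'a set" where
  "symbolic_power R I m = carrier R \<inter>
     (\<Inter>P \<in> associated_primes R (quotient_module R (carrier R) I).
        extend_contract R P (ideal_power R I m))"


section \<open>The standard graded polynomial ring\<close>

text \<open>A polynomial maps exponent vectors to coefficients. The polynomial ring in the variables
  \<open>x\<^sub>0, \<dots>, x\<^sub>N\<^sub>-\<^sub>1\<close> consists of the polynomials in countably many variables in which no other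
  variable occurs.\<close>

type_synonym 'k mpol = "(nat \<Rightarrow>\<^sub>0 nat) \<Rightarrow>\<^sub>0 'k"

definition mpol_ring :: "nat \<Rightarrow> ('k::field mpol) ring" where
  "mpol_ring N = \<lparr>carrier = {f. \<forall>e \<in> Poly_Mapping.keys f. Poly_Mapping.keys e \<subseteq> {..<N}},
     monoid.mult = (*), one = 1, zero = 0, add = (+)\<rparr>"

definition mpol_var :: "nat \<Rightarrow> 'k::field mpol" where
  "mpol_var i = Poly_Mapping.single (Poly_Mapping.single i 1) 1"

definition exponent_degree :: "(nat \<Rightarrow>\<^sub>0 nat) \<Rightarrow> nat" where
  "exponent_degree e = (\<Sum>i \<in> Poly_Mapping.keys e. Poly_Mapping.lookup e i)"

text \<open>Forms of degree \<open>d\<close>; as usual, \<open>0\<close> counts as a form of every degree.\<close>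

definition form_of_degree :: "nat \<Rightarrow> 'k::field mpol \<Rightarrow> bool" where
  "form_of_degree d f \<longleftrightarrow> (\<forall>e \<in> Poly_Mapping.keys f. exponent_degree e = d)"

definition homogeneous_ideal :: "nat \<Rightarrow> ('k::field mpol) set \<Rightarrow> bool" where
  "homogeneous_ideal N I \<longleftrightarrow> (\<exists>G \<subseteq> carrier (mpol_ring N).
     (\<forall>g \<in> G. \<exists>d. form_of_degree d g) \<and> I = Idl\<^bsub>mpol_ring N\<^esub> G)"

definition irrelevant_ideal :: "nat \<Rightarrow> ('k::field mpol) set" where
  "irrelevant_ideal N = Idl\<^bsub>mpol_ring N\<^esub> (mpol_var ` {..<N})"

end

theory Submission
  imports
    Defs
    "HOL-Algebra.Algebraic_Closure_Type"
    "HOL-Computational_Algebra.Polynomial"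
    "HOL-Computational_Algebra.Fraction_Field"
begin

text \<open>Since \<open>S/I\<close> is reduced with Hilbert function \<open>1, N, N\<close> in degrees \<open>0, 1, 2\<close>, some linear form
  \<open>l\<close> multiplies degree \<open>1\<close> isomorphically onto degree \<open>2\<close>. Dehomogenizing by \<open>l\<close> turns the linear
  forms into a reduced algebra of dimension \<open>N\<close>. Over the perfect field \<open>k\<close> its elements have
  separable minimal polynomials, so over the algebraic closure Lagrange interpolation produces enough
  common zeros of \<open>I\<close> to span the whole space. In coordinates dual to \<open>N\<close> independent zeros, \<open>I\<close>
  becomes the monomial ideal generated by all \<open>X\<^sub>i X\<^sub>j\<close> with \<open>i \<noteq> j\<close>.

  In this model \<open>I\<^sup>m\<close> consists of the elements of \<open>I\<^bsup>(m)\<^esup>\<close> of order at least \<open>2 m\<close>, while the least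
  degree of an element of \<open>I\<^bsup>(m)\<^esup>\<close> is \<open>2 m - t\<close> with \<open>t = \<lfloor>m (N - 2) / (N - 1)\<rfloor>\<close>. As orders are
  additive, the annihilator consists of the elements of order at least \<open>t\<close>. Everything descends
  from the algebraic closure to \<open>k\<close> along a \<open>k\<close>-linear retraction.\<close>

text \<open>The \<open>N\<close> zeros need not be rational over the base field, so \<open>I\<close>
  need not be monomial in any coordinates over it. What can descend is the order of a polynomial:
  neither a linear change of coordinates nor an extension of scalars alters it, and the annihilator
  is described by orders alone. The retraction is not multiplicative, but it is linear over the
  polynomials with coefficients in the base field, and that is enough to bring ideal membership
  down.

  The isomorphism from degree 1 to degree 2 is a count: there are \<open>N + (N choose 2)\<close>
  quadratic monomials, the independent generators account for \<open>N choose 2\<close>, and the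
  products of \<open>l\<close> with the variables for the other \<open>N\<close>. Perfectness
  guarantees that squarefree polynomials keep distinct roots in the algebraic closure.

  The floor comes from exponents: \<open>e\<close> belongs to the \<open>m\<close>-th symbolic power
  of the model when \<open>|e| - e_i >= m\<close> for every \<open>i < N\<close>. Adding these
  inequalities gives \<open>(N - 1) |e| >= N m\<close>, that is
  \<open>|e| >= 2 m - m (N - 2) / (N - 1)\<close>. Nearly constant exponents attain the rounded
  bound.\<close>

abbreviation keys :: "('a \<Rightarrow>\<^sub>0 'b::zero) \<Rightarrow> 'a set" where "keys \<equiv> Poly_Mapping.keys"
abbreviation lookup :: "('a \<Rightarrow>\<^sub>0 'b::zero) \<Rightarrow> 'a \<Rightarrow> 'b" where "lookup \<equiv> Poly_Mapping.lookup"
abbreviation term_of :: "(nat \<Rightarrow>\<^sub>0 nat) \<Rightarrow> 'b::zero \<Rightarrow> (nat \<Rightarrow>\<^sub>0 nat) \<Rightarrow>\<^sub>0 'b" where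
  "term_of \<equiv> Poly_Mapping.single"
abbreviation var_exp :: "nat \<Rightarrow> nat \<Rightarrow>\<^sub>0 nat" where "var_exp i \<equiv> Poly_Mapping.single i 1"
abbreviation const :: "'b::zero \<Rightarrow> (nat \<Rightarrow>\<^sub>0 nat) \<Rightarrow>\<^sub>0 'b" where "const \<equiv> term_of 0"
abbreviation polys :: "nat \<Rightarrow> 'k::field mpol set" where "polys N \<equiv> carrier (mpol_ring N)"

section \<open>Polynomials as sums of terms\<close>

lemma sum_terms:
  fixes f :: "_ \<Rightarrow>\<^sub>0 'a::comm_monoid_add"
  shows "(\<Sum>e\<in>keys f. term_of e (lookup f e)) = f"
proof (rule poly_mapping_eqI)
  fix k
  have "lookup (\<Sum>e\<in>keys f. term_of e (lookup f e)) k = (\<Sum>e\<in>keys f. if e = k then lookup f e else 0)"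
    by (simp add: lookup_sum lookup_single when_def)
  also have "\<dots> = lookup f k" by (auto simp: sum.delta in_keys_iff)
  finally show "lookup (\<Sum>e\<in>keys f. term_of e (lookup f e)) k = lookup f k" .
qed

lemma poly_induct_terms [case_names zero plus]:
  fixes f :: "_ \<Rightarrow>\<^sub>0 'a::comm_monoid_add"
  assumes "P 0" "\<And>e c f. P f \<Longrightarrow> P (term_of e c + f)"
  shows "P f"
proof -
  have "P (\<Sum>e\<in>A. term_of e (lookup f e))" if "finite A" for A
    using that by induction (auto intro: assms)
  from this[of "keys f"] show ?thesis by (simp add: sum_terms)
qed

lemma const_mult_lookup: "lookup (const c * f) e = c * lookup f e"
  for c :: "'a::comm_ring_1"
  by (simp add: mult_map_scale_conv_mult[symmetric] Poly_Mapping.map.rep_eq when_def)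

lemma const_1 [simp]: "const 1 = 1" by simp
lemma const_mult: "const (a * b) = const a * const b" for a b :: "'a::comm_ring_1"
  by (simp add: mult_single)
lemma const_add: "const (a + b) = const a + const b" for a b :: "'a::comm_ring_1"
  by (simp add: single_add)

section \<open>Polynomials in the first variables\<close>

lemma polys_iff: "f \<in> polys N \<longleftrightarrow> (\<forall>e\<in>keys f. keys e \<subseteq> {..<N})"
  by (simp add: mpol_ring_def)

lemma polys_add [intro]: "f \<in> polys N \<Longrightarrow> g \<in> polys N \<Longrightarrow> f + g \<in> polys N"
  using keys_add[of f g] by (auto simp: polys_iff)
lemma polys_uminus [intro]: "f \<in> polys N \<Longrightarrow> - f \<in> polys N"
  by (auto simp: polys_iff keys_minus)
lemma polys_diff [intro]: "f \<in> polys N \<Longrightarrow> g \<in> polys N \<Longrightarrow> f - g \<in> polys N"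
  using polys_add[of f N "- g"] by auto
lemma polys_0 [simp, intro]: "0 \<in> polys N" by (simp add: polys_iff)
lemma polys_1 [simp, intro]: "1 \<in> polys N" by (auto simp: polys_iff)
lemma polys_mult [intro]: "f \<in> polys N \<Longrightarrow> g \<in> polys N \<Longrightarrow> f * g \<in> polys N"
proof (unfold polys_iff, safe)
  fix e x assume *: "\<forall>e\<in>keys f. keys e \<subseteq> {..<N}" "\<forall>e\<in>keys g. keys e \<subseteq> {..<N}"
    "e \<in> keys (f * g)" "x \<in> keys e"
  then obtain a b where "a \<in> keys f" "b \<in> keys g" "e = a + b" using keys_mult[of f g] by auto
  with * show "x < N" using keys_add[of a b] by fastforce
qed
lemma polys_sum [intro]: "(\<And>i. i \<in> A \<Longrightarrow> f i \<in> polys N) \<Longrightarrow> (\<Sum>i\<in>A. f i) \<in> polys N"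
  by (induction A rule: infinite_finite_induct) auto
lemma polys_prod [intro]: "(\<And>i. i \<in> A \<Longrightarrow> f i \<in> polys N) \<Longrightarrow> (\<Prod>i\<in>A. f i) \<in> polys N"
  by (induction A rule: infinite_finite_induct) auto
lemma polys_power [intro]: "f \<in> polys N \<Longrightarrow> f ^ n \<in> polys N"
  by (induction n) auto
lemma polys_term [intro]: "keys e \<subseteq> {..<N} \<Longrightarrow> term_of e c \<in> polys N"
  by (auto simp: polys_iff)
lemma polys_const [simp, intro]: "const c \<in> polys N" by (auto simp: polys_iff)
lemma polys_var [intro]: "i < N \<Longrightarrow> mpol_var i \<in> polys N"
  by (auto simp: mpol_var_def polys_iff)

lemma mpol_ring_simps [simp]:
  "a \<otimes>\<^bsub>mpol_ring N\<^esub> b = a * b" "a \<oplus>\<^bsub>mpol_ring N\<^esub> b = a + b"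
  "\<one>\<^bsub>mpol_ring N\<^esub> = 1" "\<zero>\<^bsub>mpol_ring N\<^esub> = 0"
  by (simp_all add: mpol_ring_def)

lemma cring_mpol_ring: "cring (mpol_ring N :: 'k::field mpol ring)"
proof (rule cringI)
  show "abelian_group (mpol_ring N :: 'k mpol ring)"
  proof (rule abelian_groupI, goal_cases)
    case (6 x)
    then show ?case by (intro bexI[of _ "- x"]) auto
  qed (auto simp: algebra_simps)
  show "comm_monoid (mpol_ring N :: 'k mpol ring)"
    by (rule comm_monoidI) (auto simp: algebra_simps)
qed (auto simp: algebra_simps)

lemma mpol_ring_minus: "a \<in> polys N \<Longrightarrow> \<ominus>\<^bsub>mpol_ring N\<^esub> a = - a"
  by (metis add.commute add.right_inverse cring.axioms(1) cring_mpol_ring mpol_ring_simps(2,4)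
      polys_uminus ring.ring_simprules(16) abelian_group.minus_equality ring_def)

lemma mpol_ring_pow: "a [^]\<^bsub>mpol_ring N\<^esub> (n::nat) = a ^ n"
  by (induction n) (auto simp: nat_pow_def mult.commute)

text \<open>This passes from the record-based notion of ideal to the operations of the polynomial
  type. Negation is multiplication by \<open>- 1\<close>, so the additive subgroup needs no clause
  for inverses.\<close>

lemma ideal_mpol_ring_iff:
  "ideal J (mpol_ring N) \<longleftrightarrow> J \<subseteq> polys N \<and> 0 \<in> J \<and> (\<forall>f\<in>J. \<forall>g\<in>J. f + g \<in> J) \<and>
     (\<forall>r\<in>polys N. \<forall>f\<in>J. r * f \<in> J)" (is "?L \<longleftrightarrow> ?R")
proof
  assume ?L
  then interpret ideal J "mpol_ring N" .
  have "0 \<in> J" using additive_subgroup.zero_closed[OF additive_subgroup_axioms] by simp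
  moreover have "f + g \<in> J" if "f \<in> J" "g \<in> J" for f g 
    using additive_subgroup.a_closed[OF additive_subgroup_axioms that] by simp
  moreover have "r * f \<in> J" if "r \<in> polys N" "f \<in> J" for r f using I_l_closed[OF that(2,1)] by simp
  ultimately show ?R using a_subset by blast
next
  assume R: ?R
  have un: "- f \<in> J" if "f \<in> J" for f
    using R that by (metis mult_minus1 polys_1 polys_uminus)
  show ?L
  proof (rule idealI)
    show "ring (mpol_ring N)" using cring_mpol_ring cring.axioms(1) by blast
    show "subgroup J (add_monoid (mpol_ring N))"
    proof (rule group.subgroupI)
      show "Group.group (add_monoid (mpol_ring N))"
        using cring_mpol_ring by (meson abelian_group.a_group cring.axioms(1) ring_def)
      fix a assume a: "a \<in> J"
      then have "\<ominus>\<^bsub>mpol_ring N\<^esub> a = - a" using R mpol_ring_minus by blast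
      then show "inv\<^bsub>add_monoid (mpol_ring N)\<^esub> a \<in> J" using un[OF a] by (simp add: a_inv_def)
    qed (use R in auto)
    show "a \<otimes>\<^bsub>mpol_ring N\<^esub> x \<in> J" if "a \<in> J" "x \<in> polys N" for a x
      using R that by (simp add: mult.commute[of a x])
  qed (use R in auto)
qed

lemma
  assumes "ideal J (mpol_ring N)"
  shows ideal_subset: "J \<subseteq> polys N" and ideal_zero: "0 \<in> J"
    and ideal_add: "f \<in> J \<Longrightarrow> g \<in> J \<Longrightarrow> f + g \<in> J"
    and ideal_mult: "r \<in> polys N \<Longrightarrow> f \<in> J \<Longrightarrow> r * f \<in> J"
    and ideal_uminus: "f \<in> J \<Longrightarrow> - f \<in> J"
    and ideal_diff: "f \<in> J \<Longrightarrow> g \<in> J \<Longrightarrow> f - g \<in> J"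
    and ideal_sum: "(\<And>i. i \<in> A \<Longrightarrow> u i \<in> J) \<Longrightarrow> (\<Sum>i\<in>A. u i) \<in> J"
proof -
  note * = assms[unfolded ideal_mpol_ring_iff]
  show "J \<subseteq> polys N" "0 \<in> J" "f \<in> J \<Longrightarrow> g \<in> J \<Longrightarrow> f + g \<in> J"
    "r \<in> polys N \<Longrightarrow> f \<in> J \<Longrightarrow> r * f \<in> J" using * by auto
  have un: "f \<in> J \<Longrightarrow> - f \<in> J" for f using * by (metis mult_minus1 polys_1 polys_uminus)
  then show "f \<in> J \<Longrightarrow> - f \<in> J" .
  show "f \<in> J \<Longrightarrow> g \<in> J \<Longrightarrow> f - g \<in> J" using * un[of g] by (metis diff_conv_add_uminus)
  show "(\<And>i. i \<in> A \<Longrightarrow> u i \<in> J) \<Longrightarrow> (\<Sum>i\<in>A. u i) \<in> J"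
    using * by (induction A rule: infinite_finite_induct) auto
qed

section \<open>Weights\<close>

text \<open>Total degree and the degree in all variables but one are treated together. Additivity
  makes the sets \<open>weight_ge w n\<close> a multiplicative filtration, and over a domain one in
  which orders add.\<close>

definition additive_weight :: "((nat \<Rightarrow>\<^sub>0 nat) \<Rightarrow> nat) \<Rightarrow> bool" where
  "additive_weight w \<longleftrightarrow> w 0 = 0 \<and> (\<forall>a b. w (a + b) = w a + w b)"

definition weight_ge :: "((nat \<Rightarrow>\<^sub>0 nat) \<Rightarrow> nat) \<Rightarrow> nat \<Rightarrow> ((nat \<Rightarrow>\<^sub>0 nat) \<Rightarrow>\<^sub>0 'a::zero) set" where
  "weight_ge w n = {f. \<forall>e\<in>keys f. n \<le> w e}"

definition weight_eq :: "((nat \<Rightarrow>\<^sub>0 nat) \<Rightarrow> nat) \<Rightarrow> nat \<Rightarrow> ((nat \<Rightarrow>\<^sub>0 nat) \<Rightarrow>\<^sub>0 'a::zero) set" where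
  "weight_eq w n = {f. \<forall>e\<in>keys f. w e = n}"

definition part :: "((nat \<Rightarrow>\<^sub>0 nat) \<Rightarrow> nat) \<Rightarrow> nat \<Rightarrow> ((nat \<Rightarrow>\<^sub>0 nat) \<Rightarrow>\<^sub>0 'a::comm_ring_1) \<Rightarrow> (nat \<Rightarrow>\<^sub>0 nat) \<Rightarrow>\<^sub>0 'a" where
  "part w n f = (\<Sum>e\<in>{e\<in>keys f. w e = n}. term_of e (lookup f e))"

abbreviation forms :: "nat \<Rightarrow> ((nat \<Rightarrow>\<^sub>0 nat) \<Rightarrow>\<^sub>0 'a::zero) set" where
  "forms \<equiv> weight_eq exponent_degree"
abbreviation order_ge :: "nat \<Rightarrow> ((nat \<Rightarrow>\<^sub>0 nat) \<Rightarrow>\<^sub>0 'a::zero) set" where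
  "order_ge \<equiv> weight_ge exponent_degree"
abbreviation form_part :: "nat \<Rightarrow> ((nat \<Rightarrow>\<^sub>0 nat) \<Rightarrow>\<^sub>0 'a::comm_ring_1) \<Rightarrow> (nat \<Rightarrow>\<^sub>0 nat) \<Rightarrow>\<^sub>0 'a" where
  "form_part \<equiv> part exponent_degree"

lemma lookup_part: "lookup (part w n f) e = (if w e = n then lookup f e else 0)"
proof -
  have "lookup (part w n f) e = (\<Sum>k\<in>{e\<in>keys f. w e = n}. if k = e then lookup f k else 0)"
    by (simp add: lookup_sum lookup_single when_def part_def)
  also have "\<dots> = (if w e = n then lookup f e else 0)" by (auto simp: sum.delta in_keys_iff)
  finally show ?thesis .
qed

lemma keys_part: "keys (part w n f) = {e\<in>keys f. w e = n}"
  by (auto simp: in_keys_iff lookup_part split: if_splits)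

lemma part_add: "part w n (f + g) = part w n f + part w n g"
  by (rule poly_mapping_eqI) (simp add: lookup_part lookup_add)
lemma part_0 [simp]: "part w n 0 = 0"
  by (rule poly_mapping_eqI) (simp add: lookup_part)
lemma part_sum: "part w n (\<Sum>i\<in>A. f i) = (\<Sum>i\<in>A. part w n (f i))"
  by (induction A rule: infinite_finite_induct) (auto simp: part_add)
lemma part_weight_eq: "f \<in> weight_eq w m \<Longrightarrow> part w n f = (if n = m then f else 0)"
  by (rule poly_mapping_eqI) (auto simp: lookup_part weight_eq_def in_keys_iff)
lemma part_in_weight_eq: "part w n f \<in> weight_eq w n"
  by (simp add: weight_eq_def keys_part)
lemma part_polys: "f \<in> polys N \<Longrightarrow> part w n f \<in> polys N"
  by (simp add: polys_iff keys_part)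

lemma sum_parts: "finite A \<Longrightarrow> w ` keys f \<subseteq> A \<Longrightarrow> (\<Sum>n\<in>A. part w n f) = f"
  by (rule poly_mapping_eqI) (force simp: lookup_sum lookup_part in_keys_iff)

lemma sum_parts': "(\<Sum>n\<in>w ` keys f. part w n f) = f"
  by (rule sum_parts) auto

lemma weight_eq_0 [simp]: "0 \<in> weight_eq w n" by (simp add: weight_eq_def)
lemma weight_eq_add: "f \<in> weight_eq w n \<Longrightarrow> g \<in> weight_eq w n \<Longrightarrow> f + g \<in> weight_eq w n"
  using keys_add[of f g] by (auto simp: weight_eq_def)
lemma weight_eq_sum: "(\<And>i. i \<in> A \<Longrightarrow> f i \<in> weight_eq w n) \<Longrightarrow> (\<Sum>i\<in>A. f i) \<in> weight_eq w n"
  by (induction A rule: infinite_finite_induct) (auto intro: weight_eq_add)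
lemma weight_eq_uminus: "f \<in> weight_eq w n \<Longrightarrow> - f \<in> weight_eq w n"
  by (simp add: weight_eq_def keys_minus)
lemma weight_eq_diff: "f \<in> weight_eq w n \<Longrightarrow> g \<in> weight_eq w n \<Longrightarrow> f - g \<in> weight_eq w n"
  for f g :: "(nat \<Rightarrow>\<^sub>0 nat) \<Rightarrow>\<^sub>0 'a::comm_ring_1"
  using weight_eq_add[of f w n "- g"] weight_eq_uminus[of g] by simp
lemma weight_ge_0 [simp]: "0 \<in> weight_ge w n" by (simp add: weight_ge_def)
lemma weight_ge_add: "f \<in> weight_ge w n \<Longrightarrow> g \<in> weight_ge w n \<Longrightarrow> f + g \<in> weight_ge w n"
  using keys_add[of f g] by (auto simp: weight_ge_def)
lemma weight_ge_sum: "(\<And>i. i \<in> A \<Longrightarrow> f i \<in> weight_ge w n) \<Longrightarrow> (\<Sum>i\<in>A. f i) \<in> weight_ge w n"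
  by (induction A rule: infinite_finite_induct) (auto intro: weight_ge_add)
lemma weight_ge_mono: "f \<in> weight_ge w n \<Longrightarrow> m \<le> n \<Longrightarrow> f \<in> weight_ge w m"
  by (auto simp: weight_ge_def)
lemma weight_eq_imp_ge: "f \<in> weight_eq w n \<Longrightarrow> f \<in> weight_ge w n"
  by (auto simp: weight_eq_def weight_ge_def)
lemma weight_ge_zero [simp]: "f \<in> weight_ge w 0" by (simp add: weight_ge_def)

context
  fixes w assumes w: "additive_weight w"
begin

lemma weight_add: "w (a + b) = w a + w b" using w by (simp add: additive_weight_def)

lemma weight_eq_mult: "f \<in> weight_eq w n \<Longrightarrow> g \<in> weight_eq w m \<Longrightarrow> f * g \<in> weight_eq w (n + m)"
  using keys_mult[of f g] weight_add by (fastforce simp: weight_eq_def)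
lemma weight_ge_mult: "f \<in> weight_ge w n \<Longrightarrow> g \<in> weight_ge w m \<Longrightarrow> f * g \<in> weight_ge w (n + m)"
  using keys_mult[of f g] by (force simp: weight_ge_def weight_add intro: add_mono)
lemma weight_eq_const: "const c \<in> weight_eq w 0"
  using w by (simp add: weight_eq_def additive_weight_def)
lemma weight_eq_const_mult: "g \<in> weight_eq w m \<Longrightarrow> const c * g \<in> weight_eq w m"
  using weight_eq_mult[OF weight_eq_const, of g m c] by simp
lemma weight_eq_one: "1 \<in> weight_eq w 0"
  using w by (simp add: weight_eq_def additive_weight_def)
lemma weight_eq_power: "f \<in> weight_eq w n \<Longrightarrow> f ^ k \<in> weight_eq w (k * n)"
  by (induction k) (auto intro: weight_eq_mult weight_eq_one)
lemma weight_eq_prod: "(\<And>i. i \<in> A \<Longrightarrow> f i \<in> weight_eq w (n i)) \<Longrightarrow>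
    (\<Prod>i\<in>A. f i) \<in> weight_eq w (\<Sum>i\<in>A. n i)"
  by (induction A rule: infinite_finite_induct) (auto intro: weight_eq_mult weight_eq_one)

lemma part_mult_homogeneous:
  assumes "g \<in> weight_eq w d"
  shows "part w n (g * f) = (if d \<le> n then g * part w (n - d) f else 0)"
proof -
  have "part w n (g * f) = part w n (g * (\<Sum>i\<in>w ` keys f. part w i f))"
    by (simp add: sum_parts')
  also have "\<dots> = (\<Sum>i\<in>w ` keys f. part w n (g * part w i f))"
    by (simp add: sum_distrib_left part_sum)
  also have "\<dots> = (\<Sum>i\<in>w ` keys f. if n = d + i then g * part w i f else 0)"
    by (rule sum.cong) (auto simp: part_weight_eq[OF weight_eq_mult[OF assms part_in_weight_eq]])
  also have "\<dots> = (\<Sum>i\<in>w ` keys f. if i = n - d then (if d \<le> n then g * part w (n - d) f else 0) else 0)"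
    by (rule sum.cong) auto
  also have "\<dots> = (if n - d \<in> w ` keys f then (if d \<le> n then g * part w (n - d) f else 0) else 0)"
    by (simp add: sum.delta)
  also have "\<dots> = (if d \<le> n then g * part w (n - d) f else 0)"
  proof -
    have "part w (n - d) f = 0" if "n - d \<notin> w ` keys f"
      using that keys_part[of w "n - d" f] by (metis (mono_tags, lifting) empty_Collect_eq image_eqI keys_eq_empty)
    then show ?thesis by auto
  qed
  finally show ?thesis .
qed

text \<open>Orders add over a domain: the product of the lowest parts of \<open>f\<close> and
  \<open>g\<close> is nonzero, and the remaining terms of \<open>f * g\<close> have larger weight
  and cannot cancel it. With the degree this bounds the annihilator from above; with
  \<open>off_weight i\<close> it makes the ideals of the points prime and removes denominators in
  symbolic powers.\<close>

lemma weight_ge_cancel: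
  fixes f g :: "(nat \<Rightarrow>\<^sub>0 nat) \<Rightarrow>\<^sub>0 'a::idom"
  assumes fg: "f * g \<in> weight_ge w (a + n)" and f: "f \<notin> weight_ge w (Suc a)"
  shows "g \<in> weight_ge w n"
proof (cases "g = 0")
  case False
  from f obtain e where e: "e \<in> keys f" "w e \<le> a" by (auto simp: weight_ge_def not_less_eq_eq)
  define i where "i = Min (w ` keys f)"
  define j where "j = Min (w ` keys g)"
  have ne: "keys f \<noteq> {}" "keys g \<noteq> {}" using e False by auto
  have i: "i \<in> w ` keys f" "\<And>e. e \<in> keys f \<Longrightarrow> i \<le> w e" unfolding i_def using ne by auto
  have j: "j \<in> w ` keys g" "\<And>e. e \<in> keys g \<Longrightarrow> j \<le> w e" unfolding j_def using ne by auto
  have "i \<le> a" using i(2)[OF e(1)] e(2) by simp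
  define f1 where "f1 = f - part w i f"
  define g1 where "g1 = g - part w j g"
  have f1: "f1 \<in> weight_ge w (Suc i)"
    using i by (auto simp: weight_ge_def f1_def in_keys_iff lookup_minus lookup_part Suc_le_eq
        order_less_le split: if_splits)
  have g1: "g1 \<in> weight_ge w (Suc j)"
    using j by (auto simp: weight_ge_def g1_def in_keys_iff lookup_minus lookup_part Suc_le_eq
        order_less_le split: if_splits)
  have "part w i f \<noteq> 0" "part w j g \<noteq> 0"
    using i(1) j(1) keys_part[of w i f] keys_part[of w j g] by force+
  then have "part w i f * part w j g \<noteq> 0" by simp
  then obtain k where k: "k \<in> keys (part w i f * part w j g)" by (metis equals0I keys_eq_empty)
  have wk: "w k = i + j"
    using k weight_eq_mult[OF part_in_weight_eq part_in_weight_eq, of i f j g] by (auto simp: weight_eq_def)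
  have "f1 * g + part w i f * g1 \<in> weight_ge w (Suc (i + j))"
  proof (rule weight_ge_add)
    have "g \<in> weight_ge w j" using j by (auto simp: weight_ge_def)
    from weight_ge_mult[OF f1 this] show "f1 * g \<in> weight_ge w (Suc (i + j))" by simp
    from weight_ge_mult[OF weight_eq_imp_ge[OF part_in_weight_eq] g1, of i f]
    show "part w i f * g1 \<in> weight_ge w (Suc (i + j))" by simp
  qed
  then have "lookup (f1 * g + part w i f * g1) k = 0"
    using wk unfolding weight_ge_def by (metis (no_types, lifting) Suc_n_not_le_n in_keys_iff mem_Collect_eq)
  moreover have "f * g = part w i f * part w j g + (f1 * g + part w i f * g1)"
    by (simp add: f1_def g1_def algebra_simps)
  ultimately have "lookup (f * g) k \<noteq> 0" using k by (simp add: lookup_add in_keys_iff)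
  then have "k \<in> keys (f * g)" by (simp add: in_keys_iff)
  then have "a + n \<le> i + j" using fg wk by (auto simp: weight_ge_def)
  then have "n \<le> j" using \<open>i \<le> a\<close> by simp
  then show ?thesis using j(2) by (auto simp: weight_ge_def intro: order_trans)
qed auto

end

lemma exponent_degree_sum: "finite A \<Longrightarrow> keys e \<subseteq> A \<Longrightarrow> exponent_degree e = (\<Sum>i\<in>A. lookup e i)"
  unfolding exponent_degree_def by (rule sum.mono_neutral_left) (auto simp: in_keys_iff)

lemma exponent_degree_add: "exponent_degree (a + b) = exponent_degree a + exponent_degree b"
  using keys_add[of a b]
  by (simp add: exponent_degree_sum[of "keys a \<union> keys b"] lookup_add sum.distrib)

lemma lookup_le_exponent_degree: "lookup e i \<le> exponent_degree e"
proof -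
  have "exponent_degree e = (\<Sum>j\<in>insert i (keys e). lookup e j)"
    by (rule exponent_degree_sum) auto
  then show ?thesis by (simp add: sum.insert_remove)
qed

lemma exponent_degree_single [simp]: "exponent_degree (Poly_Mapping.single i n) = n"
  by (simp add: exponent_degree_def)

lemma additive_weight_degree: "additive_weight exponent_degree"
  by (simp add: additive_weight_def exponent_degree_add) (simp add: exponent_degree_def)

text \<open>\<open>weight_ge (off_weight i) m\<close> is the \<open>m\<close>-th power of the prime ideal generated by the variables
  other than the \<open>i\<close>-th.\<close>

definition off_weight :: "nat \<Rightarrow> (nat \<Rightarrow>\<^sub>0 nat) \<Rightarrow> nat" where
  "off_weight i e = exponent_degree e - lookup e i"

text \<open>The subtraction in \<open>off_weight\<close> never truncates, because a single entry is
  at most the whole degree.\<close>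

lemma additive_weight_off: "additive_weight (off_weight i)"
proof -
  have "off_weight i (a + b) = off_weight i a + off_weight i b" for a b
    using lookup_le_exponent_degree[of a i] lookup_le_exponent_degree[of b i]
    by (simp add: off_weight_def exponent_degree_add lookup_add)
  then show ?thesis by (simp add: additive_weight_def) (simp add: off_weight_def exponent_degree_def)
qed

lemma form_of_degree_iff: "form_of_degree d f \<longleftrightarrow> f \<in> forms d"
  by (simp add: form_of_degree_def weight_eq_def)

lemmas forms_mult = weight_eq_mult[OF additive_weight_degree]
  and forms_power = weight_eq_power[OF additive_weight_degree]
  and forms_const_mult = weight_eq_const_mult[OF additive_weight_degree]
  and order_ge_mult = weight_ge_mult[OF additive_weight_degree]

lemma mpol_var_form: "mpol_var i \<in> forms 1"
  by (simp add: mpol_var_def weight_eq_def)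

section \<open>Substitution\<close>

definition monomial_value :: "(nat \<Rightarrow> 'b::comm_ring_1) \<Rightarrow> (nat \<Rightarrow>\<^sub>0 nat) \<Rightarrow> 'b" where
  "monomial_value v e = (\<Prod>i\<in>keys e. v i ^ lookup e i)"

text \<open>With \<open>h\<close> acting on coefficients and \<open>v\<close> on variables, one
  construction serves evaluation at points, extension of scalars and linear changes of
  coordinates.\<close>

definition subst :: "('a::zero \<Rightarrow> 'b::comm_ring_1) \<Rightarrow> (nat \<Rightarrow> 'b) \<Rightarrow> 'a mpol \<Rightarrow> 'b" where
  "subst h v f = (\<Sum>e\<in>keys f. h (lookup f e) * monomial_value v e)"

abbreviation value_at :: "(nat \<Rightarrow> 'b::comm_ring_1) \<Rightarrow> 'b mpol \<Rightarrow> 'b" where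
  "value_at \<equiv> subst (\<lambda>c. c)"

definition ring_map :: "('a::comm_ring_1 \<Rightarrow> 'b::comm_ring_1) \<Rightarrow> bool" where
  "ring_map h \<longleftrightarrow> h 0 = 0 \<and> h 1 = 1 \<and> (\<forall>a b. h (a + b) = h a + h b) \<and> (\<forall>a b. h (a * b) = h a * h b)"

lemma monomial_value_superset: "finite A \<Longrightarrow> keys e \<subseteq> A \<Longrightarrow> monomial_value v e = (\<Prod>i\<in>A. v i ^ lookup e i)"
  unfolding monomial_value_def by (rule prod.mono_neutral_left) (auto simp: in_keys_iff)

lemma monomial_value_add: "monomial_value v (a + b) = monomial_value v a * monomial_value v b"
  using keys_add[of a b]
  by (simp add: monomial_value_superset[of "keys a \<union> keys b"] lookup_add power_add prod.distrib)

lemma monomial_value_0 [simp]: "monomial_value v 0 = 1"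
  by (simp add: monomial_value_def)

lemma monomial_value_single [simp]: "monomial_value v (Poly_Mapping.single i n) = v i ^ n"
  by (cases "n = 0") (auto simp: monomial_value_def)

context
  fixes h :: "'a::comm_ring_1 \<Rightarrow> 'b::comm_ring_1"
  assumes h: "ring_map h"
begin

lemma ring_map_simps: "h 0 = 0" "h 1 = 1" "h (a + b) = h a + h b" "h (a * b) = h a * h b"
  using h by (auto simp: ring_map_def)

lemma ring_map_minus: "h (- a) = - h a"
  using ring_map_simps(3)[of a "- a"] by (simp add: ring_map_simps(1) eq_neg_iff_add_eq_0 add.commute)

lemma ring_map_sum: "h (\<Sum>i\<in>A. f i) = (\<Sum>i\<in>A. h (f i))"
  by (induction A rule: infinite_finite_induct) (auto simp: ring_map_simps)

lemma ring_map_power: "h (a ^ n) = h a ^ n"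
  by (induction n) (auto simp: ring_map_simps)

lemma ring_map_prod: "h (\<Prod>i\<in>A. f i) = (\<Prod>i\<in>A. h (f i))"
  by (induction A rule: infinite_finite_induct) (auto simp: ring_map_simps)

end

context
  fixes h :: "'a::field \<Rightarrow> 'b::comm_ring_1"
  assumes h: "ring_map h"
begin

lemmas h_simps = ring_map_simps[OF h]

lemma subst_superset: "finite A \<Longrightarrow> keys f \<subseteq> A \<Longrightarrow>
    subst h v f = (\<Sum>e\<in>A. h (lookup f e) * monomial_value v e)"
  unfolding subst_def by (rule sum.mono_neutral_left) (auto simp: in_keys_iff h_simps)

lemma subst_0 [simp]: "subst h v 0 = 0" by (simp add: subst_def)

lemma subst_term: "subst h v (term_of e c) = h c * monomial_value v e"
  by (simp add: subst_superset[of "{e}"])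

lemma subst_const [simp]: "subst h v (const c) = h c" by (simp add: subst_term)

lemma subst_1 [simp]: "subst h v 1 = 1"
  using subst_const[of v 1] by (simp only: const_1 h_simps)

lemma subst_var [simp]: "subst h v (mpol_var i) = v i"
  by (simp add: mpol_var_def subst_term h_simps)

lemma subst_add: "subst h v (f + g) = subst h v f + subst h v g"
  using keys_add[of f g]
  by (simp add: subst_superset[of "keys f \<union> keys g"] lookup_add h_simps sum.distrib distrib_right)

lemma subst_term_mult: "subst h v (term_of e c * g) = h c * monomial_value v e * subst h v g"
proof (induction g rule: poly_induct_terms)
  case (plus e' c' f)
  then show ?case
    by (simp add: distrib_left subst_add mult_single subst_term h_simps monomial_value_add mult_ac)
qed simp

lemma subst_mult: "subst h v (f * g) = subst h v f * subst h v g"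
proof (induction f rule: poly_induct_terms)
  case (plus e c f)
  then show ?case by (simp add: distrib_right subst_add subst_term_mult subst_term)
qed simp

lemma ring_map_subst: "ring_map (subst h v)"
  by (simp add: ring_map_def subst_add subst_mult)

lemma subst_cong_polys:
  assumes "f \<in> polys N" "\<And>i. i < N \<Longrightarrow> v i = v' i"
  shows "subst h v f = subst h v' f"
proof -
  have "v i = v' i" if "e \<in> keys f" "i \<in> keys e" for e i using assms that by (force simp: polys_iff)
  then show ?thesis by (simp add: subst_def monomial_value_def)
qed

end

lemma ring_map_comp_subst:
  fixes h :: "'a::field \<Rightarrow> 'b::comm_ring_1"
  assumes "ring_map h" "ring_map H"
  shows "H (subst h v f) = subst (\<lambda>c. H (h c)) (\<lambda>i. H (v i)) f"
  unfolding subst_def monomial_value_def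
  by (simp add: ring_map_sum[OF assms(2)] ring_map_simps[OF assms(2)] ring_map_prod[OF assms(2)]
      ring_map_power[OF assms(2)])

lemma ring_map_const: "ring_map (const :: 'a::comm_ring_1 \<Rightarrow> _)"
  by (simp add: ring_map_def const_add const_mult)

lemma ring_map_id: "ring_map (\<lambda>c. c)"
  by (simp add: ring_map_def)

lemma monomial_value_var: "monomial_value mpol_var e = term_of e 1"
proof -
  have *: "mpol_var i ^ n = term_of (Poly_Mapping.single i n) (1::'a)" for i n
    by (induction n) (auto simp: mpol_var_def mult_single single_add[symmetric])
  have "(\<Prod>i\<in>A. mpol_var i ^ lookup e i) = term_of (\<Sum>i\<in>A. Poly_Mapping.single i (lookup e i)) (1::'a)" if "finite A" for A
    using that by induction (auto simp: * mult_single)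
  moreover have "(\<Sum>i\<in>keys e. Poly_Mapping.single i (lookup e i)) = e"
  proof (rule poly_mapping_eqI)
    fix k
    have "lookup (\<Sum>i\<in>keys e. Poly_Mapping.single i (lookup e i)) k = (\<Sum>i\<in>keys e. if i = k then lookup e i else 0)"
      by (simp add: lookup_sum lookup_single when_def)
    also have "\<dots> = lookup e k" by (auto simp: sum.delta in_keys_iff)
    finally show "lookup (\<Sum>i\<in>keys e. Poly_Mapping.single i (lookup e i)) k = lookup e k" .
  qed
  ultimately show ?thesis by (simp add: monomial_value_def)
qed

lemma subst_id: "subst const mpol_var f = (f :: 'a::field mpol)"
proof (induction f rule: poly_induct_terms)
  case (plus e c f)
  have "subst const mpol_var (term_of e c) = term_of e c"
    by (simp add: subst_term[OF ring_map_const] monomial_value_var mult_single)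
  then show ?case using plus by (simp only: subst_add[OF ring_map_const])
qed (simp add: subst_0[OF ring_map_const])

lemma subst_polys:
  assumes "f \<in> polys N" "\<And>c. h c \<in> polys M" "\<And>i. i < N \<Longrightarrow> v i \<in> polys M"
  shows "subst h v f \<in> polys M"
  unfolding subst_def monomial_value_def
proof (intro polys_sum polys_mult polys_prod polys_power assms)
  fix e i assume "e \<in> keys f" "i \<in> keys e"
  then show "i < N" using assms(1) by (auto simp: polys_iff)
qed

lemma weight_eq_subst:
  assumes w: "additive_weight w" and f: "f \<in> polys N" "f \<in> forms d"
    and h: "\<And>c. h c \<in> weight_eq w 0" and v: "\<And>i. i < N \<Longrightarrow> v i \<in> weight_eq w 1"
  shows "subst h v f \<in> weight_eq w d"
  unfolding subst_def
proof (rule weight_eq_sum)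
  fix e assume e: "e \<in> keys f"
  have "monomial_value v e \<in> weight_eq w (\<Sum>i\<in>keys e. lookup e i * 1)"
    unfolding monomial_value_def
    by (intro weight_eq_prod[OF w] weight_eq_power[OF w] v) (use e f in \<open>auto simp: polys_iff\<close>)
  also have "(\<Sum>i\<in>keys e. lookup e i * 1) = d"
    using e f by (auto simp: weight_eq_def exponent_degree_def)
  finally show "h (lookup f e) * monomial_value v e \<in> weight_eq w d"
    using weight_eq_mult[OF w h] by force
qed

lemma weight_ge_subst:
  assumes w: "additive_weight w" and f: "f \<in> polys N" "f \<in> order_ge d"
    and h: "\<And>c. h c \<in> weight_eq w 0" and v: "\<And>i. i < N \<Longrightarrow> v i \<in> weight_eq w 1"
    and rh: "ring_map h"
  shows "subst h v f \<in> weight_ge w d"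
proof -
  have "subst h v f = (\<Sum>n\<in>exponent_degree ` keys f. subst h v (form_part n f))"
    by (subst (1) sum_parts'[of exponent_degree f, symmetric]) (rule ring_map_sum[OF ring_map_subst[OF rh]])
  also have "\<dots> \<in> weight_ge w d"
  proof (rule weight_ge_sum)
    fix n assume "n \<in> exponent_degree ` keys f"
    then have "d \<le> n" using f by (auto simp: weight_ge_def)
    have "subst h v (form_part n f) \<in> weight_eq w n"
      by (rule weight_eq_subst[OF w _ part_in_weight_eq h v]) (use f part_polys in auto)
    then show "subst h v (form_part n f) \<in> weight_ge w d"
      using \<open>d \<le> n\<close> weight_eq_imp_ge weight_ge_mono by blast
  qed
  finally show ?thesis .
qed

lemma part_subst:
  assumes f: "f \<in> polys N" 
    and h: "\<And>c. h c \<in> forms 0" and v: "\<And>i. i < N \<Longrightarrow> v i \<in> forms 1"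
    and rh: "ring_map h"
  shows "subst h v (form_part d f) = form_part d (subst h v f)"
proof -
  note hom = weight_eq_subst[OF additive_weight_degree part_polys[OF f] part_in_weight_eq h v]
  define A where "A = insert d (exponent_degree ` keys f)"
  have "form_part d (subst h v f)
      = form_part d (subst h v (\<Sum>n\<in>A. form_part n f))"
    by (subst sum_parts) (auto simp: A_def)
  also have "\<dots> = (\<Sum>n\<in>A. form_part d (subst h v (form_part n f)))"
    by (simp add: ring_map_sum[OF ring_map_subst[OF rh]] part_sum)
  also have "\<dots> = (\<Sum>n\<in>A. if n = d then subst h v (form_part d f) else 0)"
    by (intro sum.cong refl) (auto simp: part_weight_eq[OF hom])
  also have "\<dots> = subst h v (form_part d f)" by (simp add: A_def)
  finally show ?thesis by simp
qed

section \<open>Polynomials as a vector space\<close>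

interpretation mpol: vector_space "\<lambda>(c::'a::field) (f::'a mpol). const c * f"
  by unfold_locales (auto simp: const_add const_mult algebra_simps)

lemma mpol_subspace_span_mono: "A \<subseteq> V \<Longrightarrow> 0 \<in> V \<Longrightarrow> (\<And>f g. f \<in> V \<Longrightarrow> g \<in> V \<Longrightarrow> f + g \<in> V) \<Longrightarrow>
   (\<And>c f. f \<in> V \<Longrightarrow> const c * f \<in> V) \<Longrightarrow> mpol.span A \<subseteq> V"
  by (rule mpol.span_minimal) (auto simp: mpol.subspace_def)

definition linear_forms :: "nat \<Rightarrow> 'a::field mpol set" where
  "linear_forms N = polys N \<inter> forms 1"

lemma exponent_degree_1E:
  assumes "exponent_degree e = 1"
  obtains i where "e = var_exp i"
proof -
  have "sum (lookup e) (keys e) = 1" using assms by (simp add: exponent_degree_def)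
  then obtain i where i: "i \<in> keys e" "lookup e i = 1" "\<And>j. j \<in> keys e \<Longrightarrow> j \<noteq> i \<Longrightarrow> lookup e j = 0"
    using sum_eq_1_iff[of "keys e" "lookup e"] by auto
  have "e = var_exp i"
    by (rule poly_mapping_eqI) (use i in \<open>auto simp: lookup_single when_def in_keys_iff\<close>)
  then show ?thesis using that by blast
qed

lemma linear_form_eq_sum:
  assumes "f \<in> linear_forms N"
  shows "f = (\<Sum>i<N. const (lookup f (var_exp i)) * mpol_var i)"
proof (rule poly_mapping_eqI)
  fix k
  have "lookup (\<Sum>i<N. const (lookup f (var_exp i)) * mpol_var i) k
     = (\<Sum>i<N. if var_exp i = k then lookup f (var_exp i) else 0)"
    by (simp add: lookup_sum mpol_var_def mult_single lookup_single when_def del: One_nat_def)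
  also have "\<dots> = lookup f k"
  proof (cases "k \<in> keys f")
    case True
    then obtain i where i: "k = var_exp i"
      using assms exponent_degree_1E by (auto simp: linear_forms_def weight_eq_def)
    have "i < N" using True assms i by (fastforce simp: linear_forms_def polys_iff)
    have "var_exp j = var_exp i \<longleftrightarrow> j = i" for j
      by (metis keys_single singleton_inject zero_neq_one)
    then show ?thesis using \<open>i < N\<close> by (simp add: i)
  next
    case False
    then show ?thesis by (auto simp: in_keys_iff intro: sum.neutral)
  qed
  finally show "lookup f k = lookup (\<Sum>i<N. const (lookup f (var_exp i)) * mpol_var i) k" by simp
qed

lemma linear_forms_span: "linear_forms N \<subseteq> mpol.span (mpol_var ` {..<N})"
proof
  fix f :: "'a mpol" assume "f \<in> linear_forms N"
  then have "f = (\<Sum>i<N. const (lookup f (var_exp i)) * mpol_var i)" by (rule linear_form_eq_sum)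
  also have "\<dots> \<in> mpol.span (mpol_var ` {..<N})"
    by (intro mpol.span_sum mpol.span_scale mpol.span_base) auto
  finally show "f \<in> mpol.span (mpol_var ` {..<N})" .
qed

lemma
  shows linear_forms_var: "i < N \<Longrightarrow> mpol_var i \<in> linear_forms N"
    and linear_forms_0 [simp]: "0 \<in> linear_forms N"
    and linear_forms_add: "f \<in> linear_forms N \<Longrightarrow> g \<in> linear_forms N \<Longrightarrow> f + g \<in> linear_forms N"
    and linear_forms_diff: "f \<in> linear_forms N \<Longrightarrow> g \<in> linear_forms N \<Longrightarrow> f - g \<in> linear_forms N"
    and linear_forms_scale: "f \<in> linear_forms N \<Longrightarrow> const c * f \<in> linear_forms N"
    and linear_forms_sum: "(\<And>i. i \<in> A \<Longrightarrow> u i \<in> linear_forms N) \<Longrightarrow> (\<Sum>i\<in>A. u i) \<in> linear_forms N"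
  using forms_const_mult[of f 1 c] mpol_var_form[of i]
  by (auto simp: linear_forms_def intro: weight_eq_add weight_eq_sum weight_eq_diff)

lemma linear_forms_independent_card:
  assumes "mpol.independent A" "A \<subseteq> linear_forms N"
  shows "finite A" "card A \<le> N"
proof -
  have "finite A \<and> card A \<le> card (mpol_var ` {..<N} :: 'a mpol set)"
    by (rule mpol.independent_span_bound) (use assms linear_forms_span in auto)
  moreover have "card (mpol_var ` {..<N} :: 'a mpol set) \<le> N"
    using card_image_le[of "{..<N}" mpol_var] by simp
  ultimately show "finite A" "card A \<le> N" by linarith+
qed

text \<open>An element of \<open>T\<close> outside the span of \<open>S\<close> would enlarge
  \<open>S\<close> to an independent set with more than \<open>card T\<close> elements. This stands
  in for dimension counts, once for the multiples of \<open>ell\<close> and once for the squarefree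
  quadratic monomials.\<close>

lemma independent_card_eq_span:
  assumes "finite T" "mpol.independent S" "S \<subseteq> mpol.span T" "card T \<le> card S"
  shows "mpol.span T \<subseteq> mpol.span S"
proof -
  have fS: "finite S" "card S \<le> card T" using mpol.independent_span_bound[OF assms(1-3)] by auto
  have "T \<subseteq> mpol.span S"
  proof
    fix t assume "t \<in> T"
    show "t \<in> mpol.span S"
    proof (rule ccontr)
      assume t: "t \<notin> mpol.span S"
      then have "mpol.independent (insert t S)" using assms(2) by (simp add: mpol.independent_insert)
      moreover have "insert t S \<subseteq> mpol.span T" using assms(3) \<open>t \<in> T\<close> mpol.span_base by auto
      ultimately have "card (insert t S) \<le> card T" using mpol.independent_span_bound[OF assms(1)] by blast
      moreover have "t \<notin> S" using t mpol.span_base by blast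
      ultimately show False using assms(4) fS by simp
    qed
  qed
  then show ?thesis by (rule mpol.span_minimal) (rule mpol.subspace_span)
qed

section \<open>Powers of ideals\<close>

lemma ring_mpol_ring: "ring (mpol_ring N :: 'k::field mpol ring)"
  using cring_mpol_ring cring.axioms(1) by blast

lemma ideal_power_0: "ideal_power (mpol_ring N) J 0 = polys N"
  by (simp add: nat_pow_def ideals_set_def)

lemma ideal_power_Suc: "ideal_power R J (Suc n) = ideal_prod R (ideal_power R J n) J"
  by (simp add: nat_pow_def ideals_set_def)

lemma ideal_polys: "ideal (polys N) (mpol_ring N)"
  by (auto simp: ideal_mpol_ring_iff)

lemma ideal_ideal_power:
  assumes "ideal J (mpol_ring N)"
  shows "ideal (ideal_power (mpol_ring N) J n) (mpol_ring N)"
proof (induction n)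
  case 0
  then show ?case by (simp only: ideal_power_0 ideal_polys)
next
  case (Suc n)
  then show ?case
    unfolding ideal_power_Suc using ring.ideal_prod_is_ideal[OF ring_mpol_ring _ assms] by blast
qed

lemma ideal_power_SucI:
  assumes "f \<in> ideal_power (mpol_ring N) J n" "g \<in> J"
  shows "f * g \<in> ideal_power (mpol_ring N) J (Suc n)"
  using ideal_prod.prod[OF assms, of "mpol_ring N"] by (simp only: ideal_power_Suc mpol_ring_simps)

text \<open>Since \<open>ideal_prod\<close> arises from products by addition alone, closure of
  \<open>U\<close> under these two operations suffices. The upper bounds on powers of ideals below
  come from suitable families \<open>U\<close>.\<close>

lemma ideal_power_subset:
  assumes "polys N \<subseteq> U 0" "\<And>n f g. f \<in> U n \<Longrightarrow> g \<in> J \<Longrightarrow> f * g \<in> U (Suc n)"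
    and "\<And>n f g. f \<in> U n \<Longrightarrow> g \<in> U n \<Longrightarrow> f + g \<in> U n"
  shows "ideal_power (mpol_ring N) J n \<subseteq> U n"
proof (induction n)
  case 0
  then show ?case using assms(1) by (simp only: ideal_power_0)
next
  case (Suc n)
  have "x \<in> U (Suc n)" if "x \<in> ideal_prod (mpol_ring N) (ideal_power (mpol_ring N) J n) J" for x
    using that by induction (use Suc assms in auto)
  then show ?case unfolding ideal_power_Suc by blast
qed

lemma genideal_subset:
  assumes "ideal J (mpol_ring N)" "A \<subseteq> J"
  shows "Idl\<^bsub>mpol_ring N\<^esub> A \<subseteq> J"
  using ring.genideal_minimal[OF ring_mpol_ring assms] .

lemma ideal_weight_ge:
  assumes "additive_weight w"
  shows "ideal (polys N \<inter> weight_ge w n) (mpol_ring N)"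
  using weight_ge_mult[OF assms, of _ 0 _ n]
  by (auto simp: ideal_mpol_ring_iff intro: weight_ge_add)

lemma exponent_split:
  assumes "i \<in> keys e"
  obtains e' where "e = e' + var_exp i"
proof -
  have "e = (e - var_exp i) + var_exp i"
    by (rule poly_mapping_eqI) (use assms in \<open>auto simp: lookup_add lookup_minus lookup_single when_def in_keys_iff\<close>)
  then show ?thesis using that by blast
qed

lemma ideal_irrelevant_ideal: "ideal (irrelevant_ideal N) (mpol_ring N)"
  unfolding irrelevant_ideal_def
  by (rule ring.genideal_ideal[OF ring_mpol_ring]) auto

lemma mpol_var_irrelevant: "i < N \<Longrightarrow> mpol_var i \<in> irrelevant_ideal N"
  unfolding irrelevant_ideal_def
  by (rule subsetD[OF ring.genideal_self[OF ring_mpol_ring]]) auto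

text \<open>A monomial of degree at least \<open>t\<close> gives up one variable per factor. The
  right-hand side of the theorem thereby becomes a condition on orders.\<close>

lemma irrelevant_ideal_power:
  "ideal_power (mpol_ring N) (irrelevant_ideal N :: 'k::field mpol set) t = polys N \<inter> order_ge t"
proof
  have sub: "irrelevant_ideal N \<subseteq> (polys N :: 'k mpol set) \<inter> order_ge 1"
    unfolding irrelevant_ideal_def
    by (rule genideal_subset[OF ideal_weight_ge[OF additive_weight_degree]])
      (use weight_eq_imp_ge[OF mpol_var_form] in auto)
  show "ideal_power (mpol_ring N) (irrelevant_ideal N :: 'k mpol set) t \<subseteq> polys N \<inter> order_ge t"
  proof (rule ideal_power_subset[where U = "\<lambda>n. polys N \<inter> order_ge n"], goal_cases)
    case (2 n f g)
    have "g \<in> polys N" "g \<in> order_ge 1" using sub 2(2) by blast+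
    then show ?case using order_ge_mult[of f n g 1] 2(1) by auto
  qed (auto intro: weight_ge_add)
  let ?M = "ideal_power (mpol_ring N) (irrelevant_ideal N :: 'k mpol set)"
  have id: "ideal (?M t) (mpol_ring N)" for t by (rule ideal_ideal_power[OF ideal_irrelevant_ideal])
  have "term_of e c \<in> ?M t" if "keys e \<subseteq> {..<N}" "t \<le> exponent_degree e" for e c
    using that
  proof (induction t arbitrary: e)
    case 0
    then show ?case by (simp only: ideal_power_0) auto
  next
    case (Suc t)
    then have "keys e \<noteq> {}" by (auto simp: exponent_degree_def)
    then obtain i where i: "i \<in> keys e" by blast
    then obtain e' where e': "e = e' + var_exp i" by (rule exponent_split)
    have "keys e' \<subseteq> keys e" by (auto simp: e' in_keys_iff lookup_add)
    moreover have "t \<le> exponent_degree e'" using Suc.prems(2) by (simp add: e' exponent_degree_add)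
    ultimately have "term_of e' c \<in> ?M t" using Suc.prems(1) Suc.IH by blast
    moreover have "mpol_var i \<in> irrelevant_ideal N" using i Suc.prems(1) mpol_var_irrelevant by blast
    ultimately have "term_of e' c * mpol_var i \<in> ?M (Suc t)" by (rule ideal_power_SucI)
    moreover have "term_of e' c * mpol_var i = term_of e c" by (simp add: mpol_var_def mult_single e')
    ultimately show ?case by (simp only:)
  qed
  then have "(\<Sum>e\<in>keys f. term_of e (lookup f e)) \<in> ?M t"
    if "f \<in> polys N \<inter> order_ge t" for f
    using that by (intro ideal_sum[OF id]) (auto simp: polys_iff weight_ge_def)
  then show "polys N \<inter> order_ge t \<subseteq> ?M t" by (auto simp: sum_terms)
qed

section \<open>Quotients\<close>

lemma coset_mpol_ring: "K +>\<^bsub>mpol_ring N\<^esub> a = (\<lambda>k. k + a) ` K"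
  by (auto simp: a_r_coset_def' )

lemma coset_eq_ideal_iff:
  assumes "ideal K (mpol_ring N)"
  shows "K +>\<^bsub>mpol_ring N\<^esub> a = K \<longleftrightarrow> a \<in> K"
proof
  assume "K +>\<^bsub>mpol_ring N\<^esub> a = K"
  then show "a \<in> K" using ideal_zero[OF assms] by (force simp: coset_mpol_ring)
next
  assume a: "a \<in> K"
  have "k \<in> (\<lambda>k. k + a) ` K" if "k \<in> K" for k
    using ideal_diff[OF assms that a] by (intro image_eqI[of _ _ "k - a"]) auto
  then show "K +>\<^bsub>mpol_ring N\<^esub> a = K"
    using a by (auto simp: coset_mpol_ring intro: ideal_add[OF assms])
qed

lemma quotient_module_smult_eq_zero_iff:
  assumes K: "ideal K (mpol_ring N)" and r: "r \<in> polys N"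
  shows "r \<odot>\<^bsub>quotient_module (mpol_ring N) J K\<^esub> (K +>\<^bsub>mpol_ring N\<^esub> x) =
      \<zero>\<^bsub>quotient_module (mpol_ring N) J K\<^esub> \<longleftrightarrow> r * x \<in> K"
proof -
  have *: "r * (k + x) \<in> K \<longleftrightarrow> r * x \<in> K" if "k \<in> K" for k
  proof -
    have rk: "r * k \<in> K" using ideal_mult[OF K r that] .
    show ?thesis
      using ideal_add[OF K rk, of "r * x"] ideal_diff[OF K _ rk, of "r * (k + x)"]
      by (auto simp: algebra_simps)
  qed
  have "(\<Union>y\<in>K +>\<^bsub>mpol_ring N\<^esub> x. K +>\<^bsub>mpol_ring N\<^esub> (r * y)) = K \<longleftrightarrow> r * x \<in> K"
  proof
    assume L: "(\<Union>y\<in>K +>\<^bsub>mpol_ring N\<^esub> x. K +>\<^bsub>mpol_ring N\<^esub> (r * y)) = K"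
    have "x \<in> K +>\<^bsub>mpol_ring N\<^esub> x" "r * x \<in> K +>\<^bsub>mpol_ring N\<^esub> (r * x)"
      using ideal_zero[OF K] by (force simp: coset_mpol_ring)+
    then show "r * x \<in> K" using L by blast
  next
    assume rx: "r * x \<in> K"
    have "K +>\<^bsub>mpol_ring N\<^esub> (r * y) = K" if "y \<in> K +>\<^bsub>mpol_ring N\<^esub> x" for y
      using that rx * coset_eq_ideal_iff[OF K, of "r * y"] by (auto simp: coset_mpol_ring)
    \<comment> \<open>An empty union would not be \<open>K\<close>, so the coset must have an
      element.\<close>
    moreover have "K +>\<^bsub>mpol_ring N\<^esub> x \<noteq> {}" using ideal_zero[OF K] by (auto simp: coset_mpol_ring)
    ultimately show "(\<Union>y\<in>K +>\<^bsub>mpol_ring N\<^esub> x. K +>\<^bsub>mpol_ring N\<^esub> (r * y)) = K" by auto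
  qed
  then show ?thesis by (simp add: quotient_module_def)
qed

lemma annihilator_quotient_module:
  assumes "ideal K (mpol_ring N)"
  shows "annihilator (mpol_ring N) (quotient_module (mpol_ring N) J K) = {r \<in> polys N. \<forall>x\<in>J. r * x \<in> K}"
proof -
  have "carrier (quotient_module (mpol_ring N) J K) = (\<lambda>x. K +>\<^bsub>mpol_ring N\<^esub> x) ` J"
    by (simp add: quotient_module_def)
  then show ?thesis
    by (simp add: annihilator_def quotient_module_smult_eq_zero_iff[OF assms] cong: conj_cong)
qed

lemma associated_primes_quotient:
  assumes "ideal K (mpol_ring N)"
  shows "associated_primes (mpol_ring N) (quotient_module (mpol_ring N) (polys N) K) =
    {P. primeideal P (mpol_ring N) \<and> (\<exists>x\<in>polys N. P = {r \<in> polys N. r * x \<in> K})}"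
proof -
  have c: "carrier (quotient_module (mpol_ring N) (polys N) K) = (\<lambda>x. K +>\<^bsub>mpol_ring N\<^esub> x) ` polys N"
    by (simp add: quotient_module_def)
  have "{r \<in> polys N. r \<odot>\<^bsub>quotient_module (mpol_ring N) (polys N) K\<^esub> (K +>\<^bsub>mpol_ring N\<^esub> x) =
      \<zero>\<^bsub>quotient_module (mpol_ring N) (polys N) K\<^esub>} = {r \<in> polys N. r * x \<in> K}" for x
    using quotient_module_smult_eq_zero_iff[OF assms] by auto
  then show ?thesis by (simp add: associated_primes_def c)
qed

lemma primeideal_mpol_ring_iff:
  "primeideal P (mpol_ring N) \<longleftrightarrow> ideal P (mpol_ring N) \<and> 1 \<notin> P \<and>
    (\<forall>a\<in>polys N. \<forall>b\<in>polys N. a * b \<in> P \<longrightarrow> a \<in> P \<or> b \<in> P)" (is "?L \<longleftrightarrow> ?R")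
proof
  assume L: ?L
  then interpret primeideal P "mpol_ring N" .
  have "1 \<notin> P" using I_notcarr ideal.one_imp_carrier[OF is_ideal] by auto
  moreover have "a \<in> P \<or> b \<in> P" if "a \<in> polys N" "b \<in> polys N" "a * b \<in> P" for a b
    using I_prime[OF that(1,2)] that(3) by simp
  ultimately show ?R using is_ideal by blast
next
  assume R: ?R
  show ?L
  proof (rule primeidealI)
    show "polys N \<noteq> P" using R polys_1 by metis
  qed (use R cring_mpol_ring in auto)
qed

section \<open>Localization\<close>

text \<open>Fractions over a multiplicative set without zero divisors are identified with their values
  in the fraction field, from which the ring axioms are inherited.\<close>

context
  fixes N :: nat and W :: "'k::field mpol set"
  assumes W: "W \<subseteq> polys N" "1 \<in> W" "0 \<notin> W" "\<And>a b. a \<in> W \<Longrightarrow> b \<in> W \<Longrightarrow> a * b \<in> W"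
begin

definition fraction_values :: "'k mpol fract set" where
  "fraction_values = {Fract a s | a s. a \<in> polys N \<and> s \<in> W}"

definition fraction_class :: "'k mpol fract \<Rightarrow> ('k mpol \<times> 'k mpol) set" where
  "fraction_class x = {(b, t). b \<in> polys N \<and> t \<in> W \<and> Fract b t = x}"

abbreviation fractions where "fractions \<equiv> fraction_ring (mpol_ring N) W"
abbreviation frac where "frac \<equiv> fraction (mpol_ring N) W"

lemma W_nonzero: "s \<in> W \<Longrightarrow> s \<noteq> 0" using W by metis

text \<open>The extra factor \<open>u\<close> in \<open>fraction_rel\<close> cancels, because
  polynomials have no zero divisors and \<open>0\<close> is outside \<open>W\<close>. What remains
  is equality in the fraction field.\<close>

lemma fraction_eq_class:
  assumes "a \<in> polys N" "s \<in> W"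
  shows "frac a s = fraction_class (Fract a s)"
proof -
  have "(\<exists>u\<in>W. u * (a * t) = u * (b * s)) \<longleftrightarrow> Fract b t = Fract a s" if "t \<in> W" for b t
  proof -
    have "(\<exists>u\<in>W. u * (a * t) = u * (b * s)) \<longleftrightarrow> a * t = b * s"
      using W_nonzero W(2) by (metis mult_cancel_left)
    also have "\<dots> \<longleftrightarrow> Fract b t = Fract a s"
      using W_nonzero[OF that] W_nonzero[OF assms(2)] by (auto simp: eq_fract)
    finally show ?thesis .
  qed
  then show ?thesis
    using assms by (auto simp: fraction_def fraction_rel_def fraction_class_def)
qed

lemma fraction_class_inj: "inj_on fraction_class fraction_values"
proof (rule inj_onI)
  fix x y assume x: "x \<in> fraction_values" and eq: "fraction_class x = fraction_class y"
  then obtain a s where "a \<in> polys N" "s \<in> W" "x = Fract a s" by (auto simp: fraction_values_def)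
  then have "(a, s) \<in> fraction_class x" by (simp add: fraction_class_def)
  then have "(a, s) \<in> fraction_class y" using eq by simp
  then show "x = y" using \<open>x = Fract a s\<close> by (simp add: fraction_class_def)
qed

lemma fraction_class_nonempty:
  assumes "x \<in> fraction_values"
  obtains a s where "(a, s) \<in> fraction_class x"
  using assms by (auto simp: fraction_values_def fraction_class_def)

lemma carrier_fraction_ring: "carrier fractions = fraction_class ` fraction_values"
proof -
  have "carrier fractions = (\<lambda>(a, s). frac a s) ` (polys N \<times> W)"
    by (auto simp: fraction_ring_def quotient_def fraction_def)
  also have "\<dots> = (\<lambda>(a, s). fraction_class (Fract a s)) ` (polys N \<times> W)"
    by (rule image_cong) (auto simp: fraction_eq_class)
  also have "\<dots> = fraction_class ` fraction_values" by (auto simp: fraction_values_def)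
  finally show ?thesis .
qed

lemma fraction_values_closed:
  "x \<in> fraction_values \<Longrightarrow> y \<in> fraction_values \<Longrightarrow> x + y \<in> fraction_values"
  "x \<in> fraction_values \<Longrightarrow> y \<in> fraction_values \<Longrightarrow> x * y \<in> fraction_values"
  "x \<in> fraction_values \<Longrightarrow> - x \<in> fraction_values"
  "0 \<in> fraction_values" "1 \<in> fraction_values"
proof -
  show "x + y \<in> fraction_values" "x * y \<in> fraction_values"
    if xy: "x \<in> fraction_values" "y \<in> fraction_values"
  proof -
    obtain a s b t where *: "a \<in> polys N" "s \<in> W" "x = Fract a s" "b \<in> polys N" "t \<in> W" "y = Fract b t"
      using xy by (auto simp: fraction_values_def)
    then have "x + y = Fract (a * t + b * s) (s * t)" "x * y = Fract (a * b) (s * t)"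
      using W_nonzero by (simp_all add: algebra_simps)
    moreover have "a * t + b * s \<in> polys N" "a * b \<in> polys N" "s * t \<in> W" using * W by auto
    ultimately show "x + y \<in> fraction_values" "x * y \<in> fraction_values"
      by (auto simp: fraction_values_def)
  qed
  show "- x \<in> fraction_values" if xv: "x \<in> fraction_values"
  proof -
    obtain a s where "a \<in> polys N" "s \<in> W" "x = Fract a s"
      using xv by (auto simp: fraction_values_def)
    then have "- x = Fract (- a) s" "- a \<in> polys N" by auto
    then show ?thesis using \<open>s \<in> W\<close> unfolding fraction_values_def by blast
  qed
  show "0 \<in> fraction_values" "1 \<in> fraction_values"
    using W by (auto simp: fraction_values_def Zero_fract_def One_fract_def)
qed

lemma fraction_ring_ops:
  assumes "x \<in> fraction_values" "y \<in> fraction_values"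
  shows "fraction_class x \<otimes>\<^bsub>fractions\<^esub> fraction_class y = fraction_class (x * y)"
    and "fraction_class x \<oplus>\<^bsub>fractions\<^esub> fraction_class y = fraction_class (x + y)"
proof -
  have m: "frac (a * b) (s * t) = fraction_class (x * y)"
    and p: "frac (a * t + b * s) (s * t) = fraction_class (x + y)"
    if "(a, s) \<in> fraction_class x" "(b, t) \<in> fraction_class y" for a b s t
  proof -
    have *: "a \<in> polys N" "s \<in> W" "x = Fract a s" "b \<in> polys N" "t \<in> W" "y = Fract b t"
      using that by (auto simp: fraction_class_def)
    then have "a * t + b * s \<in> polys N" "a * b \<in> polys N" "s * t \<in> W" using W by auto
    then show "frac (a * b) (s * t) = fraction_class (x * y)"
      "frac (a * t + b * s) (s * t) = fraction_class (x + y)"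
      using * W_nonzero by (simp_all add: fraction_eq_class algebra_simps)
  qed
  obtain a s b t where ab: "(a, s) \<in> fraction_class x" "(b, t) \<in> fraction_class y"
    using fraction_class_nonempty assms by metis
  \<comment> \<open>By \<open>m\<close> every choice of representatives contributes the same class,
    so the family is constant.\<close>
  have "(\<Union>(a, s)\<in>fraction_class x. \<Union>(b, t)\<in>fraction_class y. frac (a * b) (s * t))
      = (\<Union>p\<in>fraction_class x. \<Union>q\<in>fraction_class y. fraction_class (x * y))"
    using m by (intro SUP_cong refl) (auto simp: split_beta)
  also have "\<dots> = fraction_class (x * y)" using ab by auto
  finally show "fraction_class x \<otimes>\<^bsub>fractions\<^esub> fraction_class y = fraction_class (x * y)"
    by (simp add: fraction_ring_def)
  have "(\<Union>(a, s)\<in>fraction_class x. \<Union>(b, t)\<in>fraction_class y. frac (a * t + b * s) (s * t))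
      = (\<Union>p\<in>fraction_class x. \<Union>q\<in>fraction_class y. fraction_class (x + y))"
    using p by (intro SUP_cong refl) (auto simp: split_beta)
  also have "\<dots> = fraction_class (x + y)" using ab by auto
  finally show "fraction_class x \<oplus>\<^bsub>fractions\<^esub> fraction_class y = fraction_class (x + y)"
    by (simp add: fraction_ring_def)
qed

lemma fraction_ring_units:
  "\<zero>\<^bsub>fractions\<^esub> = fraction_class 0"
  "\<one>\<^bsub>fractions\<^esub> = fraction_class 1"
  using W by (simp_all add: fraction_ring_def fraction_eq_class Zero_fract_def One_fract_def)

lemma cring_fraction_ring: "cring fractions"
proof (rule cringI)
  note [simp] = carrier_fraction_ring fraction_ring_ops fraction_ring_units fraction_values_closed
  show "abelian_group fractions"
  proof (rule abelian_groupI, goal_cases)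
    case (6 x)
    then obtain y where "y \<in> fraction_values" "x = fraction_class y" by auto
    then show ?case by (intro bexI[of _ "fraction_class (- y)"]) auto
  qed (auto simp: algebra_simps)
  show "comm_monoid fractions"
    by (rule comm_monoidI) (auto simp: algebra_simps)
qed (auto simp: carrier_fraction_ring fraction_ring_ops fraction_values_closed algebra_simps)

lemma fraction_ring_inv:
  assumes "x \<in> fraction_values"
  shows "\<ominus>\<^bsub>fractions\<^esub> fraction_class x = fraction_class (- x)"
proof -
  have "abelian_group fractions"
    using cring_fraction_ring by (simp add: cring_def ring_def)
  then show ?thesis
    by (rule abelian_group.minus_equality)
      (use assms in \<open>auto simp: carrier_fraction_ring fraction_ring_ops fraction_ring_units fraction_values_closed\<close>)
qed

text \<open>These fractions will turn out to bound the extension of \<open>J\<close>: they form an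
  ideal, and it contains the images of all elements of \<open>J\<close>.\<close>

lemma ideal_fractions:
  assumes J: "ideal J (mpol_ring N)"
  shows "ideal (fraction_class ` {Fract b s | b s. b \<in> J \<and> s \<in> W}) fractions"
    (is "ideal (fraction_class ` ?L) ?R")
proof (rule idealI)
  have sub: "?L \<subseteq> fraction_values" using ideal_subset[OF J] by (auto simp: fraction_values_def)
  have mem: "Fract b s \<in> ?L" if "b \<in> J" "s \<in> W" for b s using that by blast
  show "ring ?R" using cring_fraction_ring by (rule cring.axioms(1))
  then have g: "Group.group (add_monoid ?R)" by (metis ring_def abelian_group.a_group)
  have add: "x + y \<in> ?L" if "x \<in> ?L" "y \<in> ?L" for x y
  proof -
    obtain b s c t where *: "b \<in> J" "s \<in> W" "x = Fract b s" "c \<in> J" "t \<in> W" "y = Fract c t"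
      using \<open>x \<in> ?L\<close> \<open>y \<in> ?L\<close> by blast
    then have "x + y = Fract (t * b + s * c) (s * t)" using W_nonzero by (simp add: algebra_simps)
    moreover have "t * b + s * c \<in> J" using * W(1) J by (meson ideal_add ideal_mult subsetD)
    ultimately show ?thesis using * W(4) by auto
  qed
  have mul: "x * y \<in> ?L" if "x \<in> fraction_values" "y \<in> ?L" for x y
  proof -
    obtain b s c t where *: "b \<in> polys N" "s \<in> W" "x = Fract b s" "c \<in> J" "t \<in> W" "y = Fract c t"
      using \<open>x \<in> fraction_values\<close> \<open>y \<in> ?L\<close> unfolding fraction_values_def by blast
    then have "x * y = Fract (b * c) (s * t)" by simp
    moreover have "b * c \<in> J" using * J ideal_mult by blast
    ultimately show ?thesis using * W(4) by auto
  qed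
  have neg: "- x \<in> ?L" if "x \<in> ?L" for x
    using mul[of "- 1" x] that fraction_values_closed by auto
  show "subgroup (fraction_class ` ?L) (add_monoid ?R)"
  proof (rule group.subgroupI[OF g])
    show "fraction_class ` ?L \<subseteq> carrier (add_monoid ?R)"
      using sub by (auto simp: carrier_fraction_ring)
    show "fraction_class ` ?L \<noteq> {}" using mem[OF ideal_zero[OF J] W(2)] by blast
  next
    fix a assume "a \<in> fraction_class ` ?L"
    then obtain x where x: "x \<in> ?L" "a = fraction_class x" by blast
    then have "\<ominus>\<^bsub>?R\<^esub> a = fraction_class (- x)" using sub fraction_ring_inv by blast
    then show "inv\<^bsub>add_monoid ?R\<^esub> a \<in> fraction_class ` ?L" using neg[OF x(1)] by (simp add: a_inv_def)
  next
    fix a b assume "a \<in> fraction_class ` ?L" "b \<in> fraction_class ` ?L"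
    then obtain x y where x: "x \<in> ?L" "a = fraction_class x" "y \<in> ?L" "b = fraction_class y" by blast
    then have "a \<oplus>\<^bsub>?R\<^esub> b = fraction_class (x + y)" using fraction_ring_ops(2) sub by blast
    then show "a \<otimes>\<^bsub>add_monoid ?R\<^esub> b \<in> fraction_class ` ?L" using add[OF x(1,3)] by simp
  qed
  fix a x assume "a \<in> fraction_class ` ?L" "x \<in> carrier ?R"
  then obtain y z where yz: "y \<in> ?L" "a = fraction_class y" "z \<in> fraction_values" "x = fraction_class z"
    by (auto simp: carrier_fraction_ring)
  then have "x \<otimes>\<^bsub>?R\<^esub> a = fraction_class (z * y)" "a \<otimes>\<^bsub>?R\<^esub> x = fraction_class (z * y)"
    using fraction_ring_ops(1) sub by (auto simp: mult.commute subset_eq)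
  then show "x \<otimes>\<^bsub>?R\<^esub> a \<in> fraction_class ` ?L" "a \<otimes>\<^bsub>?R\<^esub> x \<in> fraction_class ` ?L"
    using mul[OF yz(3,1)] by simp_all
qed

text \<open>An equation \<open>a / 1 = b / s\<close> with \<open>b \<in> J\<close> means
  \<open>s * a = b\<close>; conversely the image of \<open>s * a\<close> is multiplied by
  \<open>1 / s\<close>.\<close>

lemma fraction_extension_iff:
  assumes J: "ideal J (mpol_ring N)" and a: "a \<in> polys N"
  shows "frac a 1 \<in>
      Idl\<^bsub>fractions\<^esub> ((\<lambda>b. frac b 1) ` J) \<longleftrightarrow>
    (\<exists>s\<in>W. s * a \<in> J)" (is "_ \<in> Idl\<^bsub>?R\<^esub> ?A \<longleftrightarrow> _")
proof
  interpret R: cring ?R by (rule cring_fraction_ring)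
  have val: "Fract b 1 \<in> fraction_values" if "b \<in> polys N" for b
    using that W(2) by (auto simp: fraction_values_def)
  have A: "?A = (\<lambda>b. fraction_class (Fract b 1)) ` J"
    using ideal_subset[OF J] W(2) by (intro image_cong refl fraction_eq_class) auto
  have Asub: "?A \<subseteq> carrier ?R" unfolding A carrier_fraction_ring using val ideal_subset[OF J] by auto
  have fa: "frac a 1 = fraction_class (Fract a 1)"
    using a W(2) by (rule fraction_eq_class)
  {
    assume "frac a 1 \<in> Idl\<^bsub>?R\<^esub> ?A"
    moreover have "Idl\<^bsub>?R\<^esub> ?A \<subseteq> fraction_class ` {Fract b s | b s. b \<in> J \<and> s \<in> W}"
      by (rule R.genideal_minimal[OF ideal_fractions[OF J]]) (use W(2) A in auto)
    ultimately obtain b s where b: "b \<in> J" "s \<in> W" "fraction_class (Fract a 1) = fraction_class (Fract b s)"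
      unfolding fa by auto
    have "Fract a 1 = Fract b s"
      using inj_onD[OF fraction_class_inj b(3) val[OF a]] b ideal_subset[OF J]
      by (auto simp: fraction_values_def)
    then have "s * a = b" using W_nonzero[OF b(2)] by (simp add: eq_fract mult.commute)
    then show "\<exists>s\<in>W. s * a \<in> J" using b by blast
  }
  {
    assume "\<exists>s\<in>W. s * a \<in> J"
    then obtain s where s: "s \<in> W" "s * a \<in> J" by blast
    interpret Id: ideal "Idl\<^bsub>?R\<^esub> ?A" ?R by (rule R.genideal_ideal[OF Asub])
    have "fraction_class (Fract (s * a) 1) \<in> Idl\<^bsub>?R\<^esub> ?A"
      using R.genideal_self[OF Asub] s A by auto
    moreover have i: "Fract 1 s \<in> fraction_values" using s W by (auto simp: fraction_values_def)
    ultimately have "fraction_class (Fract 1 s) \<otimes>\<^bsub>?R\<^esub> fraction_class (Fract (s * a) 1) \<in> Idl\<^bsub>?R\<^esub> ?A"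
      by (intro Id.I_l_closed) (auto simp: carrier_fraction_ring)
    moreover have "Fract 1 s * Fract (s * a) 1 = Fract a 1"
      using W_nonzero[OF s(1)] by (simp add: eq_fract mult.commute)
    moreover have "s * a \<in> polys N" using s ideal_subset[OF J] by auto
    ultimately show "frac a 1 \<in> Idl\<^bsub>?R\<^esub> ?A"
      using fraction_ring_ops(1)[OF i val] fa by simp
  }
qed

end

lemma extend_contract_eq:
  assumes P: "primeideal P (mpol_ring N)" and J: "ideal J (mpol_ring N)"
  shows "extend_contract (mpol_ring N) P J = {a \<in> polys N. \<exists>s\<in>polys N - P. s * a \<in> J}"
proof -
  note P = P[unfolded primeideal_mpol_ring_iff]
  have W: "polys N - P \<subseteq> polys N" "1 \<in> polys N - P" "0 \<notin> polys N - P"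
    "\<And>a b. a \<in> polys N - P \<Longrightarrow> b \<in> polys N - P \<Longrightarrow> a * b \<in> polys N - P"
    using P ideal_zero[of P N] by auto
  show ?thesis
    using fraction_extension_iff[OF W J]
    by (auto simp: extend_contract_def localization_def localization_map_def)
qed

text \<open>An associated prime is the annihilator of the class of some \<open>x\<close>, so a
  denominator outside it is an \<open>s\<close> with \<open>s * x \<notin> J\<close>. This
  eliminates both localizations and primes in favour of witnesses.\<close>

lemma symbolic_power_eq:
  assumes J: "ideal J (mpol_ring N)"
  shows "symbolic_power (mpol_ring N) J m = {f \<in> polys N.
     \<forall>x\<in>polys N. primeideal {r \<in> polys N. r * x \<in> J} (mpol_ring N) \<longrightarrow>
       (\<exists>s\<in>polys N. s * x \<notin> J \<and> s * f \<in> ideal_power (mpol_ring N) J m)}"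
  unfolding symbolic_power_def associated_primes_quotient[OF J]
proof (rule subset_antisym; rule subsetI)
  note ec = extend_contract_eq[OF _ ideal_ideal_power[OF J]]
  let ?Ass = "{P. primeideal P (mpol_ring N) \<and> (\<exists>x\<in>polys N. P = {r \<in> polys N. r * x \<in> J})}"
  let ?C = "\<lambda>P. extend_contract (mpol_ring N) P (ideal_power (mpol_ring N) J m)"
  let ?S = "{f \<in> polys N. \<forall>x\<in>polys N. primeideal {r \<in> polys N. r * x \<in> J} (mpol_ring N) \<longrightarrow>
       (\<exists>s\<in>polys N. s * x \<notin> J \<and> s * f \<in> ideal_power (mpol_ring N) J m)}"
  {
    fix f assume f: "f \<in> polys N \<inter> (\<Inter>P\<in>?Ass. ?C P)"
    have "\<exists>s\<in>polys N. s * x \<notin> J \<and> s * f \<in> ideal_power (mpol_ring N) J m"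
      if x: "x \<in> polys N" "primeideal {r \<in> polys N. r * x \<in> J} (mpol_ring N)" for x
    proof -
      have "f \<in> ?C {r \<in> polys N. r * x \<in> J}" using f x by blast
      then show ?thesis unfolding ec[OF x(2)] by blast
    qed
    then show "f \<in> ?S" using f by blast
  next
    fix f assume f: "f \<in> ?S"
    have "f \<in> ?C P" if P: "P \<in> ?Ass" for P
    proof -
      obtain x where x: "x \<in> polys N" "P = {r \<in> polys N. r * x \<in> J}" "primeideal P (mpol_ring N)"
        using P by blast
      then obtain s where "s \<in> polys N" "s * x \<notin> J" "s * f \<in> ideal_power (mpol_ring N) J m"
        using f by blast
      then have "s \<in> polys N - P" "s * f \<in> ideal_power (mpol_ring N) J m" using x(2) by simp_all
      then show ?thesis unfolding ec[OF x(3)] using f by blast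
    qed
    then show "f \<in> polys N \<inter> (\<Inter>P\<in>?Ass. ?C P)" using f by (intro IntI INT_I) simp_all
  }
qed

section \<open>Homogenization of univariate polynomials\<close>

text \<open>For \<open>degree f \<le> n\<close> this is \<open>l ^ n * f (x / l)\<close> written
  without division. Coefficients beyond \<open>n\<close> are discarded, whence the degree bounds in
  the rules for products.\<close>

definition homogenized :: "('a::comm_ring_1 \<Rightarrow> 'b::comm_ring_1) \<Rightarrow> 'b \<Rightarrow> 'b \<Rightarrow> nat \<Rightarrow> 'a poly \<Rightarrow> 'b" where
  "homogenized h x l n f = (\<Sum>i\<le>n. h (coeff f i) * x ^ i * l ^ (n - i))"

context
  fixes h :: "'a::comm_ring_1 \<Rightarrow> 'b::comm_ring_1" and x l :: 'b
  assumes h: "ring_map h"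
begin

lemma homogenized_0 [simp]: "homogenized h x l n 0 = 0"
  by (simp add: homogenized_def ring_map_simps[OF h])

lemma homogenized_add: "homogenized h x l n (f + g) = homogenized h x l n f + homogenized h x l n g"
  by (simp add: homogenized_def ring_map_simps[OF h] sum.distrib distrib_right)

lemma homogenized_smult: "homogenized h x l n (smult c f) = h c * homogenized h x l n f"
  by (simp add: homogenized_def ring_map_simps[OF h] sum_distrib_left mult.assoc)

lemma homogenized_pCons:
  "homogenized h x l (Suc n) (pCons a f) = h a * l ^ Suc n + x * homogenized h x l n f"
  by (simp add: homogenized_def sum.atMost_Suc_shift sum_distrib_left mult_ac del: sum.atMost_Suc)

lemma homogenized_extend:
  assumes "degree f \<le> n"
  shows "homogenized h x l (n + m) f = l ^ m * homogenized h x l n f"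
proof -
  have "homogenized h x l (n + m) f = (\<Sum>i\<le>n. h (coeff f i) * x ^ i * l ^ (n + m - i))"
    unfolding homogenized_def
    by (rule sum.mono_neutral_right) (use assms in \<open>auto simp: coeff_eq_0 ring_map_simps[OF h]\<close>)
  also have "\<dots> = (\<Sum>i\<le>n. l ^ m * (h (coeff f i) * x ^ i * l ^ (n - i)))"
  proof (intro sum.cong refl)
    fix i assume "i \<in> {..n}"
    then have "l ^ (n + m - i) = l ^ m * l ^ (n - i)" by (simp add: power_add[symmetric] add.commute)
    then show "h (coeff f i) * x ^ i * l ^ (n + m - i) = l ^ m * (h (coeff f i) * x ^ i * l ^ (n - i))"
      by (simp add: mult_ac)
  qed
  finally show ?thesis by (simp add: homogenized_def sum_distrib_left)
qed

lemma homogenized_const: "homogenized h x l n [:a:] = h a * l ^ n"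
  using homogenized_extend[of "[:a:]" 0 n] by (simp add: homogenized_def mult.commute)

lemma homogenized_mult:
  "degree f \<le> n \<Longrightarrow> degree g \<le> m \<Longrightarrow>
    homogenized h x l (n + m) (f * g) = homogenized h x l n f * homogenized h x l m g"
proof (induction f arbitrary: n)
  case (pCons a f)
  have g: "homogenized h x l (n + m) (smult a g) = h a * l ^ n * homogenized h x l m g"
    using homogenized_extend[OF pCons.prems(2), of n]
    by (simp add: homogenized_smult add.commute mult.assoc)
  show ?case
  proof (cases "f = 0")
    case True
    then show ?thesis using g by (simp add: homogenized_const)
  next
    case False
    then obtain n' where n': "n = Suc n'" "degree f \<le> n'"
      using pCons.prems(1) by (cases n) auto
    have "homogenized h x l (n + m) (pCons 0 (f * g)) = x * homogenized h x l (n' + m) (f * g)"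
      using homogenized_pCons[of "n' + m" 0 "f * g"] by (simp add: n' ring_map_simps[OF h])
    then show ?thesis
      using g pCons.IH[OF n'(2) pCons.prems(2)]
      by (simp add: homogenized_add n'(1) homogenized_pCons algebra_simps)
  qed
qed simp

lemma degree_prod_linear: "finite A \<Longrightarrow> degree (\<Prod>a\<in>A. [:- a, 1:]) \<le> card A"
  for A :: "'a set"
proof (induction A rule: finite_induct)
  case (insert a A)
  have "degree ([:- a, 1:] * (\<Prod>a\<in>A. [:- a, 1:])) \<le> degree [:- a, 1:] + degree (\<Prod>a\<in>A. [:- a, 1:])"
    by (rule degree_mult_le)
  then show ?case using insert by simp
qed simp

lemma homogenized_prod_linear:
  "finite A \<Longrightarrow> homogenized h x l (card A) (\<Prod>a\<in>A. [:- a, 1:]) = (\<Prod>a\<in>A. x - h a * l)"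
proof (induction A rule: finite_induct)
  case empty
  then show ?case by (simp add: homogenized_def ring_map_simps[OF h])
next
  case (insert a A)
  have "homogenized h x l 1 [:- a, 1:] = x - h a * l"
    by (simp add: homogenized_def ring_map_simps[OF h] ring_map_minus[OF h])
  then show ?case
    using homogenized_mult[of "[:- a, 1:]" 1 "\<Prod>a\<in>A. [:- a, 1:]" "card A"] insert degree_prod_linear[of A]
    by simp
qed

end

lemma homogenized_map_poly:
  "g 0 = 0 \<Longrightarrow> homogenized h x l n (map_poly g f) = homogenized (\<lambda>c. h (g c)) x l n f"
  by (simp add: homogenized_def coeff_map_poly)

lemma homogenized_eq_poly: "degree f \<le> n \<Longrightarrow> homogenized (\<lambda>c. c) x 1 n f = poly f x"
  by (simp add: homogenized_def poly_altdef) (rule sum.mono_neutral_right, auto simp: coeff_eq_0)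

text \<open>This is the interpolation of the constant \<open>1\<close>: both sides have degree less
  than \<open>card A\<close> and agree at every point of \<open>A\<close>.\<close>

lemma lagrange_sum_eq_1:
  fixes A :: "'a::field set"
  assumes "finite A" "A \<noteq> {}"
  shows "(\<Sum>a\<in>A. smult (inverse (\<Prod>b\<in>A - {a}. a - b)) (\<Prod>b\<in>A - {a}. [:- b, 1:])) = 1"
    (is "?p = 1")
proof (rule poly_eqI_degree)
  fix c assume c: "c \<in> A"
  have "poly ?p c = (\<Sum>a\<in>A. inverse (\<Prod>b\<in>A - {a}. a - b) * (\<Prod>b\<in>A - {a}. c - b))"
    by (simp add: poly_sum poly_prod)
  also have "\<dots> = (\<Sum>a\<in>A. if a = c then 1 else 0)"
  proof (intro sum.cong refl)
    fix a assume a: "a \<in> A"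
    show "inverse (\<Prod>b\<in>A - {a}. a - b) * (\<Prod>b\<in>A - {a}. c - b) = (if a = c then 1 else 0)"
      using assms(1) c by (auto intro!: left_inverse prod_zero bexI[of _ c])
  qed
  also have "\<dots> = poly 1 c" using assms(1) c by simp
  finally show "poly ?p c = poly 1 c" .
next
  have "degree (smult (inverse (\<Prod>b\<in>A - {a}. a - b)) (\<Prod>b\<in>A - {a}. [:- b, 1:])) \<le> card A - 1"
    if "a \<in> A" for a
  proof -
    have "degree (\<Prod>b\<in>A - {a}. [:- b, 1:]) \<le> card (A - {a})"
      by (rule degree_prod_linear[OF ring_map_id]) (simp add: assms)
    then show ?thesis using that by (auto simp: card_Diff_singleton intro: order_trans[OF degree_smult_le])
  qed
  then have "degree ?p \<le> card A - 1" by (rule degree_sum_le[OF assms(1)])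
  moreover have "card A > 0" using assms by (simp add: card_gt_0_iff)
  ultimately show "degree ?p < card A" "degree (1::'a poly) < card A" by simp_all
qed

section \<open>Separability over perfect fields\<close>

abbreviation ac_poly :: "'k::field poly \<Rightarrow> 'k alg_closure poly" where "ac_poly \<equiv> map_poly to_ac"

lemma ring_map_to_ac: "ring_map to_ac" by (simp add: ring_map_def)

lemma ac_poly_add: "ac_poly (f + g) = ac_poly f + ac_poly g"
  by (rule poly_eqI) (simp add: coeff_map_poly)

lemma ac_poly_mult: "ac_poly (f * g) = ac_poly f * ac_poly g"
  by (rule poly_eqI) (simp add: coeff_map_poly coeff_mult to_ac_sum)

lemma ac_poly_pderiv: "ac_poly (pderiv f) = pderiv (ac_poly f)"
  by (rule poly_eqI) (simp add: coeff_map_poly coeff_pderiv)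

lemma degree_ac_poly: "degree (ac_poly f) = degree f"
  by (rule degree_map_poly) auto

lemma ac_poly_eq_0_iff: "ac_poly f = 0 \<longleftrightarrow> f = 0"
  by (rule map_poly_eq_0_iff) auto

text \<open>If the derivative vanishes, only exponents divisible by the characteristic
  \<open>p\<close> occur. Surjectivity of the Frobenius map provides \<open>p\<close>-th roots of
  the coefficients, hence a polynomial \<open>r\<close> of smaller degree whose value at
  \<open>a\<close> has the value of \<open>g\<close> as its \<open>p\<close>-th power.\<close>

lemma pderiv_eq_0_perfect:
  fixes g :: "'k::field poly"
  assumes perfect: "perfect_field TYPE('k)" and g: "pderiv g = 0"
    and root: "poly (ac_poly g) a = 0" "g \<noteq> 0"
  obtains r where "r \<noteq> 0" "degree r < degree g" "poly (ac_poly r) a = 0"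
proof -
  have cz: "coeff g n = 0" if nd: "\<not> CHAR('k) dvd n" for n
  proof -
    obtain m where m: "n = Suc m" using nd by (cases n) auto
    have "of_nat (Suc m) * coeff g (Suc m) = 0" by (metis g coeff_0 coeff_pderiv)
    moreover have "of_nat (Suc m) \<noteq> (0::'k)" using nd m of_nat_eq_0_iff_char_dvd by metis
    ultimately show ?thesis using m by simp
  qed
  have dpos: "degree g > 0"
  proof (rule ccontr)
    assume "\<not> degree g > 0"
    then obtain c where "g = [:c:]" by (metis degree_eq_zeroE gr0I)
    with root show False by (simp add: map_poly_pCons)
  qed
  define p where "p = CHAR('k)"
  \<comment> \<open>In characteristic \<open>0\<close> the vanishing derivative would annihilate
    even the leading coefficient, since the degree is positive.\<close>
  have "p \<noteq> 0"
  proof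
    assume "p = 0"
    then have "coeff g (degree g) = 0" using cz dpos by (simp add: p_def)
    then show False using root by simp
  qed
  then have p: "Factorial_Ring.prime p" unfolding p_def by (intro prime_CHAR_semidom) simp
  have "surj (\<lambda>a::'k. a ^ p)" using perfect \<open>p \<noteq> 0\<close> by (auto simp: perfect_field_def p_def)
  then have "\<exists>b. b ^ p = c" for c :: 'k by (metis surjD)
  then obtain rt where rt: "rt c ^ p = c" for c :: 'k by metis
  have rt0: "rt 0 = 0" using rt[of 0] by simp
  define r where "r = (\<Sum>i\<le>degree g div p. monom (rt (coeff g (i * p))) i)"
  have cr: "coeff r i = rt (coeff g (i * p))" for i
  proof -
    have "coeff r i = (if i \<le> degree g div p then rt (coeff g (i * p)) else 0)"
      by (simp add: r_def coeff_sum coeff_monom sum.delta)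
    moreover have "coeff g (i * p) = 0" if "\<not> i \<le> degree g div p"
      using that \<open>p \<noteq> 0\<close> by (intro coeff_eq_0) (simp add: less_eq_div_iff_mult_less_eq not_le)
    ultimately show ?thesis by (simp add: rt0)
  qed
  have dvd: "p dvd degree g" using cz[of "degree g"] root unfolding p_def by auto
  have "coeff r (degree g div p) ^ p = lead_coeff g" using dvd by (simp add: cr rt)
  then have "r \<noteq> 0" using root(2) \<open>p \<noteq> 0\<close> by (auto simp: power_0_left)
  moreover have "degree r < degree g"
  proof -
    have "degree r \<le> degree g div p"
      unfolding r_def by (intro degree_sum_le) (auto intro: order_trans[OF degree_monom_le])
    also have "\<dots> < degree g" using p dpos prime_gt_1_nat by (intro div_less_dividend) auto
    finally show ?thesis .
  qed
  moreover have "poly (ac_poly r) a ^ p = poly (ac_poly g) a"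
  proof -
    have dr: "degree r \<le> degree g div p"
      unfolding r_def by (intro degree_sum_le) (auto intro: order_trans[OF degree_monom_le])
    have "poly (ac_poly r) a = (\<Sum>i\<le>degree g div p. to_ac (coeff r i) * a ^ i)"
      unfolding poly_altdef degree_ac_poly coeff_map_poly[of to_ac, OF to_ac_0]
      by (rule sum.mono_neutral_left) (use dr in \<open>auto simp: coeff_eq_0\<close>)
    also have "\<dots> ^ p = (\<Sum>i\<le>degree g div p. (to_ac (coeff r i) * a ^ i) ^ p)"
      by (rule freshmans_dream_sum) (use p in \<open>auto simp: p_def\<close>)
    also have "\<dots> = (\<Sum>i\<le>degree g div p. to_ac (coeff g (i * p)) * a ^ (i * p))"
      by (simp add: power_mult_distrib power_mult cr rt flip: to_ac_power)
    also have "\<dots> = (\<Sum>n\<in>(\<lambda>i. i * p) ` {..degree g div p}. to_ac (coeff g n) * a ^ n)"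
      using \<open>p \<noteq> 0\<close> by (subst sum.reindex) (auto simp: inj_on_def)
    also have "\<dots> = (\<Sum>n\<le>degree g. to_ac (coeff g n) * a ^ n)"
    proof (rule sum.mono_neutral_left)
      show "(\<lambda>i. i * p) ` {..degree g div p} \<subseteq> {..degree g}"
        using \<open>p \<noteq> 0\<close> by (auto simp: less_eq_div_iff_mult_less_eq)
      show "\<forall>n\<in>{..degree g} - (\<lambda>i. i * p) ` {..degree g div p}. to_ac (coeff g n) * a ^ n = 0"
      proof
        fix n assume n: "n \<in> {..degree g} - (\<lambda>i. i * p) ` {..degree g div p}"
        have "\<not> p dvd n"
        proof
          assume "p dvd n"
          then have "n = (n div p) * p" "n div p \<le> degree g div p" using n by (auto intro: div_le_mono)
          then show False using n by blast
        qed
        then show "to_ac (coeff g n) * a ^ n = 0" using cz p_def by simp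
      qed
    qed simp
    also have "\<dots> = poly (ac_poly g) a"
      unfolding poly_altdef degree_ac_poly coeff_map_poly[of to_ac, OF to_ac_0] ..
    finally show ?thesis .
  qed
  then have "poly (ac_poly r) a = 0" using root \<open>p \<noteq> 0\<close> by simp
  ultimately show ?thesis using that by blast
qed

lemma minimal_annihilating_poly:
  fixes a :: "'k::field alg_closure"
  obtains g :: "'k poly" where "g \<noteq> 0" "poly (ac_poly g) a = 0"
    "\<And>f. poly (ac_poly f) a = 0 \<Longrightarrow> g dvd f"
proof -
  obtain g :: "'k poly" where g: "g \<noteq> 0 \<and> poly (ac_poly g) a = 0"
    and min: "\<And>r. r \<noteq> 0 \<and> poly (ac_poly r) a = 0 \<Longrightarrow> degree g \<le> degree r"
    using ex_has_least_nat[of "\<lambda>g. g \<noteq> 0 \<and> poly (ac_poly g) a = 0" _ degree]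
    by (metis alg_closure_algebraic)
  have dvd: "g dvd f" if f: "poly (ac_poly f) a = 0" for f
  proof -
    have "ac_poly (g * (f div g) + f mod g) = ac_poly f" by simp
    then have "ac_poly g * ac_poly (f div g) + ac_poly (f mod g) = ac_poly f"
      by (simp only: ac_poly_add ac_poly_mult)
    then have "poly (ac_poly f) a =
        poly (ac_poly g) a * poly (ac_poly (f div g)) a + poly (ac_poly (f mod g)) a"
      by (metis poly_add poly_mult)
    then have "poly (ac_poly (f mod g)) a = 0" using g f by simp
    then show ?thesis using min[of "f mod g"] degree_mod_less'[of g f] g
      by (metis dvd_eq_mod_eq_0 not_le)
  qed
  show ?thesis
  proof (rule that)
    show "g \<noteq> 0" "poly (ac_poly g) a = 0" using g by auto
  qed (rule dvd)
qed

text \<open>Let \<open>g\<close> be the minimal polynomial of \<open>a\<close> and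
  \<open>f = g * q\<close>. If the derivative of \<open>f\<close> vanished at \<open>a\<close>, then
  so would that of \<open>g\<close> or \<open>q\<close> itself. The former contradicts minimality of
  \<open>g\<close>, with perfectness covering the case \<open>pderiv g = 0\<close>; the latter makes
  \<open>g ^ 2\<close> a divisor of \<open>f\<close>.\<close>

lemma squarefree_imp_simple_root:
  fixes f :: "'k::field poly"
  assumes perfect: "perfect_field TYPE('k)" and "f \<noteq> 0"
    and sqf: "\<And>g q. f = g ^ 2 * q \<Longrightarrow> degree g = 0"
    and root: "poly (ac_poly f) a = 0"
  shows "poly (pderiv (ac_poly f)) a \<noteq> 0"
proof
  assume d: "poly (pderiv (ac_poly f)) a = 0"
  obtain g :: "'k poly" where g: "g \<noteq> 0" "poly (ac_poly g) a = 0"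
    and gdvd: "\<And>f. poly (ac_poly f) a = 0 \<Longrightarrow> g dvd f"
    using minimal_annihilating_poly[of a] by metis
  have min: "degree g \<le> degree r" if "r \<noteq> 0" "poly (ac_poly r) a = 0" for r
    using gdvd that dvd_imp_degree_le by blast
  have pos: "degree g > 0"
  proof (rule ccontr)
    assume "\<not> degree g > 0"
    then obtain c where "g = [:c:]" by (metis degree_eq_zeroE gr0I)
    with g show False by (simp add: map_poly_pCons)
  qed
  obtain q where q: "f = g * q" using gdvd[OF root] by auto
  have "poly (ac_poly (pderiv g)) a * poly (ac_poly q) a = 0"
    using d g by (simp add: q ac_poly_mult pderiv_mult ac_poly_pderiv mult.commute)
  then consider "poly (ac_poly (pderiv g)) a = 0" | "poly (ac_poly q) a = 0" by auto
  then show False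
  proof cases
    case 1
    show False
    proof (cases "pderiv g = 0")
      case True
      then show False using pderiv_eq_0_perfect[OF perfect True g(2,1)] min by (metis not_le)
    next
      case False
      have "degree (pderiv g) < degree g"
        using pos by (intro degree_lessI) (auto simp: coeff_pderiv coeff_eq_0)
      then show False using min[OF False 1] by simp
    qed
  next
    case 2
    then obtain q' where "q = g * q'" using gdvd by auto
    then have "f = g ^ 2 * q'" using q by (simp add: power2_eq_square mult.assoc)
    then show False using sqf pos by force
  qed
qed

text \<open>A repeated root would also be a root of the derivative, so the multiset of roots
  provided by algebraic closedness is a set.\<close>

lemma squarefree_splits_distinct:
  fixes f :: "'k::field poly"
  assumes "perfect_field TYPE('k)" and f: "f \<noteq> 0"
    and "\<And>g q. f = g ^ 2 * q \<Longrightarrow> degree g = 0"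
  obtains A c where "finite A" "c \<noteq> 0" "card A = degree f"
    "ac_poly f = smult c (\<Prod>a\<in>A. [:- a, 1:])"
proof -
  let ?f = "ac_poly f"
  have f0: "?f \<noteq> 0" using f by (simp add: ac_poly_eq_0_iff)
  obtain M where M: "size M = degree ?f" "?f = smult (lead_coeff ?f) (\<Prod>x\<in>#M. [:-x, 1:])"
    using alg_closed_imp_factorization[OF f0] by blast
  have dist: "count M a \<le> 1" for a
  proof (rule ccontr)
    assume "\<not> count M a \<le> 1"
    then have "2 \<le> count M a" by simp
    then have "{#a, a#} \<subseteq># M" by (simp add: subseteq_mset_def)
    then obtain M' where "M = add_mset a (add_mset a M')"
      by (metis add_mset_add_single subset_mset.le_iff_add union_mset_add_mset_left add_0)
    then have "(\<Prod>x\<in>#M. [:-x, 1:]) = [:- a, 1:] * ([:- a, 1:] * (\<Prod>x\<in>#M'. [:-x, 1:]))" by simp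
    then have e: "?f = [:- a, 1:] * ([:- a, 1:] * smult (lead_coeff ?f) (\<Prod>x\<in>#M'. [:-x, 1:]))"
      using M(2) by (simp only: mult_smult_right)
    then obtain Q where e: "?f = [:- a, 1:] * ([:- a, 1:] * Q)" by blast
    have "poly ?f a = 0" "poly (pderiv ?f) a = 0" unfolding e by (simp_all only: poly_mult poly_add pderiv_mult) simp_all
    moreover from this(1) have "poly (pderiv ?f) a \<noteq> 0"
      by (rule squarefree_imp_simple_root[OF assms(1) f, rotated]) (erule assms(3))
    ultimately show False by simp
  qed
  have "count M a = count (mset_set (set_mset M)) a" for a
    using dist[of a] by (cases "a \<in># M") (auto simp: count_mset_set' le_Suc_eq not_in_iff[symmetric] count_eq_zero_iff)
  then have "M = mset_set (set_mset M)" by (rule multiset_eqI)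
  then have "(\<Prod>x\<in>#M. [:-x, 1:]) = (\<Prod>x\<in>set_mset M. [:-x, 1:])" "card (set_mset M) = size M"
    by (metis prod_unfold_prod_mset, metis size_mset_set)
  then show ?thesis
    using M f0 leading_coeff_neq_0[OF f0]
    by (intro that[of "set_mset M" "lead_coeff ?f"]) (simp_all only: degree_ac_poly finite_set_mset not_False_eq_True)
qed

section \<open>The quadrics\<close>

lemma term_of_eq_0_iff [simp]: "term_of e c = 0 \<longleftrightarrow> c = 0"
  using lookup_single_eq[of e c] by (cases "c = 0") (force simp del: lookup_single_eq)+

lemma exponent_degree_2E:
  assumes "exponent_degree e = 2"
  obtains i j where "i \<le> j" "e = var_exp j + var_exp i"
proof -
  have "keys e \<noteq> {}" using assms by (auto simp: exponent_degree_def)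
  then obtain i where i: "i \<in> keys e" by blast
  then obtain e' where e': "e = e' + var_exp i" by (rule exponent_split)
  have "exponent_degree e' = 1" using assms by (simp add: e' exponent_degree_add)
  then obtain j where "e' = var_exp j" by (rule exponent_degree_1E)
  then show ?thesis using that[of i j] that[of j i] e' by (cases "i \<le> j") (auto simp: add.commute)
qed

text \<open>The set \<open>A\<close> of admissible index pairs is left open: all pairs
  \<open>i \<le> j\<close> span the quadrics, the pairs \<open>i < j\<close> those without squares
  of variables.\<close>

lemma quadratic_form_span:
  fixes f :: "'a::field mpol"
  assumes f: "f \<in> polys N" "f \<in> forms 2"
    and A: "\<And>i j. i \<le> j \<Longrightarrow> j < N \<Longrightarrow> var_exp j + var_exp i \<in> keys f \<Longrightarrow> (i, j) \<in> A"
  shows "f \<in> mpol.span ((\<lambda>(i, j). mpol_var i * mpol_var j) ` A)"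
proof -
  have "term_of e (lookup f e) \<in> mpol.span ((\<lambda>(i, j). mpol_var i * mpol_var j) ` A)" if e: "e \<in> keys f" for e
  proof -
    have d: "exponent_degree e = 2" "keys e \<subseteq> {..<N}" using e f by (auto simp: weight_eq_def polys_iff)
    then obtain i j where ij: "i \<le> j" "e = var_exp j + var_exp i" by (auto elim: exponent_degree_2E)
    then have "j < N" using d(2) by (auto simp: in_keys_iff lookup_add subset_eq)
    then have "(i, j) \<in> A" using A ij e by blast
    then have "const (lookup f e) * (mpol_var i * mpol_var j) \<in>
        mpol.span ((\<lambda>(i, j). mpol_var i * mpol_var j) ` A)"
      by (intro mpol.span_scale mpol.span_base) auto
    then show ?thesis by (simp add: ij mpol_var_def mult_single add.commute)
  qed
  then have "(\<Sum>e\<in>keys f. term_of e (lookup f e)) \<in> mpol.span ((\<lambda>(i, j). mpol_var i * mpol_var j) ` A)"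
    by (rule mpol.span_sum)
  then show ?thesis by (simp add: sum_terms)
qed

lemma card_index_pairs: "card {(i, j). i \<le> j \<and> j < (N::nat)} = N + (N choose 2)"
  and finite_index_pairs: "finite {(i, j). i \<le> j \<and> j < (N::nat)}"
proof -
  have eq: "{(i, j). i \<le> j \<and> j < (N::nat)} = prod.swap ` (SIGMA j:{..<N}. {..j})" by force
  show "finite {(i, j). i \<le> j \<and> j < (N::nat)}" unfolding eq by auto
  have "card {(i, j). i \<le> j \<and> j < (N::nat)} = card (SIGMA j:{..<N}. {..j})"
    unfolding eq by (rule card_image) (auto intro: inj_onI)
  also have "\<dots> = (\<Sum>j<N. Suc j)" by simp
  also have "\<dots> = N + (N choose 2)"
    by (induction N) (auto simp: numeral_2_eq_2)
  finally show "card {(i, j). i \<le> j \<and> j < (N::nat)} = N + (N choose 2)" .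
qed

text \<open>The statement concerns a family, whereas independence is a notion for sets. A repeated
  value is itself a dependence, with coefficients \<open>1\<close> and \<open>- 1\<close>; without
  repetition there are \<open>N + 1\<close> distinct linear forms.\<close>

lemma linear_dependence:
  fixes v :: "nat \<Rightarrow> 'a::field mpol"
  assumes "\<And>j. v j \<in> linear_forms N"
  obtains c j0 where "j0 \<le> N" "c j0 \<noteq> 0" "(\<Sum>j\<le>N. const (c j) * v j) = 0"
proof (cases "inj_on v {..N}")
  case True
  have "mpol.dependent (v ` {..N})"
  proof (rule ccontr)
    assume "mpol.independent (v ` {..N})"
    then have "card (v ` {..N}) \<le> N" using assms by (intro linear_forms_independent_card) auto
    then show False using card_image[OF True] by simp
  qed
  then obtain u w where "w \<in> v ` {..N}" "u w \<noteq> 0" "(\<Sum>x\<in>v ` {..N}. const (u x) * x) = 0"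
    using mpol.dependent_finite[of "v ` {..N}"] by auto
  then show ?thesis using that[of _ "\<lambda>j. u (v j)"] by (auto simp: sum.reindex[OF True])
next
  case False
  then obtain i j where ij: "i \<le> N" "j \<le> N" "i \<noteq> j" "v i = v j" by (auto simp: inj_on_def)
  have "(\<Sum>k\<le>N. const (if k = i then 1 else if k = j then - 1 else 0) * v k)
      = (\<Sum>k\<in>{i, j}. const (if k = i then 1 else if k = j then - 1 else 0) * v k)"
    by (rule sum.mono_neutral_right) (use ij in auto)
  also have "\<dots> = v i + const (- 1) * v j" using ij by simp
  also have "\<dots> = 0" using ij by (simp add: single_uminus)
  finally show ?thesis using that[of i "\<lambda>k. if k = i then 1 else if k = j then - 1 else 0"] ij by simp
qed

section \<open>The ideal in degrees one and two\<close>

locale radical_quadrics =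
  fixes I G :: "'k::field mpol set" and N :: nat
  assumes ideal_I: "ideal I (mpol_ring N)"
    and radical_I: "\<And>f n. f \<in> polys N \<Longrightarrow> f ^ n \<in> I \<Longrightarrow> f \<in> I"
    and finite_G: "finite G" and card_G: "card G = N choose 2"
    and quadrics_G: "\<And>g. g \<in> G \<Longrightarrow> g \<in> forms 2"
    and minimal_G: "minimal_generating_set (mpol_ring N) G I"
    and perfect: "perfect_field TYPE('k)"
    and N_pos: "N > 0"
begin

lemma G_polys: "G \<subseteq> polys N" and I_eq: "I = Idl\<^bsub>mpol_ring N\<^esub> G"
  using minimal_G by (auto simp: minimal_generating_set_def)

lemma G_subset_I: "G \<subseteq> I"
  unfolding I_eq by (rule ring.genideal_self[OF ring_mpol_ring G_polys])

lemmas I_zero = ideal_zero[OF ideal_I] and I_add = ideal_add[OF ideal_I] and I_mult = ideal_mult[OF ideal_I]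
  and I_uminus = ideal_uminus[OF ideal_I] and I_diff = ideal_diff[OF ideal_I] and I_sum = ideal_sum[OF ideal_I]

lemma I_polys: "f \<in> I \<Longrightarrow> f \<in> polys N" using ideal_subset[OF ideal_I] by blast

lemma I_weight_ge: "I \<subseteq> order_ge 2"
proof -
  have "I \<subseteq> polys N \<inter> order_ge 2"
    unfolding I_eq by (rule genideal_subset[OF ideal_weight_ge[OF additive_weight_degree]])
      (use G_polys weight_eq_imp_ge[OF quadrics_G] in auto)
  then show ?thesis by blast
qed

text \<open>The polynomials all of whose homogeneous parts lie in \<open>I\<close> form an ideal,
  and it contains the homogeneous generators.\<close>

lemma I_part:
  assumes "f \<in> I"
  shows "form_part n f \<in> I"
proof -
  have "ideal {f \<in> polys N. \<forall>n. form_part n f \<in> I} (mpol_ring N)"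
    unfolding ideal_mpol_ring_iff
  proof (intro conjI ballI)
    fix r f :: "'k mpol" assume r: "r \<in> polys N" and f: "f \<in> {f \<in> polys N. \<forall>n. form_part n f \<in> I}"
    have "form_part n (r * f) \<in> I" for n
    proof -
      have "r * f = (\<Sum>j\<in>exponent_degree ` keys r. form_part j r * f)"
        by (simp add: sum_distrib_right[symmetric] sum_parts')
      then have "form_part n (r * f) =
          (\<Sum>j\<in>exponent_degree ` keys r. form_part n (form_part j r * f))"
        by (simp add: part_sum)
      also have "\<dots> \<in> I"
        using f r by (intro I_sum)
          (auto simp: part_mult_homogeneous[OF additive_weight_degree part_in_weight_eq] part_polys
            intro: I_mult I_zero)
      finally show ?thesis .
    qed
    then show "r * f \<in> {f \<in> polys N. \<forall>n. form_part n f \<in> I}" using r f by auto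
  qed (auto simp: part_add intro: I_add I_zero)
  moreover have "G \<subseteq> {f \<in> polys N. \<forall>n. form_part n f \<in> I}"
    using G_polys G_subset_I I_zero by (auto simp: part_weight_eq[OF quadrics_G])
  ultimately have "I \<subseteq> {f \<in> polys N. \<forall>n. form_part n f \<in> I}"
    unfolding I_eq by (rule genideal_subset)
  then show ?thesis using assms by blast
qed

lemma span_subset_I:
  assumes "A \<subseteq> I"
  shows "mpol.span A \<subseteq> I"
  by (rule mpol_subspace_span_mono[OF assms])
    (auto intro: I_add I_zero I_mult)

text \<open>Minimality of the generators becomes linear independence: a generator in the span of the
  others would already lie in the ideal they generate.\<close>

lemma independent_G: "mpol.independent G"
proof
  assume "mpol.dependent G"
  then obtain g where g: "g \<in> G" "g \<in> mpol.span (G - {g})" by (auto simp: mpol.dependent_def)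
  have "ideal (Idl\<^bsub>mpol_ring N\<^esub> (G - {g})) (mpol_ring N)"
    by (rule ring.genideal_ideal[OF ring_mpol_ring]) (use G_polys in auto)
  moreover have gs: "G - {g} \<subseteq> Idl\<^bsub>mpol_ring N\<^esub> (G - {g})"
    by (rule ring.genideal_self[OF ring_mpol_ring]) (use G_polys in auto)
  ultimately have "mpol.span (G - {g}) \<subseteq> Idl\<^bsub>mpol_ring N\<^esub> (G - {g})"
    by (intro mpol_subspace_span_mono) (auto intro: ideal_add ideal_zero ideal_mult)
  then have "G \<subseteq> Idl\<^bsub>mpol_ring N\<^esub> (G - {g})" using g gs by auto
  then have "Idl\<^bsub>mpol_ring N\<^esub> G \<subseteq> Idl\<^bsub>mpol_ring N\<^esub> (G - {g})"
    by (rule genideal_subset[rotated]) fact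
  moreover have "Idl\<^bsub>mpol_ring N\<^esub> (G - {g}) \<subseteq> I"
    by (rule genideal_subset[OF ideal_I]) (use G_subset_I in auto)
  ultimately have "Idl\<^bsub>mpol_ring N\<^esub> (G - {g}) = I" using I_eq by auto
  moreover have "G - {g} \<subset> G" using g by auto
  ultimately show False using minimal_G by (auto simp: minimal_generating_set_def)
qed

lemma linear_form_in_I:
  assumes "f \<in> I" "f \<in> linear_forms N"
  shows "f = 0"
proof -
  have "e \<notin> keys f" for e
    using assms I_weight_ge by (force simp: linear_forms_def weight_ge_def weight_eq_def)
  then show ?thesis by (metis equals0I keys_eq_empty)
qed

lemma square_in_I: "f \<in> polys N \<Longrightarrow> f * f \<in> I \<Longrightarrow> f \<in> I"
  using radical_I[of f 2] by (simp add: power2_eq_square)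

lemma linear_forms_polys: "f \<in> linear_forms N \<Longrightarrow> f \<in> polys N"
  by (simp add: linear_forms_def)

text \<open>Pairwise orthogonal linear forms are independent because the coordinate ring is reduced.
  The sum of a maximal orthogonal family is a non-zero-divisor on linear forms.\<close>

lemma exists_nonzerodivisor:
  obtains l where "l \<in> linear_forms N" "\<And>a. a \<in> linear_forms N \<Longrightarrow> l * a \<in> I \<Longrightarrow> a = 0"
proof -
  define orth where "orth F \<longleftrightarrow> F \<subseteq> linear_forms N - {0} \<and> (\<forall>a\<in>F. \<forall>b\<in>F. a \<noteq> b \<longrightarrow> a * b \<in> I)" for F
  have ind: "mpol.independent F" if F: "orth F" for F
    unfolding mpol.independent_explicit_finite_subsets
  proof (intro allI impI ballI)
    fix S u v assume S: "S \<subseteq> F" "finite S" "(\<Sum>v\<in>S. const (u v) * v) = 0" "v \<in> S"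
    have FI: "a * b \<in> I" if "a \<in> F" "b \<in> F" "a \<noteq> b" for a b using F that by (simp add: orth_def)
    have v: "v \<in> linear_forms N" "v \<noteq> 0" using F S by (auto simp: orth_def)
    \<comment> \<open>After multiplication by \<open>v\<close>, orthogonality leaves only the term
      with \<open>v * v\<close> modulo \<open>I\<close>.\<close>
    have "(\<Sum>w\<in>S. const (u w) * w * v) = 0" using S(3) by (simp add: sum_distrib_right[symmetric])
    then have "const (u v) * (v * v) = - (\<Sum>w\<in>S - {v}. const (u w) * (w * v))"
      using sum.remove[OF S(2,4), of "\<lambda>w. const (u w) * w * v"] by (simp add: mult.assoc eq_neg_iff_add_eq_0)
    also have "\<dots> \<in> I"
      by (intro I_uminus I_sum I_mult FI) (use S in auto)
    finally have "const (u v) * (const (u v) * (v * v)) \<in> I" by (rule I_mult[OF polys_const])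
    then have "(const (u v) * v) * (const (u v) * v) \<in> I" by (simp add: mult_ac)
    then have "const (u v) * v \<in> I"
      by (rule square_in_I[rotated]) (use v linear_forms_polys in auto)
    then have "const (u v) * v = 0" using linear_form_in_I linear_forms_scale v by blast
    then show "u v = 0" using v by auto
  qed
  have bound: "finite F \<and> card F \<le> N" if "orth F" for F
    using linear_forms_independent_card[OF ind[OF that]] that by (auto simp: orth_def)
  have "\<exists>F. orth F \<and> (\<forall>F'. orth F' \<longrightarrow> card F' \<le> card F)"
  proof (rule ex_has_greatest_nat)
    show "orth {}" by (simp add: orth_def)
    show "\<forall>F. orth F \<longrightarrow> card F < Suc N" using bound by (simp add: less_Suc_eq_le)
  qed
  then obtain F where F: "orth F" and max: "\<And>F'. orth F' \<Longrightarrow> card F' \<le> card F" by blast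
  have fin: "finite F" using bound[OF F] by simp
  have Flin: "\<And>a. a \<in> F \<Longrightarrow> a \<in> linear_forms N" "\<And>a. a \<in> F \<Longrightarrow> a \<noteq> 0" using F by (auto simp: orth_def)
  show ?thesis
  proof (rule that[of "\<Sum>F"])
    show l: "\<Sum>F \<in> linear_forms N" using Flin by (intro linear_forms_sum)
    fix a assume a: "a \<in> linear_forms N" "\<Sum>F * a \<in> I"
    have ba: "b * a \<in> I" if b: "b \<in> F" for b
    proof -
      \<comment> \<open>The factor \<open>b\<close> makes every summand with
        \<open>c \<noteq> b\<close> a multiple of some \<open>c * b \<in> I\<close>, and the factor
        \<open>a\<close> turns the remaining one into the square of \<open>b * a\<close>. Radicality
        then gives \<open>b * a \<in> I\<close>.\<close>
      have "(a * b) * (\<Sum>F * a) = a * b * a * b + (\<Sum>c\<in>F - {b}. a * a * (c * b))"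
        by (subst sum.remove[OF fin b]) (simp add: algebra_simps sum_distrib_left)
      moreover have "(a * b) * (\<Sum>F * a) \<in> I"
        by (intro I_mult a) (use a b Flin linear_forms_polys in auto)
      moreover have "(\<Sum>c\<in>F - {b}. a * a * (c * b)) \<in> I"
        by (rule I_sum, rule I_mult)
          (use F a b linear_forms_polys in \<open>auto simp: orth_def\<close>)
      ultimately have "a * b * a * b \<in> I" using I_diff by (metis add_diff_cancel_right')
      then have "(b * a) * (b * a) \<in> I" by (simp add: mult_ac)
      then show ?thesis by (rule square_in_I[rotated]) (use a b Flin linear_forms_polys in auto)
    qed
    show "a = 0"
    proof (rule ccontr)
      assume "a \<noteq> 0"
      have "a \<notin> F"
      proof
        assume "a \<in> F"
        then have "a \<in> I" using ba[of a] a linear_forms_polys square_in_I by blast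
        then show False using linear_form_in_I a \<open>a \<noteq> 0\<close> by blast
      qed
      moreover have "orth (insert a F)"
        unfolding orth_def using F a ba \<open>a \<noteq> 0\<close> by (auto simp: orth_def mult.commute)
      ultimately show False using max[of "insert a F"] fin by simp
    qed
  qed
qed

section \<open>Dehomogenization by a non-zero-divisor\<close>

definition ell :: "'k mpol" where
  "ell = (SOME l. l \<in> linear_forms N \<and> (\<forall>a\<in>linear_forms N. l * a \<in> I \<longrightarrow> a = 0))"

lemma ell: "ell \<in> linear_forms N" "a \<in> linear_forms N \<Longrightarrow> ell * a \<in> I \<Longrightarrow> a = 0"
proof -
  have "\<exists>l. l \<in> linear_forms N \<and> (\<forall>a\<in>linear_forms N. l * a \<in> I \<longrightarrow> a = 0)"
    using exists_nonzerodivisor by metis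
  from someI_ex[OF this] show "ell \<in> linear_forms N" "a \<in> linear_forms N \<Longrightarrow> ell * a \<in> I \<Longrightarrow> a = 0"
    unfolding ell_def[symmetric] by auto
qed

lemma ell_polys: "ell \<in> polys N" using ell(1) linear_forms_polys by blast

text \<open>The defining property of \<open>ell\<close> concerns only linear forms, so its powers
  cannot be removed one at a time. Instead a power of \<open>ell * a\<close> is shown to lie in
  \<open>I\<close>, and radicality leads back to \<open>ell * a \<in> I\<close>.\<close>

lemma ell_power_cancel:
  assumes a: "a \<in> linear_forms N" and "ell ^ n * a \<in> I"
  shows "a = 0"
proof -
  have "ell * a ^ Suc n * (ell ^ n * a) \<in> I"
    by (rule I_mult[OF _ assms(2)]) (use a ell_polys linear_forms_polys in auto)
  then have "a * (ell * a) ^ Suc n \<in> I" by (simp add: mult_ac power_mult_distrib)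
  then have "ell * (a * (ell * a) ^ Suc n) \<in> I" by (rule I_mult[OF ell_polys])
  then have "(ell * a) ^ Suc (Suc n) \<in> I" by (simp add: mult_ac)
  then have "ell * a \<in> I" by (rule radical_I[rotated]) (use a ell_polys linear_forms_polys in auto)
  then show ?thesis using ell(2) a by blast
qed

text \<open>The generators and the products of \<open>ell\<close> with the variables are
  \<open>(N choose 2) + N\<close> independent quadrics, as many as there are quadratic monomials, so
  they span all quadrics. After division by \<open>ell\<close> the linear forms are therefore closed
  under multiplication modulo \<open>I\<close>.\<close>

lemma linear_product:
  assumes "a \<in> linear_forms N" "b \<in> linear_forms N"
  obtains c where "c \<in> linear_forms N" "a * b - ell * c \<in> I"
proof -
  define T :: "'k mpol set" where "T = (\<lambda>(i, j). mpol_var i * mpol_var j) ` {(i, j). i \<le> j \<and> j < N}"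
  let ?E = "\<lambda>n. (\<lambda>i. ell * mpol_var i) ` {..<n}"
  have fT: "finite T" and cT: "card T \<le> N + (N choose 2)"
    using card_image_le[OF finite_index_pairs[of N]] finite_index_pairs[of N]
    by (auto simp: T_def card_index_pairs)
  have spanE: "mpol.span (?E n) \<subseteq> (\<lambda>b. ell * b) ` linear_forms n" for n
  proof (rule mpol_subspace_span_mono)
    show "?E n \<subseteq> (\<lambda>b. ell * b) ` linear_forms n" using linear_forms_var by auto
    show "0 \<in> (\<lambda>b. ell * b) ` linear_forms n" by (intro image_eqI[of _ _ 0]) auto
  next
    fix f g assume "f \<in> (\<lambda>b. ell * b) ` linear_forms n" "g \<in> (\<lambda>b. ell * b) ` linear_forms n"
    then obtain a b where "a \<in> linear_forms n" "b \<in> linear_forms n" "f = ell * a" "g = ell * b" by auto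
    then show "f + g \<in> (\<lambda>b. ell * b) ` linear_forms n"
      by (intro image_eqI[of _ _ "a + b"]) (auto simp: distrib_left linear_forms_add)
  next
    fix c f assume "f \<in> (\<lambda>b. ell * b) ` linear_forms n"
    then obtain a where "a \<in> linear_forms n" "f = ell * a" by auto
    then show "const c * f \<in> (\<lambda>b. ell * b) ` linear_forms n"
      by (intro image_eqI[of _ _ "const c * a"]) (simp_all add: mult.left_commute linear_forms_scale)
  qed
  have span_decomp: "\<exists>g c. g \<in> I \<and> c \<in> linear_forms n \<and> f = g + ell * c"
    if f: "f \<in> mpol.span (G \<union> ?E n)" for f n
  proof -
    obtain g h where "f = g + h" "g \<in> mpol.span G" "h \<in> mpol.span (?E n)"
      using f by (auto simp: mpol.span_Un)
    then show ?thesis using spanE span_subset_I[OF G_subset_I] by blast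
  qed
  \<comment> \<open>The variables enter one at a time. A dependence would give
    \<open>ell * (mpol_var n - c) \<in> I\<close> with \<open>c\<close> a linear form in the
    variables before the \<open>n\<close>-th, hence \<open>mpol_var n = c\<close>, which is
    absurd.\<close>
  have ind: "mpol.independent (G \<union> ?E n) \<and> card (G \<union> ?E n) = card G + n" if "n \<le> N" for n
    using that
  proof (induction n)
    case 0
    then show ?case using independent_G by simp
  next
    case (Suc n)
    then have IH: "mpol.independent (G \<union> ?E n)" "card (G \<union> ?E n) = card G + n" by auto
    have notin: "ell * mpol_var n \<notin> mpol.span (G \<union> ?E n)"
    proof
      assume "ell * mpol_var n \<in> mpol.span (G \<union> ?E n)"
      then obtain g c where gc: "g \<in> I" "c \<in> linear_forms n" "ell * mpol_var n = g + ell * c"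
        using span_decomp by blast
      have "c \<in> linear_forms N" using gc(2) Suc.prems by (force simp: linear_forms_def polys_iff)
      then have "mpol_var n - c \<in> linear_forms N" using Suc.prems by (intro linear_forms_diff linear_forms_var) auto
      moreover have "ell * (mpol_var n - c) \<in> I" using gc by (simp add: algebra_simps)
      ultimately have "mpol_var n = c" using ell(2) by force
      then have "(mpol_var n :: 'k mpol) \<in> polys n" using gc(2) linear_forms_def by blast
      then show False by (simp add: mpol_var_def polys_iff)
    qed
    have eq: "G \<union> ?E (Suc n) = insert (ell * mpol_var n) (G \<union> ?E n)" by (auto simp: lessThan_Suc)
    have "mpol.independent (G \<union> ?E (Suc n))" unfolding eq using notin IH by (intro mpol.independent_insertI)
    moreover have "card (G \<union> ?E (Suc n)) = card G + Suc n"
    proof -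
      have "ell * mpol_var n \<notin> G \<union> ?E n" using notin mpol.span_base[of _ "G \<union> ?E n"] by metis
      then have "card (insert (ell * mpol_var n) (G \<union> ?E n)) = Suc (card (G \<union> ?E n))"
        by (rule card_insert_disjoint[rotated]) (simp add: finite_G)
      then show ?thesis unfolding eq IH(2) by simp
    qed
    ultimately show ?case by (rule conjI)
  qed
  have q: "f * g \<in> polys N \<inter> forms 2" if "f \<in> linear_forms N" "g \<in> linear_forms N"
    for f g :: "'k mpol"
    using that forms_mult[of f 1 g 1] by (auto simp: linear_forms_def numeral_2_eq_2)
  have T: "polys N \<inter> forms 2 \<subseteq> mpol.span T" unfolding T_def by (auto intro: quadratic_form_span)
  then have sub: "G \<union> ?E N \<subseteq> mpol.span T" using q[OF ell(1) linear_forms_var] quadrics_G G_polys by blast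
  have "mpol.span T \<subseteq> mpol.span (G \<union> ?E N)"
    by (rule independent_card_eq_span[OF fT _ sub]) (use ind[of N] cT card_G in auto)
  moreover have "a * b \<in> mpol.span T" using q[OF assms] T by blast
  ultimately obtain g c where "g \<in> I" "c \<in> linear_forms N" "a * b = g + ell * c" using span_decomp by blast
  then show ?thesis using that by auto
qed

text \<open>In dehomogenized form this says \<open>(x / ell) ^ j = v / ell\<close>; a further factor
  \<open>x / ell\<close> is absorbed by \<open>linear_product\<close>.\<close>

lemma linear_power:
  assumes "x \<in> linear_forms N"
  shows "\<exists>v\<in>linear_forms N. x ^ j * ell - ell ^ j * v \<in> I"
proof (induction j)
  case 0
  show ?case using ell(1) I_zero by (intro bexI[of _ ell]) auto
next
  case (Suc j)
  then obtain v where v: "v \<in> linear_forms N" "x ^ j * ell - ell ^ j * v \<in> I" by blast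
  obtain c where c: "c \<in> linear_forms N" "v * x - ell * c \<in> I" using linear_product[OF v(1) assms] by blast
  have "x * (x ^ j * ell - ell ^ j * v) + ell ^ j * (v * x - ell * c) \<in> I"
    by (intro I_add I_mult v c)
      (use assms ell_polys linear_forms_polys in auto)
  then have "x ^ Suc j * ell - ell ^ Suc j * c \<in> I" by (simp add: algebra_simps)
  then show ?case using c by blast
qed

lemma homogenized_polys:
  assumes "x \<in> polys N" "l \<in> polys N"
  shows "homogenized const x l n f \<in> polys N"
  unfolding homogenized_def using assms by (intro polys_sum polys_mult polys_power) auto

text \<open>The \<open>N + 1\<close> linear forms that represent the powers of
  \<open>x / ell\<close> up to exponent \<open>N\<close> satisfy a linear relation, whose
  coefficients are those of \<open>f\<close>. The homogenization has degree \<open>N + 1\<close>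
  rather than \<open>N\<close> because each power is multiplied by \<open>ell\<close> to be
  represented.\<close>

lemma annihilating_poly:
  assumes x: "x \<in> linear_forms N"
  obtains f n where "f \<noteq> 0" "degree f \<le> n" "homogenized const x ell n f \<in> I"
proof -
  have "\<forall>j. \<exists>v. v \<in> linear_forms N \<and> x ^ j * ell - ell ^ j * v \<in> I"
    using linear_power[OF x] by blast
  then obtain v where "\<forall>j. v j \<in> linear_forms N \<and> x ^ j * ell - ell ^ j * v j \<in> I"
    by (rule choice[THEN exE])
  then have v: "v j \<in> linear_forms N" "x ^ j * ell - ell ^ j * v j \<in> I" for j by auto
  obtain c j0 where c: "j0 \<le> N" "c j0 \<noteq> 0" "(\<Sum>j\<le>N. const (c j) * v j) = 0"
    by (rule linear_dependence[of v N, OF v(1)])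
  define f where "f = (\<Sum>j\<le>N. monom (c j) j)"
  have cf: "coeff f j = (if j \<le> N then c j else 0)" for j
    by (simp add: f_def coeff_sum coeff_monom sum.delta)
  have "f \<noteq> 0" using c cf[of j0] by auto
  moreover have df: "degree f \<le> N" by (rule degree_le) (simp add: cf)
  moreover have "homogenized const x ell (N + 1) f \<in> I"
  proof -
    have "(\<Sum>j\<le>N. const (c j) * ell ^ (N - j) * (x ^ j * ell - ell ^ j * v j)) \<in> I"
      by (intro I_sum I_mult v) (use ell_polys in auto)
    also have "(\<Sum>j\<le>N. const (c j) * ell ^ (N - j) * (x ^ j * ell - ell ^ j * v j)) =
        (\<Sum>j\<le>N. ell * (const (c j) * x ^ j * ell ^ (N - j)) - ell ^ N * (const (c j) * v j))"
    proof (intro sum.cong refl)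
      fix j assume "j \<in> {..N}"
      then have "ell ^ N = ell ^ (N - j) * ell ^ j" by (simp add: power_add[symmetric])
      then show "const (c j) * ell ^ (N - j) * (x ^ j * ell - ell ^ j * v j) =
          ell * (const (c j) * x ^ j * ell ^ (N - j)) - ell ^ N * (const (c j) * v j)"
        by (simp add: algebra_simps)
    qed
    also have "\<dots> = ell * (\<Sum>j\<le>N. const (c j) * x ^ j * ell ^ (N - j)) - ell ^ N * (\<Sum>j\<le>N. const (c j) * v j)"
      by (simp add: sum_subtractf sum_distrib_left)
    also have "\<dots> = ell * homogenized const x ell N f"
      using c(3) by (simp add: homogenized_def cf)
    also have "\<dots> = homogenized const x ell (N + 1) f"
      using homogenized_extend[OF ring_map_const df, of x ell 1] by simp
    finally show ?thesis .
  qed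
  ultimately show ?thesis using that[of f "N + 1"] by simp
qed

text \<open>Choose \<open>f\<close> of least degree. If \<open>f = g ^ 2 * q\<close>, then the
  square of \<open>g * q\<close> equals \<open>f * q\<close>, so by radicality \<open>g * q\<close>
  annihilates as well; minimality leaves \<open>g\<close> no positive degree.\<close>

lemma squarefree_annihilating_poly:
  assumes x: "x \<in> linear_forms N"
  obtains f n where "f \<noteq> 0" "degree f \<le> n" "homogenized const x ell n f \<in> I"
    "\<forall>g q. f = g ^ 2 * q \<longrightarrow> degree g = 0"
proof -
  let ?P = "\<lambda>f. f \<noteq> 0 \<and> (\<exists>n. degree f \<le> n \<and> homogenized const x ell n f \<in> I)"
  obtain f where f: "?P f" and min: "\<And>g. ?P g \<Longrightarrow> degree f \<le> degree g"
    using ex_has_least_nat[of ?P _ degree] annihilating_poly[OF x] by metis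
  obtain n where n: "degree f \<le> n" "homogenized const x ell n f \<in> I" using f by blast
  have "degree g = 0" if fg: "f = g ^ 2 * q" for g q
  proof -
    have g0: "g \<noteq> 0" "q \<noteq> 0" using f fg by auto
    have d: "degree f = degree g + (degree g + degree q)"
      using g0 by (simp add: fg power2_eq_square degree_mult_eq)
    let ?h = "homogenized const x ell"
    have "(g * q) * (g * q) = f * q" by (simp add: fg power2_eq_square mult_ac)
    then have "?h (n + n) ((g * q) * (g * q)) = ?h (n + n) (f * q)" by (simp only:)
    moreover have "?h (n + n) ((g * q) * (g * q)) = ?h n (g * q) * ?h n (g * q)"
      by (rule homogenized_mult[OF ring_map_const]) (use d n g0 in \<open>auto simp: degree_mult_eq\<close>)
    moreover have "?h (n + n) (f * q) = ?h n f * ?h n q"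
      by (rule homogenized_mult[OF ring_map_const]) (use d n in auto)
    ultimately have "?h n (g * q) * ?h n (g * q) = ?h n q * ?h n f" by (simp add: mult.commute)
    also have "\<dots> \<in> I"
      by (intro I_mult n homogenized_polys) (use x ell_polys linear_forms_polys in auto)
    finally have "?h n (g * q) \<in> I"
      by (rule square_in_I[OF homogenized_polys[OF linear_forms_polys[OF x] ell_polys]])
    moreover have "degree (g * q) \<le> n" using d n g0 by (auto simp: degree_mult_eq)
    ultimately have "degree f \<le> degree (g * q)" using min[of "g * q"] g0 by auto
    then show ?thesis using d g0 by (simp add: degree_mult_eq)
  qed
  then show ?thesis using that f n by blast
qed

end

section \<open>Extension of scalars\<close>

text \<open>Such a projection exists because \<open>to_ac\<close> is an injective linear map, so the
  base field has a complement in its algebraic closure. It is linear over the base field but in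
  general not multiplicative.\<close>

definition to_ac_retract :: "'k::field alg_closure \<Rightarrow> 'k" where
  "to_ac_retract = (SOME g. Vector_Spaces.linear (\<lambda>a b. to_ac a * b) (*) g \<and> (\<forall>v. g (to_ac v) = v))"

lemma to_ac_retract:
  fixes a b :: "'k::field alg_closure"
  shows "to_ac_retract (a + b) = to_ac_retract a + to_ac_retract b"
    "to_ac_retract (to_ac c * b) = c * to_ac_retract b"
    "to_ac_retract (1 :: 'k alg_closure) = 1"
    "to_ac_retract (0 :: 'k alg_closure) = 0"
proof -
  interpret vector_space_pair "(*) :: 'k \<Rightarrow> 'k \<Rightarrow> 'k" "\<lambda>a b. to_ac a * b :: 'k alg_closure"
    by unfold_locales (auto simp: algebra_simps)
  have lin: "Vector_Spaces.linear (*) (\<lambda>a b. to_ac a * b) (to_ac :: 'k \<Rightarrow> _)"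
    by unfold_locales (auto simp: algebra_simps)
  have "\<exists>g. Vector_Spaces.linear (\<lambda>a b. to_ac a * b) (*) g \<and> (\<forall>v :: 'k. g (to_ac v) = v)"
    using linear_exists_left_inverse_on[OF lin vs1.subspace_UNIV] inj_to_ac by auto
  from someI_ex[OF this]
  have g: "Vector_Spaces.linear (\<lambda>a b. to_ac a * b) (*) (to_ac_retract :: _ \<Rightarrow> 'k)"
      "\<And>v :: 'k. to_ac_retract (to_ac v) = v"
    unfolding to_ac_retract_def[symmetric] by blast+
  interpret g: Vector_Spaces.linear "\<lambda>a b. to_ac a * b :: 'k alg_closure" "(*)" to_ac_retract by (rule g(1))
  show "to_ac_retract (a + b) = to_ac_retract a + to_ac_retract b"
    "to_ac_retract (to_ac c * b) = c * to_ac_retract b" by (rule g.add g.scale)+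
  show "to_ac_retract (1 :: 'k alg_closure) = 1" "to_ac_retract (0 :: 'k alg_closure) = 0"
    using g(2)[of 1] g(2)[of 0] by simp_all
qed

definition poly_retract :: "'k::field alg_closure mpol \<Rightarrow> 'k mpol" where
  "poly_retract F = Poly_Mapping.map to_ac_retract F"

definition lift :: "'k::field mpol \<Rightarrow> 'k alg_closure mpol" where
  "lift = subst (\<lambda>c. const (to_ac c)) mpol_var"

lemma ring_map_const_to_ac: "ring_map (\<lambda>c. const (to_ac c))"
  by (simp add: ring_map_def const_add const_mult)

lemma ring_map_lift: "ring_map lift"
  unfolding lift_def by (rule ring_map_subst[OF ring_map_const_to_ac])

lemmas lift_simps = ring_map_simps[OF ring_map_lift]

lemma lift_term: "lift (term_of e c) = term_of e (to_ac c)"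
  by (simp add: lift_def subst_term[OF ring_map_const_to_ac] monomial_value_var mult_single)

lemma lift_var [simp]: "lift (mpol_var i) = mpol_var i"
  by (simp add: mpol_var_def lift_term)

lemma lift_const [simp]: "lift (const c) = const (to_ac c)" by (rule lift_term)

lemma lookup_lift: "lookup (lift f) e = to_ac (lookup f e)"
  by (induction f rule: poly_induct_terms)
    (auto simp: lift_simps lift_term lookup_add lookup_single when_def)

lemma keys_lift: "keys (lift f) = keys f" by (auto simp: in_keys_iff lookup_lift)

lemma lift_polys: "lift f \<in> polys N \<longleftrightarrow> f \<in> polys N" by (simp add: polys_iff keys_lift)

lemma lift_weight_eq: "lift f \<in> weight_eq w n \<longleftrightarrow> f \<in> weight_eq w n"
  by (simp add: weight_eq_def keys_lift)

lemma lift_linear_forms: "lift f \<in> linear_forms N \<longleftrightarrow> f \<in> linear_forms N"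
  by (simp add: linear_forms_def lift_polys lift_weight_eq)

lemma lookup_poly_retract: "lookup (poly_retract F) e = to_ac_retract (lookup F e)"
  by (simp add: poly_retract_def Poly_Mapping.map.rep_eq when_def to_ac_retract(4))

lemma keys_poly_retract: "keys (poly_retract F) \<subseteq> keys F"
  by (auto simp: in_keys_iff lookup_poly_retract to_ac_retract(4))

lemma poly_retract_polys: "F \<in> polys N \<Longrightarrow> poly_retract F \<in> polys N"
  using keys_poly_retract by (auto simp: polys_iff)

lemma poly_retract_weight_eq: "F \<in> weight_eq w n \<Longrightarrow> poly_retract F \<in> weight_eq w n"
  using keys_poly_retract by (auto simp: weight_eq_def)

lemma poly_retract_linear_forms: "F \<in> linear_forms N \<Longrightarrow> poly_retract F \<in> linear_forms N"
  by (simp add: linear_forms_def poly_retract_polys poly_retract_weight_eq)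

lemma poly_retract_add: "poly_retract (F + H) = poly_retract F + poly_retract H"
  by (rule poly_mapping_eqI) (simp add: lookup_poly_retract lookup_add to_ac_retract)

lemma poly_retract_0 [simp]: "poly_retract 0 = 0"
  by (rule poly_mapping_eqI) (simp add: lookup_poly_retract to_ac_retract)

lemma poly_retract_term: "poly_retract (term_of e c) = term_of e (to_ac_retract c)"
  by (rule poly_mapping_eqI) (simp add: lookup_poly_retract to_ac_retract lookup_single when_def)

lemma poly_retract_sum: "poly_retract (\<Sum>i\<in>A. f i) = (\<Sum>i\<in>A. poly_retract (f i))"
  by (induction A rule: infinite_finite_induct) (auto simp: poly_retract_add)

text \<open>This linearity over the polynomials of the base field replaces multiplicativity; it is
  why the retraction is compatible with ideals.\<close>

lemma poly_retract_lift_mult: "poly_retract (lift s * F) = s * poly_retract F"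
proof (induction s rule: poly_induct_terms)
  case (plus e c s)
  have "poly_retract (term_of e (to_ac c) * F) = term_of e c * poly_retract F"
  proof (induction F rule: poly_induct_terms)
    case (plus e' d F)
    then show ?case
      by (simp add: distrib_left poly_retract_add mult_single poly_retract_term to_ac_retract)
  qed simp
  then show ?case using plus by (simp add: distrib_right lift_simps poly_retract_add lift_term)
qed (simp add: lift_simps)

lemma poly_retract_lift [simp]: "poly_retract (lift s) = s"
proof -
  have "poly_retract 1 = (1 :: 'a mpol)"
    by (rule poly_mapping_eqI) (simp add: lookup_poly_retract lookup_one when_def to_ac_retract)
  then show ?thesis using poly_retract_lift_mult[of s 1] by simp
qed

text \<open>The retraction may send \<open>F\<close> itself to \<open>0\<close>. Scaling some
  coefficient to \<open>1\<close> first protects it.\<close>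

lemma poly_retract_const_nonzero:
  assumes "F \<noteq> 0"
  obtains c where "poly_retract (const c * F) \<noteq> 0"
proof -
  obtain e where e: "e \<in> keys F" using assms by (metis equals0I keys_eq_empty)
  have "lookup (poly_retract (const (inverse (lookup F e)) * F)) e = 1"
    using e by (simp add: lookup_poly_retract const_mult_lookup to_ac_retract in_keys_iff)
  then show ?thesis using that by (metis lookup_zero zero_neq_one)
qed

lemma homogenized_sum:
  "ring_map h \<Longrightarrow> homogenized h x l n (\<Sum>i\<in>A. f i) = (\<Sum>i\<in>A. homogenized h x l n (f i))"
  by (induction A rule: infinite_finite_induct) (auto simp: homogenized_add)

lemma lift_homogenized: "lift (homogenized const x l n f) = homogenized const (lift x) (lift l) n (ac_poly f)"
  by (simp add: homogenized_map_poly)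
    (simp add: homogenized_def ring_map_sum[OF ring_map_lift] lift_simps ring_map_power[OF ring_map_lift])

text \<open>Modulo \<open>J\<close> each variable is a multiple of \<open>l\<close>, so a monomial
  of degree \<open>d\<close> becomes its value at \<open>q\<close> times
  \<open>l ^ d\<close>.\<close>

lemma form_congruent_value:
  fixes F :: "'a::field mpol"
  assumes J: "ideal J (mpol_ring N)" and l: "l \<in> polys N"
    and q: "\<And>i. i < N \<Longrightarrow> mpol_var i - const (q i) * l \<in> J"
    and F: "F \<in> polys N" "F \<in> forms d"
  shows "F - const (value_at q F) * l ^ d \<in> J"
proof -
  have mono: "term_of e 1 - const (monomial_value q e) * l ^ d \<in> J"
    if "keys e \<subseteq> {..<N}" "exponent_degree e = d" for e d
    using that
  proof (induction d arbitrary: e)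
    case 0
    then have "e = 0" by (metis lookup_le_exponent_degree le_zero_eq lookup_zero poly_mapping_eqI)
    then show ?case using ideal_zero[OF J] by simp
  next
    case (Suc d)
    then have "keys e \<noteq> {}" by (auto simp: exponent_degree_def)
    then obtain i where i: "i \<in> keys e" by blast
    then obtain e' where e': "e = e' + var_exp i" by (rule exponent_split)
    have k: "keys e' \<subseteq> keys e" by (auto simp: e' in_keys_iff lookup_add)
    have d: "exponent_degree e' = d" using Suc.prems(2) by (simp add: e' exponent_degree_add)
    have iN: "i < N" using i Suc.prems(1) by auto
    have IH: "term_of e' 1 - const (monomial_value q e') * l ^ d \<in> J"
      using Suc.IH[of e'] k d Suc.prems(1) by blast
    have "term_of e' 1 * (mpol_var i - const (q i) * l) +
        (const (q i) * l) * (term_of e' 1 - const (monomial_value q e') * l ^ d) \<in> J"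
      using k Suc.prems(1) l
      by (intro ideal_add[OF J] ideal_mult[OF J _ IH] ideal_mult[OF J _ q[OF iN]] polys_mult polys_term) auto
    also have "term_of e' 1 * (mpol_var i - const (q i) * l) +
        (const (q i) * l) * (term_of e' 1 - const (monomial_value q e') * l ^ d) =
        term_of e' 1 * mpol_var i - (const (monomial_value q e') * const (q i)) * l ^ Suc d"
      by (simp add: algebra_simps)
    also have "term_of e' 1 * mpol_var i = (term_of e 1 :: 'a mpol)" by (simp add: e' mpol_var_def mult_single)
    also have "const (monomial_value q e') * const (q i) = const (monomial_value q e)"
      by (simp add: e' monomial_value_add mult_single)
    finally show ?case .
  qed
  have "F - const (value_at q F) * l ^ d =
      (\<Sum>e\<in>keys F. const (lookup F e) * (term_of e 1 - const (monomial_value q e) * l ^ d))"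
  proof -
    have "(\<Sum>e\<in>keys F. const (lookup F e) * (term_of e 1 - const (monomial_value q e) * l ^ d))
      = (\<Sum>e\<in>keys F. term_of e (lookup F e)) - (\<Sum>e\<in>keys F. const (lookup F e * monomial_value q e)) * l ^ d"
      by (simp add: algebra_simps sum_subtractf sum_distrib_left mult_single)
    also have "(\<Sum>e\<in>keys F. const (lookup F e * monomial_value q e)) = const (value_at q F)"
      by (simp only: subst_def ring_map_sum[OF ring_map_const])
    finally show ?thesis by (simp add: sum_terms)
  qed
  also have "\<dots> \<in> J"
    by (intro ideal_sum[OF J] ideal_mult[OF J] mono) (use F in \<open>auto simp: polys_iff weight_eq_def\<close>)
  finally show ?thesis .
qed

context radical_quadrics
begin

section \<open>Common zeros over the algebraic closure\<close>

text \<open>\<open>IK\<close> is the extension of \<open>I\<close> to the algebraic closure, described by retractions instead of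
  generators, and \<open>satK\<close> below is its saturation with respect to \<open>ell\<close>.\<close>

definition IK :: "'k alg_closure mpol set" where
  "IK = {F \<in> polys N. \<forall>c. poly_retract (const c * F) \<in> I}"

lemma ideal_IK: "ideal IK (mpol_ring N)"
  unfolding ideal_mpol_ring_iff
proof (intro conjI ballI)
  fix r F :: "'k alg_closure mpol" assume r: "r \<in> polys N" and F: "F \<in> IK"
  have "poly_retract (const c * (r * F)) \<in> I" for c
  proof -
    have "const c * (r * F) = (\<Sum>e\<in>keys r. const c * (term_of e (lookup r e) * F))"
      by (subst sum_terms[of r, symmetric]) (simp only: sum_distrib_left sum_distrib_right)
    \<comment> \<open>The coefficients of \<open>r\<close> are absorbed into \<open>c\<close>, which
      is why \<open>IK\<close> quantifies over all scalars; what remains of \<open>r\<close> are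
      lifted monomials.\<close>
    also have "\<dots> = (\<Sum>e\<in>keys r. lift (term_of e 1) * (const (c * lookup r e) * F))"
      by (simp add: lift_term mult_single mult.assoc[symmetric])
    finally have "poly_retract (const c * (r * F)) =
        (\<Sum>e\<in>keys r. term_of e 1 * poly_retract (const (c * lookup r e) * F))"
      by (simp only: poly_retract_sum poly_retract_lift_mult)
    also have "\<dots> \<in> I"
      by (intro I_sum I_mult) (use r F in \<open>auto simp: polys_iff IK_def\<close>)
    finally show ?thesis .
  qed
  then show "r * F \<in> IK" using r F by (auto simp: IK_def)
qed (auto simp: IK_def distrib_left poly_retract_add intro: I_add I_zero)

lemma lift_IK: "f \<in> I \<Longrightarrow> lift f \<in> IK"
  using I_mult[OF _ , of _ f]
  by (auto simp: IK_def lift_polys I_polys mult.commute[of _ "lift f"] poly_retract_lift_mult poly_retract_term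
      mult.commute[of f])

definition ellK :: "'k alg_closure mpol" where "ellK = lift ell"

lemma ellK: "ellK \<in> linear_forms N" "ellK \<in> polys N"
  using ell(1) by (simp_all add: ellK_def lift_linear_forms lift_polys ell_polys)

lemma ellK_power_cancel:
  assumes y: "y \<in> linear_forms N" and "ellK ^ n * y \<in> IK"
  shows "y = 0"
proof (rule ccontr)
  assume "y \<noteq> 0"
  then obtain c where c: "poly_retract (const c * y) \<noteq> 0" by (rule poly_retract_const_nonzero)
  have "poly_retract (const c * (ellK ^ n * y)) \<in> I" using assms(2) by (simp add: IK_def)
  also have "const c * (ellK ^ n * y) = lift (ell ^ n) * (const c * y)"
    by (simp add: ellK_def ring_map_power[OF ring_map_lift] mult_ac)
  finally have "ell ^ n * poly_retract (const c * y) \<in> I" by (simp only: poly_retract_lift_mult)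
  then have "poly_retract (const c * y) = 0"
    by (rule ell_power_cancel[rotated]) (intro poly_retract_linear_forms linear_forms_scale y)
  with c show False by simp
qed

definition satK :: "'k alg_closure mpol set" where
  "satK = {F \<in> polys N. \<exists>n. ellK ^ n * F \<in> IK}"

lemma ideal_satK: "ideal satK (mpol_ring N)"
  unfolding ideal_mpol_ring_iff
proof (intro conjI ballI)
  fix F H :: "'k alg_closure mpol" assume "F \<in> satK" "H \<in> satK"
  then obtain n m where *: "F \<in> polys N" "H \<in> polys N" "ellK ^ n * F \<in> IK" "ellK ^ m * H \<in> IK"
    by (auto simp: satK_def)
  have "ellK ^ m * (ellK ^ n * F) + ellK ^ n * (ellK ^ m * H) \<in> IK"
    using ellK by (intro ideal_add[OF ideal_IK] ideal_mult[OF ideal_IK] *) auto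
  then have "ellK ^ (n + m) * (F + H) \<in> IK" by (simp add: algebra_simps power_add)
  then show "F + H \<in> satK" using * by (auto simp: satK_def)
next
  fix r F :: "'k alg_closure mpol" assume "r \<in> polys N" "F \<in> satK"
  then obtain n where *: "F \<in> polys N" "r \<in> polys N" "ellK ^ n * F \<in> IK" by (auto simp: satK_def)
  have "r * (ellK ^ n * F) \<in> IK" by (rule ideal_mult[OF ideal_IK *(2,3)])
  then have "ellK ^ n * (r * F) \<in> IK" by (simp add: mult.left_commute)
  then show "r * F \<in> satK" using * by (auto simp: satK_def)
qed (use ideal_zero[OF ideal_IK] in \<open>auto simp: satK_def\<close>)

lemmas satK_zero = ideal_zero[OF ideal_satK] and satK_add = ideal_add[OF ideal_satK]
  and satK_mult = ideal_mult[OF ideal_satK] and satK_sum = ideal_sum[OF ideal_satK]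

lemma IK_subset_satK: "F \<in> IK \<Longrightarrow> F \<in> satK"
  using ideal_subset[OF ideal_IK] by (auto simp: satK_def intro: exI[of _ 0])

lemma satK_cancel: "F \<in> polys N \<Longrightarrow> ellK ^ n * F \<in> satK \<Longrightarrow> F \<in> satK"
  by (auto simp: satK_def power_add[symmetric] mult.assoc[symmetric])

text \<open>The squarefree polynomial that annihilates the variable splits into distinct linear
  factors over the algebraic closure. Passing to \<open>satK\<close> removes the power of
  \<open>ellK\<close> by which \<open>n\<close> exceeds its degree.\<close>

lemma splitting_set:
  assumes "i < N"
  obtains A where "finite A" "(\<Prod>a\<in>A. mpol_var i - const a * ellK) \<in> satK"
proof -
  obtain f n where f: "f \<noteq> 0" "degree f \<le> n" "homogenized const (mpol_var i) ell n f \<in> I"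
    and sqf: "\<forall>g q. f = g ^ 2 * q \<longrightarrow> degree g = 0"
    by (rule squarefree_annihilating_poly[OF linear_forms_var[OF assms]])
  obtain A c where A: "finite A" "c \<noteq> 0" "card A = degree f"
    "ac_poly f = smult c (\<Prod>a\<in>A. [:- a, 1:])"
    by (rule squarefree_splits_distinct[OF perfect f(1)]) (use sqf in blast)+
  let ?p = "\<Prod>a\<in>A. mpol_var i - const a * ellK"
  have pp: "?p \<in> polys N" using ellK assms by (intro polys_prod polys_diff polys_mult) auto
  obtain m where m: "n = card A + m" using f(2) A(3) by (metis le_add_diff_inverse)
  have "lift (homogenized const (mpol_var i) ell n f) = const c * (ellK ^ m * ?p)"
    using homogenized_extend[OF ring_map_const degree_prod_linear[OF ring_map_const A(1)], of "mpol_var i" ellK m]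
      homogenized_prod_linear[OF ring_map_const A(1), of "mpol_var i" ellK]
    by (simp add: lift_homogenized A(4) homogenized_smult[OF ring_map_const] m ellK_def)
  then have "const c * (ellK ^ m * ?p) \<in> IK" using lift_IK[OF f(3)] by simp
  then have "const (inverse c) * (const c * (ellK ^ m * ?p)) \<in> IK" by (rule ideal_mult[OF ideal_IK polys_const])
  moreover have "const (inverse c) * (const c * (ellK ^ m * ?p)) = ellK ^ m * ?p"
    using A(2) by (simp add: mult.assoc[symmetric] mult_single)
  ultimately have "ellK ^ m * ?p \<in> IK" by (simp only:)
  then have "?p \<in> satK" using pp unfolding satK_def by blast
  then show ?thesis using that A(1) by blast
qed

text \<open>The products \<open>H a\<close> are Lagrange numerators, and a linear combination of
  them is a power of \<open>ellK\<close>. As \<open>F\<close> is not in \<open>satK\<close>, some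
  \<open>H a\<close> keeps it outside, while the missing factor for \<open>a\<close> takes
  \<open>H a\<close> into \<open>satK\<close>.\<close>

lemma separate_variable:
  assumes i: "i < N" and F: "F \<in> polys N" "F \<notin> satK"
  obtains a H where "H \<in> polys N" "H * F \<notin> satK" "(mpol_var i - const a * ellK) * H \<in> satK"
proof -
  obtain A where A: "finite A" "(\<Prod>a\<in>A. mpol_var i - const a * ellK) \<in> satK"
    by (rule splitting_set[OF i])
  define H where "H a = (\<Prod>b\<in>A - {a}. mpol_var i - const b * ellK)" for a
  have Hp: "H a \<in> polys N" for a
    unfolding H_def using ellK i by (intro polys_prod polys_diff polys_mult) auto
  have "A \<noteq> {}"
  proof
    assume "A = {}"
    then have "F * 1 \<in> satK" using A(2) by (intro satK_mult[OF F(1)]) simp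
    then show False using F(2) by simp
  qed
  have "\<exists>a\<in>A. H a * F \<notin> satK"
  proof (rule ccontr)
    assume "\<not> (\<exists>a\<in>A. H a * F \<notin> satK)"
    then have HF: "H a * F \<in> satK" if "a \<in> A" for a using that by blast
    define c where "c a = inverse (\<Prod>b\<in>A - {a}. a - b)" for a
    have "ellK ^ (card A - 1) = homogenized const (mpol_var i) ellK (card A - 1) [:1:]"
      by (simp add: homogenized_const[OF ring_map_const])
    also have "[:1:] = (\<Sum>a\<in>A. smult (c a) (\<Prod>b\<in>A - {a}. [:- b, 1:]))"
      using lagrange_sum_eq_1[OF A(1) \<open>A \<noteq> {}\<close>] by (simp add: c_def one_pCons)
    also have "homogenized const (mpol_var i) ellK (card A - 1) \<dots> = (\<Sum>a\<in>A. const (c a) * H a)"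
      unfolding homogenized_sum[OF ring_map_const] homogenized_smult[OF ring_map_const]
    proof (intro sum.cong refl arg_cong2[of _ _ _ _ "(*)"])
      fix a assume "a \<in> A"
      then have "card A - 1 = card (A - {a})" using A(1) by simp
      then show "homogenized const (mpol_var i) ellK (card A - 1) (\<Prod>b\<in>A - {a}. [:- b, 1:]) = H a"
        using homogenized_prod_linear[OF ring_map_const, of "A - {a}" "mpol_var i" ellK] A(1)
        by (simp only: H_def finite_Diff)
    qed
    finally have "ellK ^ (card A - 1) * F = (\<Sum>a\<in>A. const (c a) * (H a * F))"
      by (simp add: sum_distrib_right mult.assoc)
    also have "\<dots> \<in> satK" by (intro satK_sum satK_mult HF) auto
    finally show False using satK_cancel F by blast
  qed
  then obtain a where a: "a \<in> A" "H a * F \<notin> satK" by blast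
  have "(mpol_var i - const a * ellK) * H a \<in> satK"
    using A(2) prod.remove[OF A(1) a(1), of "\<lambda>a. mpol_var i - const a * ellK"] by (simp add: H_def)
  then show ?thesis using that Hp a by blast
qed

text \<open>A projective zero of \<open>I\<close> off the hyperplane where \<open>ell\<close>
  vanishes, with the representative fixed by giving \<open>ell\<close> the value
  \<open>1\<close>.\<close>

definition zero_point :: "(nat \<Rightarrow> 'k alg_closure) \<Rightarrow> bool" where
  "zero_point q \<longleftrightarrow> subst to_ac q ell = 1 \<and>
     (\<forall>g\<in>I. \<forall>d. g \<in> forms d \<longrightarrow> subst to_ac q g = 0)"

lemma subst_lift: "value_at q (lift f) = subst to_ac q f"
proof -
  have "value_at q (lift f) = subst (\<lambda>c. value_at q (const (to_ac c))) (\<lambda>i. value_at q (mpol_var i)) f"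
    unfolding lift_def by (rule ring_map_comp_subst[OF ring_map_const_to_ac ring_map_subst[OF ring_map_id]])
  then show ?thesis by (simp add: subst_const[OF ring_map_id] subst_var[OF ring_map_id])
qed

text \<open>This takes the place of the Nullstellensatz. Since \<open>y\<close> is not in
  \<open>satK\<close>, the variables can be separated one after another by a multiplier
  \<open>E\<close> that keeps \<open>y\<close> outside; the constants found on the way are the
  coordinates of the zero.\<close>

lemma zero_point_exists:
  assumes y: "y \<in> linear_forms N" "y \<noteq> 0"
  obtains q where "zero_point q" "value_at q y \<noteq> 0"
proof -
  have yp: "y \<in> polys N" using y by (simp add: linear_forms_def)
  have y0: "y \<notin> satK" using ellK_power_cancel[OF y(1)] y(2) by (auto simp: satK_def)
  have "\<exists>E q. E \<in> polys N \<and> E * y \<notin> satK \<and> (\<forall>i<n. (mpol_var i - const (q i) * ellK) * E \<in> satK)"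
    if "n \<le> N" for n
    using that
  proof (induction n)
    case 0
    then show ?case using y0 by (intro exI[of _ 1]) auto
  next
    case (Suc n)
    then obtain E q where E: "E \<in> polys N" "E * y \<notin> satK"
      "\<forall>i<n. (mpol_var i - const (q i) * ellK) * E \<in> satK" by auto
    obtain a H where H: "H \<in> polys N" "H * (E * y) \<notin> satK" "(mpol_var n - const a * ellK) * H \<in> satK"
      by (rule separate_variable[of n "E * y"]) (use Suc E yp in auto)
    have "(mpol_var i - const ((q(n := a)) i) * ellK) * (H * E) \<in> satK" if "i < Suc n" for i
    proof (cases "i = n")
      case True
      have "E * ((mpol_var n - const a * ellK) * H) \<in> satK" by (rule satK_mult[OF E(1) H(3)])
      then show ?thesis using True by (simp add: mult_ac)
    next
      case False
      then have "H * ((mpol_var i - const (q i) * ellK) * E) \<in> satK"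
        using E H that by (intro satK_mult[OF H(1)]) auto
      then show ?thesis using False by (simp add: mult_ac)
    qed
    moreover have "H * E * y \<notin> satK" using H by (simp add: mult.assoc)
    ultimately show ?case using E H by (intro exI[of _ "H * E"] exI[of _ "q(n := a)"]) auto
  qed
  then obtain E q where E: "E \<in> polys N" "E * y \<notin> satK"
    "\<And>i. i < N \<Longrightarrow> (mpol_var i - const (q i) * ellK) * E \<in> satK" by (metis order_refl)
  \<comment> \<open>The colon ideal of \<open>satK\<close> by \<open>E\<close>. It contains all
    \<open>mpol_var i - const (q i) * ellK\<close>, so modulo it every form is a multiple of a power
    of \<open>ellK\<close>, and it contains no such power. Membership of a form thus decides whether
    its value at \<open>q\<close> is \<open>0\<close>.\<close>
  define J where "J = {F \<in> polys N. F * E \<in> satK}"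
  have J: "ideal J (mpol_ring N)"
    unfolding ideal_mpol_ring_iff J_def
    using satK_add satK_mult satK_zero
    by (auto simp: distrib_right mult.assoc)
  have cong: "F - const (value_at q F) * ellK ^ d \<in> J"
    if "F \<in> polys N" "F \<in> forms d" for F d
    by (rule form_congruent_value[OF J ellK(2) _ that]) (use E ellK in \<open>auto simp: J_def\<close>)
  have nJ: "ellK ^ d \<notin> J" for d
  proof
    assume "ellK ^ d \<in> J"
    then have "E \<in> satK" using satK_cancel E by (auto simp: J_def)
    then have "y * E \<in> satK" by (rule satK_mult[OF yp])
    then show False using E by (simp add: mult.commute)
  qed
  have nJ': "c = 0" if "const c * ellK ^ d \<in> J" for c d
  proof (rule ccontr)
    assume "c \<noteq> 0"
    have "const (inverse c) * (const c * ellK ^ d) \<in> J" using that by (rule ideal_mult[OF J polys_const])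
    also have "const (inverse c) * (const c * ellK ^ d) = ellK ^ d"
      using \<open>c \<noteq> 0\<close> by (simp add: mult.assoc[symmetric] mult_single)
    finally show False using nJ by blast
  qed
  have "zero_point q"
    unfolding zero_point_def
  proof (intro conjI ballI allI impI)
    have "ellK - const (value_at q ellK) * ellK ^ 1 \<in> J"
      using ellK by (intro cong) (auto simp: linear_forms_def)
    moreover have "ellK - const (value_at q ellK) * ellK ^ 1 = const (1 - subst to_ac q ell) * ellK ^ 1"
      by (simp add: ellK_def subst_lift single_diff algebra_simps)
    ultimately have "const (1 - subst to_ac q ell) * ellK ^ 1 \<in> J" by (simp only:)
    from nJ'[OF this] show "subst to_ac q ell = 1" by simp
  next
    fix g d assume g: "g \<in> I" "g \<in> forms d"
    have "E * lift g \<in> satK" using E by (intro satK_mult IK_subset_satK lift_IK g)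
    then have "lift g \<in> J" using g by (auto simp: J_def lift_polys I_polys mult.commute)
    moreover have "lift g - const (subst to_ac q g) * ellK ^ d \<in> J"
      using cong[of "lift g" d] g by (simp add: lift_polys I_polys lift_weight_eq subst_lift)
    ultimately have "const (subst to_ac q g) * ellK ^ d \<in> J"
      using ideal_diff[OF J, of "lift g" "lift g - const (subst to_ac q g) * ellK ^ d"] by simp
    then show "subst to_ac q g = 0" by (rule nJ')
  qed
  moreover have "value_at q y \<noteq> 0"
  proof
    assume "value_at q y = 0"
    then have "y \<in> J" using cong[of y 1] y by (simp add: linear_forms_def)
    then show False using E by (simp add: J_def mult.commute)
  qed
  ultimately show ?thesis using that by blast
qed

end

section \<open>Coordinates dual to the zeros\<close>

lemma independent_variables: "mpol.independent (mpol_var ` {..<N} :: 'a::field mpol set)"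
  and inj_mpol_var: "inj (mpol_var :: nat \<Rightarrow> 'a::field mpol)"
proof -
  have s: "var_exp i = var_exp j \<longleftrightarrow> i = j" for i j :: nat
    by (metis keys_single singleton_inject zero_neq_one)
  have lv: "lookup (mpol_var i :: 'a mpol) (var_exp j) = (if i = j then 1 else 0)" for i j
    by (simp add: mpol_var_def lookup_single when_def s del: One_nat_def)
  show inj: "inj (mpol_var :: nat \<Rightarrow> 'a mpol)"
    by (rule injI) (metis lv zero_neq_one)
  have io: "inj_on (mpol_var :: nat \<Rightarrow> 'a mpol) {..<N}" using inj by (auto simp: inj_on_def)
  show "mpol.independent (mpol_var ` {..<N} :: 'a mpol set)"
  proof (rule mpol.independent_if_scalars_zero)
    fix u :: "'a mpol \<Rightarrow> 'a" and x :: "'a mpol"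
    assume u: "(\<Sum>x\<in>mpol_var ` {..<N}. const (u x) * x) = 0" and x: "x \<in> mpol_var ` {..<N}"
    from x obtain i where i: "i < N" "x = mpol_var i" by auto
    have "0 = lookup (\<Sum>j<N. const (u (mpol_var j)) * mpol_var j) (var_exp i)"
    proof -
      have "(\<Sum>x\<in>mpol_var ` {..<N}. const (u x) * x) = (\<Sum>j<N. const (u (mpol_var j)) * mpol_var j)"
        using sum.reindex[OF io, of "\<lambda>x. const (u x) * x"] by (simp add: comp_def)
      then show ?thesis by (simp only: u lookup_zero)
    qed
    also have "\<dots> = (\<Sum>j<N. if j = i then u (mpol_var i) else 0)"
      unfolding lookup_sum by (intro sum.cong refl) (auto simp: const_mult_lookup lv simp del: One_nat_def)
    also have "\<dots> = u x" using i by simp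
    finally show "u x = 0" by simp
  qed simp
qed

context
  fixes q :: "nat \<Rightarrow> 'a::field"
begin

lemma value_const_mult: "value_at q (const c * f) = c * value_at q f"
  by (simp add: subst_mult[OF ring_map_id] subst_const[OF ring_map_id])

lemma value_diff: "value_at q (f - g) = value_at q f - value_at q g"
  using subst_add[OF ring_map_id, of q "f - g" g] by simp

lemma value_sum: "value_at q (\<Sum>i\<in>A. f i) = (\<Sum>i\<in>A. value_at q (f i))"
  by (rule ring_map_sum[OF ring_map_subst[OF ring_map_id]])

lemma value_var: "value_at q (mpol_var i) = q i"
  by (rule subst_var[OF ring_map_id])

lemma value_0: "value_at q 0 = 0"
  by (rule subst_0[OF ring_map_id])

lemmas value_simps = value_const_mult value_diff value_sum value_var value_0

end

context radical_quadrics
begin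

definition dual_system :: "nat \<Rightarrow> (nat \<Rightarrow> nat \<Rightarrow> 'k alg_closure) \<Rightarrow> (nat \<Rightarrow> 'k alg_closure mpol) \<Rightarrow> bool" where
  "dual_system n p y \<longleftrightarrow> (\<forall>i<n. zero_point (p i) \<and> y i \<in> linear_forms N) \<and>
     (\<forall>i<n. \<forall>j<n. value_at (p j) (y i) = (if i = j then 1 else 0))"

lemma dual_system_independent:
  assumes d: "dual_system n p y"
  shows "inj_on y {..<n}" "mpol.independent (y ` {..<n})" "n \<le> N"
proof -
  show inj: "inj_on y {..<n}"
  proof (rule inj_onI)
    fix i j assume *: "i \<in> {..<n}" "j \<in> {..<n}" "y i = y j"
    have "value_at (p j) (y j) = 1" using d *(2) by (simp add: dual_system_def)
    moreover have "value_at (p j) (y i) = (if i = j then 1 else 0)"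
      using d *(1,2) by (simp add: dual_system_def)
    ultimately show "i = j" using *(3) by (simp split: if_splits)
  qed
  show ind: "mpol.independent (y ` {..<n})"
  proof (rule mpol.independent_if_scalars_zero)
    fix u x assume u: "(\<Sum>x\<in>y ` {..<n}. const (u x) * x) = 0" and x: "x \<in> y ` {..<n}"
    from x obtain i where i: "i < n" "x = y i" by auto
    have "0 = value_at (p i) (\<Sum>j<n. const (u (y j)) * y j)"
      using u inj by (simp add: sum.reindex value_0)
    also have "\<dots> = (\<Sum>j<n. if j = i then u (y i) else 0)"
      unfolding value_sum value_const_mult by (intro sum.cong refl) (use d i in \<open>auto simp: dual_system_def\<close>)
    also have "\<dots> = u x" using i by simp
    finally show "u x = 0" by simp
  qed simp
  have "card (y ` {..<n}) \<le> N"
    using linear_forms_independent_card(2)[OF ind] d by (auto simp: dual_system_def)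
  then show "n \<le> N" using card_image[OF inj] by simp
qed

text \<open>A Gram-Schmidt step: \<open>Y\<close> vanishes at the old points, so subtracting
  multiples of it makes the old forms vanish at a new zero without changing their values at the old
  ones.\<close>

lemma dual_system_extend:
  assumes d: "dual_system n p y" and Y: "Y \<in> linear_forms N" "Y \<noteq> 0"
    and van: "\<And>j. j < n \<Longrightarrow> value_at (p j) Y = 0"
  shows "\<exists>p' y'. dual_system (Suc n) p' y'"
proof -
  obtain q where q: "zero_point q" "value_at q Y \<noteq> 0" by (rule zero_point_exists[OF Y])
  define Z where "Z = const (inverse (value_at q Y)) * Y"
  define p' where "p' = p(n := q)"
  define y' where "y' i = (if i = n then Z else y i - const (value_at q (y i)) * Z)" for i
  have Z: "Z \<in> linear_forms N" unfolding Z_def by (intro linear_forms_scale Y)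
  have Zq: "value_at q Z = 1" using q by (simp add: Z_def value_simps)
  have Zp: "value_at (p j) Z = 0" if "j < n" for j using van[OF that] by (simp add: Z_def value_simps)
  have "zero_point (p' i) \<and> y' i \<in> linear_forms N" if "i < Suc n" for i
    using that d q Z by (auto simp: p'_def y'_def dual_system_def linear_forms_diff linear_forms_scale)
  moreover have "value_at (p' j) (y' i) = (if i = j then 1 else 0)" if ij: "i < Suc n" "j < Suc n" for i j
  proof -
    consider "i = n" "j = n" | "i = n" "j < n" | "i < n" "j = n" | "i < n" "j < n" using ij by linarith
    then show ?thesis
    proof cases
      case 4
      then have "value_at (p j) (y i) = (if i = j then 1 else 0)" using d by (simp add: dual_system_def)
      then show ?thesis using 4 Zp by (simp add: p'_def y'_def value_simps)
    qed (simp_all add: p'_def y'_def value_simps Zq Zp)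
  qed
  ultimately show ?thesis unfolding dual_system_def by blast
qed

text \<open>Take a dual system of maximal size. The difference between a variable and its
  interpolation vanishes at all its points, so a nonzero difference would permit an extension. Hence
  \<open>n\<close> forms span the \<open>N\<close> variables, and \<open>n = N\<close>.\<close>

lemma dual_basis_exists:
  obtains p y where "dual_system N p y" "\<forall>r<N. mpol_var r = (\<Sum>j<N. const (p j r) * y j)"
proof -
  have "dual_system 0 p y" for p y by (simp add: dual_system_def)
  then have "\<exists>n. (\<exists>p y. dual_system n p y) \<and> (\<forall>n'. (\<exists>p y. dual_system n' p y) \<longrightarrow> n' \<le> n)"
  proof (intro Nat.ex_has_greatest_nat[of _ 0 N])
    show "\<exists>p y. dual_system 0 p y" using \<open>\<And>p y. dual_system 0 p y\<close> by blast
    show "\<forall>n. (\<exists>p y. dual_system n p y) \<longrightarrow> n \<le> N" using dual_system_independent(3) by blast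
  qed
  then obtain n p y where d: "dual_system n p y" and max: "\<And>n' p y. dual_system n' p y \<Longrightarrow> n' \<le> n" by blast
  have eq: "mpol_var r = (\<Sum>j<n. const (p j r) * y j)" if r: "r < N" for r
  proof (rule ccontr)
    assume ne: "mpol_var r \<noteq> (\<Sum>j<n. const (p j r) * y j)"
    have "\<exists>p' y'. dual_system (Suc n) p' y'"
    proof (rule dual_system_extend[OF d])
      show "mpol_var r - (\<Sum>j<n. const (p j r) * y j) \<in> linear_forms N"
        by (intro linear_forms_diff linear_forms_sum linear_forms_scale linear_forms_var r)
          (use d in \<open>auto simp: dual_system_def\<close>)
      show "mpol_var r - (\<Sum>j<n. const (p j r) * y j) \<noteq> 0" using ne by simp
      fix i assume i: "i < n"
      have "(\<Sum>j<n. p j r * value_at (p i) (y j)) = (\<Sum>j<n. if j = i then p i r else 0)"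
        by (intro sum.cong refl) (use d i in \<open>auto simp: dual_system_def\<close>)
      then show "value_at (p i) (mpol_var r - (\<Sum>j<n. const (p j r) * y j)) = 0"
        using i by (simp add: value_simps)
    qed
    then show False using max[of "Suc n"] by force
  qed
  have "mpol_var ` {..<N} \<subseteq> mpol.span (y ` {..<n})"
  proof
    fix v :: "'k alg_closure mpol" assume "v \<in> mpol_var ` {..<N}"
    then obtain r where "r < N" "v = mpol_var r" by auto
    then have "v = (\<Sum>j<n. const (p j r) * y j)" using eq by simp
    also have "\<dots> \<in> mpol.span (y ` {..<n})" by (intro mpol.span_sum mpol.span_scale mpol.span_base) auto
    finally show "v \<in> mpol.span (y ` {..<n})" .
  qed
  then have "card (mpol_var ` {..<N} :: 'k alg_closure mpol set) \<le> card (y ` {..<n})"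
    using mpol.independent_span_bound[OF _ independent_variables] by blast
  also have "\<dots> \<le> n" using card_image_le[of "{..<n}" y] by simp
  finally have "N \<le> n" by (simp add: card_image[OF inj_on_subset[OF inj_mpol_var subset_UNIV]])
  then have "n = N" using dual_system_independent(3)[OF d] by simp
  then show ?thesis using that d eq by blast
qed

end

section \<open>The linear change of coordinates and the way back\<close>

lemma ring_map_homogenized:
  assumes "ring_map H"
  shows "H (homogenized h x l n f) = homogenized (\<lambda>c. H (h c)) (H x) (H l) n f"
  by (simp add: homogenized_def ring_map_sum[OF assms] ring_map_simps[OF assms] ring_map_power[OF assms])

locale split_quadrics = radical_quadrics I G N for I G :: "'k::field mpol set" and N +
  fixes p :: "nat \<Rightarrow> nat \<Rightarrow> 'k alg_closure" and y :: "nat \<Rightarrow> 'k alg_closure mpol"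
  assumes dual: "dual_system N p y"
    and var_eq: "\<And>r. r < N \<Longrightarrow> mpol_var r = (\<Sum>j<N. const (p j r) * y j)"
begin

lemma zero_p: "i < N \<Longrightarrow> zero_point (p i)" and y_linear: "i < N \<Longrightarrow> y i \<in> linear_forms N"
  and dual_value: "i < N \<Longrightarrow> j < N \<Longrightarrow> value_at (p j) (y i) = (if i = j then 1 else 0)"
  using dual by (auto simp: dual_system_def)

text \<open>The \<open>r\<close>-th coordinate of a general combination of the points
  \<open>p j\<close>, with the new variables as coefficients. Substituting it for the
  \<open>r\<close>-th variable turns the points into unit vectors.\<close>

definition coord :: "nat \<Rightarrow> 'k alg_closure mpol" where
  "coord r = (\<Sum>j<N. const (p j r) * mpol_var j)"

definition Theta :: "'k mpol \<Rightarrow> 'k alg_closure mpol" where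
  "Theta = subst (\<lambda>c. const (to_ac c)) coord"

definition ThetaK :: "'k alg_closure mpol \<Rightarrow> 'k alg_closure mpol" where
  "ThetaK = subst const coord"

definition InvK :: "'k alg_closure mpol \<Rightarrow> 'k alg_closure mpol" where
  "InvK = subst const y"

lemma ring_map_Theta: "ring_map Theta" and ring_map_ThetaK: "ring_map ThetaK" and ring_map_InvK: "ring_map InvK"
  unfolding Theta_def ThetaK_def InvK_def
  by (rule ring_map_subst[OF ring_map_const_to_ac] ring_map_subst[OF ring_map_const])+

lemmas Theta_simps = ring_map_simps[OF ring_map_Theta] and ThetaK_simps = ring_map_simps[OF ring_map_ThetaK]
  and InvK_simps = ring_map_simps[OF ring_map_InvK]

lemma coord_linear: "coord r \<in> linear_forms N"
  unfolding coord_def by (intro linear_forms_sum linear_forms_scale linear_forms_var) auto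

lemma coord_polys: "coord r \<in> polys N" using coord_linear by (simp add: linear_forms_def)

lemma y_polys: "i < N \<Longrightarrow> y i \<in> polys N" using y_linear by (simp add: linear_forms_def)

lemma InvK_const [simp]: "InvK (const c) = const c" by (simp add: InvK_def subst_const[OF ring_map_const])
lemma ThetaK_const [simp]: "ThetaK (const c) = const c" by (simp add: ThetaK_def subst_const[OF ring_map_const])
lemma InvK_var [simp]: "InvK (mpol_var i) = y i" by (simp add: InvK_def subst_var[OF ring_map_const])
lemma ThetaK_var [simp]: "ThetaK (mpol_var i) = coord i" by (simp add: ThetaK_def subst_var[OF ring_map_const])

lemma ThetaK_lift: "ThetaK (lift f) = Theta f"
  unfolding lift_def Theta_def
  by (subst ring_map_comp_subst[OF ring_map_const_to_ac ring_map_ThetaK]) simp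

lemma ThetaK_linear:
  assumes "f \<in> linear_forms N"
  shows "ThetaK f = (\<Sum>j<N. const (value_at (p j) f) * mpol_var j)"
proof -
  define a where "a r = lookup f (var_exp r)" for r
  have f: "f = (\<Sum>r<N. const (a r) * mpol_var r)" unfolding a_def by (rule linear_form_eq_sum[OF assms])
  have "ThetaK f = (\<Sum>r<N. const (a r) * coord r)"
    by (subst f) (simp add: ring_map_sum[OF ring_map_ThetaK] ThetaK_simps)
  also have "\<dots> = (\<Sum>r<N. \<Sum>j<N. const (a r * p j r) * mpol_var j)"
    by (simp add: coord_def sum_distrib_left mult_single mult.assoc[symmetric])
  also have "\<dots> = (\<Sum>j<N. \<Sum>r<N. const (a r * p j r) * mpol_var j)" by (rule sum.swap)
  also have "\<dots> = (\<Sum>j<N. const (\<Sum>r<N. a r * p j r) * mpol_var j)"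
    by (simp add: sum_distrib_right ring_map_sum[OF ring_map_const])
  also have "\<dots> = (\<Sum>j<N. const (value_at (p j) f) * mpol_var j)"
  proof -
    have "value_at (p j) f = (\<Sum>r<N. a r * p j r)" for j by (subst f) (simp add: value_simps)
    then show ?thesis by simp
  qed
  finally show ?thesis .
qed

lemma ThetaK_y: "i < N \<Longrightarrow> ThetaK (y i) = mpol_var i"
proof -
  assume i: "i < N"
  have "ThetaK (y i) = (\<Sum>j<N. if j = i then mpol_var i else 0)"
    unfolding ThetaK_linear[OF y_linear[OF i]] by (intro sum.cong refl) (use dual_value i in auto)
  then show ?thesis using i by simp
qed

lemma InvK_coord: "r < N \<Longrightarrow> InvK (coord r) = mpol_var r"
  by (subst var_eq) (simp_all add: coord_def ring_map_sum[OF ring_map_InvK] InvK_simps)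

lemma InvK_ThetaK: "F \<in> polys N \<Longrightarrow> InvK (ThetaK F) = F"
proof -
  assume F: "F \<in> polys N"
  have "InvK (ThetaK F) = subst const (\<lambda>i. InvK (coord i)) F"
    unfolding ThetaK_def by (subst ring_map_comp_subst[OF ring_map_const ring_map_InvK]) simp
  also have "\<dots> = subst const mpol_var F"
    by (rule subst_cong_polys[OF ring_map_const F]) (rule InvK_coord)
  finally show ?thesis by (simp add: subst_id)
qed

lemma ThetaK_InvK: "F \<in> polys N \<Longrightarrow> ThetaK (InvK F) = F"
proof -
  assume F: "F \<in> polys N"
  have "ThetaK (InvK F) = subst const (\<lambda>i. ThetaK (y i)) F"
    unfolding InvK_def by (subst ring_map_comp_subst[OF ring_map_const ring_map_ThetaK]) simp
  also have "\<dots> = subst const mpol_var F"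
    by (rule subst_cong_polys[OF ring_map_const F]) (rule ThetaK_y)
  finally show ?thesis by (simp add: subst_id)
qed

lemma InvK_Theta: "f \<in> polys N \<Longrightarrow> InvK (Theta f) = lift f"
  by (simp add: ThetaK_lift[symmetric] InvK_ThetaK lift_polys)

lemma Theta_polys: "f \<in> polys N \<Longrightarrow> Theta f \<in> polys N"
  unfolding Theta_def by (rule subst_polys) (auto intro: coord_polys)

lemma InvK_polys: "F \<in> polys N \<Longrightarrow> InvK F \<in> polys N"
  unfolding InvK_def by (rule subst_polys) (auto intro: y_polys)

lemma weight_const_degree: "const c \<in> forms 0"
  by (rule weight_eq_const[OF additive_weight_degree])

lemma coord_weight: "coord i \<in> forms 1"
  using coord_linear[of i] by (simp add: linear_forms_def)

lemma y_weight: "i < N \<Longrightarrow> y i \<in> forms 1"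
  using y_linear[of i] by (simp add: linear_forms_def)

lemma Theta_weight_ge: "f \<in> polys N \<Longrightarrow> f \<in> order_ge d \<Longrightarrow> Theta f \<in> order_ge d"
  unfolding Theta_def
  by (rule weight_ge_subst[OF additive_weight_degree _ _ weight_const_degree coord_weight ring_map_const_to_ac])

lemma Theta_weight_eq: "f \<in> polys N \<Longrightarrow> f \<in> forms d \<Longrightarrow> Theta f \<in> forms d"
  unfolding Theta_def
  by (rule weight_eq_subst[OF additive_weight_degree _ _ weight_const_degree coord_weight])

lemma InvK_weight_eq: "F \<in> polys N \<Longrightarrow> F \<in> forms d \<Longrightarrow> InvK F \<in> forms d"
  unfolding InvK_def
  by (rule weight_eq_subst[OF additive_weight_degree _ _ weight_const_degree y_weight])

lemma Theta_weight_ge_iff: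
  assumes f: "f \<in> polys N"
  shows "Theta f \<in> order_ge d \<longleftrightarrow> f \<in> order_ge d"
proof
  assume "Theta f \<in> order_ge d"
  then have "InvK (Theta f) \<in> order_ge d"
    unfolding InvK_def
    by (rule weight_ge_subst[OF additive_weight_degree Theta_polys[OF f] _ weight_const_degree y_weight ring_map_const])
  then show "f \<in> order_ge d" by (simp add: InvK_Theta[OF f] weight_ge_def keys_lift)
qed (rule Theta_weight_ge[OF f])

lemma Theta_part: "f \<in> polys N \<Longrightarrow> Theta (form_part d f) = form_part d (Theta f)"
  unfolding Theta_def
  by (rule part_subst[OF _ weight_const_degree coord_weight ring_map_const_to_ac])

text \<open>The way back from the model to the base field: on polynomials in the \<open>N\<close>
  variables it undoes \<open>Theta\<close>, and it is linear over the polynomials of the base field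
  though in general no ring map.\<close>

definition Psi :: "'k alg_closure mpol \<Rightarrow> 'k mpol" where
  "Psi F = poly_retract (InvK F)"

lemma Psi_mult_Theta: "s \<in> polys N \<Longrightarrow> Psi (F * Theta s) = Psi F * s"
  by (simp add: Psi_def InvK_simps InvK_Theta mult.commute[of _ "lift s"]
      poly_retract_lift_mult mult.commute)

lemma Psi_sum: "Psi (\<Sum>i\<in>A. F i) = (\<Sum>i\<in>A. Psi (F i))"
  by (simp add: Psi_def ring_map_sum[OF ring_map_InvK] poly_retract_sum)

lemma Psi_Theta: "s \<in> polys N \<Longrightarrow> Psi (Theta s) = s"
  by (simp add: Psi_def InvK_Theta)

lemma Psi_polys: "F \<in> polys N \<Longrightarrow> Psi F \<in> polys N"
  by (simp add: Psi_def poly_retract_polys InvK_polys)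

section \<open>The monomial model\<close>

lemma off_weight_pure: "off_weight i e = 0 \<longleftrightarrow> e = Poly_Mapping.single i (exponent_degree e)"
proof
  assume "off_weight i e = 0"
  then have l: "lookup e i = exponent_degree e"
    using lookup_le_exponent_degree[of e i] by (simp add: off_weight_def)
  have "exponent_degree e = (\<Sum>j\<in>insert i (keys e). lookup e j)" by (rule exponent_degree_sum) auto
  also have "\<dots> = lookup e i + (\<Sum>j\<in>keys e - {i}. lookup e j)" by (simp add: sum.insert_remove)
  finally have "\<forall>j\<in>keys e - {i}. lookup e j = 0" using l by simp
  then have "\<And>j. j \<noteq> i \<Longrightarrow> lookup e j = 0" by (auto simp: in_keys_iff)
  then show "e = Poly_Mapping.single i (exponent_degree e)"
    by (intro poly_mapping_eqI) (auto simp: lookup_single when_def l)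
next
  assume e: "e = Poly_Mapping.single i (exponent_degree e)"
  have "lookup e i = exponent_degree e" by (subst e) simp
  then show "off_weight i e = 0" by (simp add: off_weight_def)
qed

lemma unit_value:
  fixes F :: "'a::field mpol"
  assumes "F \<in> forms d"
  shows "value_at (\<lambda>j. if j = i then 1 else 0) F = lookup F (Poly_Mapping.single i d)"
proof -
  let ?u = "\<lambda>j. if j = i then 1 else (0::'a)"
  have mv: "monomial_value ?u e = (if keys e \<subseteq> {i} then 1 else 0)" for e
    by (auto simp: monomial_value_def in_keys_iff intro!: prod.neutral prod_zero)
  have "value_at ?u F = (\<Sum>e\<in>keys F. if e = Poly_Mapping.single i d then lookup F e else 0)"
    unfolding subst_def
  proof (intro sum.cong refl)
    fix e assume e: "e \<in> keys F"
    have d: "exponent_degree e = d" using e assms by (simp add: weight_eq_def)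
    have "keys e \<subseteq> {i} \<longleftrightarrow> e = Poly_Mapping.single i d"
    proof
      assume "keys e \<subseteq> {i}"
      then have "exponent_degree e = lookup e i" by (simp add: exponent_degree_sum[of "{i}"])
      then show "e = Poly_Mapping.single i d" using off_weight_pure[of i e] d by (simp add: off_weight_def)
    qed simp
    then show "lookup F e * monomial_value ?u e = (if e = Poly_Mapping.single i d then lookup F e else 0)"
      by (simp add: mv)
  qed
  also have "\<dots> = lookup F (Poly_Mapping.single i d)" by (simp add: sum.delta in_keys_iff)
  finally show ?thesis .
qed

lemma Theta_unit_value:
  assumes i: "i < N" and f: "f \<in> polys N"
  shows "value_at (\<lambda>j. if j = i then 1 else 0) (Theta f) = subst to_ac (p i) f"
proof -
  let ?u = "\<lambda>j. if j = i then 1 else (0::'k alg_closure)"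
  have "value_at ?u (Theta f) = subst to_ac (\<lambda>r. value_at ?u (coord r)) f"
    unfolding Theta_def
    by (subst ring_map_comp_subst[OF ring_map_const_to_ac ring_map_subst[OF ring_map_id]])
      (simp add: subst_const[OF ring_map_id])
  also have "\<dots> = subst to_ac (p i) f"
  proof (rule subst_cong_polys[OF ring_map_to_ac f])
    fix r
    have "(\<Sum>j<N. p j r * (if j = i then 1 else 0)) = (\<Sum>j<N. if j = i then p i r else 0)"
      by (intro sum.cong refl) auto
    then show "value_at ?u (coord r) = p i r" using i by (simp add: coord_def value_simps)
  qed
  finally show ?thesis .
qed

text \<open>The \<open>i\<close>-th point has become the \<open>i\<close>-th unit vector, where a
  form of degree \<open>d\<close> takes its coefficient at the pure power \<open>X_i ^ d\<close> as
  value. Pure powers of \<open>X_i\<close> are exactly the monomials of \<open>off_weight i\<close>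
  zero.\<close>

lemma Theta_off_weight_ge_1_iff:
  assumes i: "i < N" and f: "f \<in> polys N"
  shows "Theta f \<in> weight_ge (off_weight i) 1 \<longleftrightarrow> (\<forall>d. subst to_ac (p i) (form_part d f) = 0)"
proof -
  have val: "subst to_ac (p i) (form_part d f) = lookup (Theta f) (Poly_Mapping.single i d)" for d
  proof -
    have "subst to_ac (p i) (form_part d f) =
        value_at (\<lambda>j. if j = i then 1 else 0) (Theta (form_part d f))"
      by (rule Theta_unit_value[OF i part_polys[OF f], symmetric])
    also have "\<dots> = lookup (form_part d (Theta f)) (Poly_Mapping.single i d)"
      unfolding Theta_part[OF f] by (rule unit_value[OF part_in_weight_eq])
    finally show ?thesis by (simp add: lookup_part)
  qed
  have "Theta f \<in> weight_ge (off_weight i) 1 \<longleftrightarrow> (\<forall>e\<in>keys (Theta f). off_weight i e \<noteq> 0)"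
    by (auto simp: weight_ge_def)
  also have "\<dots> \<longleftrightarrow> (\<forall>d. lookup (Theta f) (Poly_Mapping.single i d) = 0)"
    unfolding off_weight_pure by (metis exponent_degree_single in_keys_iff)
  finally show ?thesis by (simp add: val)
qed

lemma I_off_weight:
  assumes "i < N" "f \<in> I"
  shows "Theta f \<in> weight_ge (off_weight i) 1"
  unfolding Theta_off_weight_ge_1_iff[OF assms(1) I_polys[OF assms(2)]]
  using zero_p[OF assms(1)] I_part[OF assms(2)] part_in_weight_eq unfolding zero_point_def by blast

lemma Theta_mult: "Theta (f * g) = Theta f * Theta g" by (rule Theta_simps)
lemma Theta_add: "Theta (f + g) = Theta f + Theta g" by (rule Theta_simps)

lemma ideal_power_off_weight:
  assumes i: "i < N"
  shows "ideal_power (mpol_ring N) I m \<subseteq> {f. Theta f \<in> weight_ge (off_weight i) m}"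
proof (rule ideal_power_subset[where U = "\<lambda>m. {f. Theta f \<in> weight_ge (off_weight i) m}"], goal_cases)
  case (2 n f g)
  have "Theta f * Theta g \<in> weight_ge (off_weight i) (n + 1)"
    by (rule weight_ge_mult[OF additive_weight_off _ I_off_weight[OF i 2(2)]]) (use 2(1) in simp)
  then show ?case by (simp add: Theta_mult)
qed (auto simp: Theta_add intro: weight_ge_add)

lemma ideal_power_degree: "ideal_power (mpol_ring N) I m \<subseteq> order_ge (2 * m)"
proof (rule ideal_power_subset[where U = "\<lambda>m. order_ge (2 * m)"], goal_cases)
  case (2 n f g)
  then show ?case
    using order_ge_mult[of f "2 * n" g 2] I_weight_ge by auto
qed (auto intro: weight_ge_add)

text \<open>Independence survives extension of scalars. A relation is multiplied by an arbitrary
  \<open>c\<close> and retracted, so every \<open>c * u x\<close> retracts to \<open>0\<close>; for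
  \<open>u x \<noteq> 0\<close> the choice \<open>c = inverse (u x)\<close> would give
  \<open>1\<close>.\<close>

lemma inj_Theta_G: "inj_on Theta G" and independent_Theta_G: "mpol.independent (Theta ` G)"
proof -
  show inj: "inj_on Theta G"
    by (rule inj_onI) (metis Psi_Theta G_polys subsetD)
  show "mpol.independent (Theta ` G)"
  proof (rule mpol.independent_if_scalars_zero)
    show "finite (Theta ` G)" using finite_G by simp
    fix u x assume u: "(\<Sum>x\<in>Theta ` G. const (u x) * x) = 0" and x: "x \<in> Theta ` G"
    from x obtain g0 where g0: "g0 \<in> G" "x = Theta g0" by auto
    have u0: "(\<Sum>g\<in>G. const (u (Theta g)) * Theta g) = 0" using u by (simp add: sum.reindex[OF inj])
    have z: "to_ac_retract (c * u (Theta g0)) = 0" for c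
    proof -
      have "0 = Psi (const c * (\<Sum>g\<in>G. const (u (Theta g)) * Theta g))"
        unfolding u0 by (simp add: Psi_def InvK_simps)
      also have "\<dots> = (\<Sum>g\<in>G. Psi (const (c * u (Theta g)) * Theta g))"
        by (simp add: sum_distrib_left Psi_sum mult.assoc[symmetric] mult_single)
      also have "\<dots> = (\<Sum>g\<in>G. const (to_ac_retract (c * u (Theta g))) * g)"
      proof (intro sum.cong refl)
        fix g assume "g \<in> G"
        then show "Psi (const (c * u (Theta g)) * Theta g) = const (to_ac_retract (c * u (Theta g))) * g"
          using G_polys by (subst Psi_mult_Theta) (auto simp: Psi_def poly_retract_term)
      qed
      finally have "(\<Sum>g\<in>G. const (to_ac_retract (c * u (Theta g))) * g) = 0" by simp
      then show ?thesis
        by (rule independent_G[unfolded mpol.independent_explicit_finite_subsets, rule_format,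
              OF subset_refl finite_G _ g0(1)])
    qed
    show "u x = 0"
    proof (rule ccontr)
      assume "u x \<noteq> 0"
      then show False using z[of "inverse (u x)"] g0 by (simp add: to_ac_retract(3))
    qed
  qed
qed

text \<open>The transformed generators vanish at the unit vectors and so contain no squares of
  variables. They are \<open>N choose 2\<close> independent elements in the span of equally many
  squarefree monomials, hence span them all.\<close>

lemma variable_pair_in_span:
  assumes ab: "a < N" "b < N" "a \<noteq> b"
  shows "mpol_var a * mpol_var b \<in> mpol.span (Theta ` G)"
proof -
  define T :: "'k alg_closure mpol set" where
    "T = (\<lambda>(i, j). mpol_var i * mpol_var j) ` {(i, j). i < j \<and> j < N}"
  have eq: "{(i, j). i < j \<and> j < N} = prod.swap ` (SIGMA j:{..<N}. {..<j})" by force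
  have fin: "finite {(i, j). i < j \<and> j < N}" unfolding eq by auto
  have "card {(i, j). i < j \<and> j < N} = card (SIGMA j:{..<N}. {..<j})"
    unfolding eq by (rule card_image) (auto intro: inj_onI)
  also have "\<dots> = (\<Sum>j<N. j)" by simp
  also have "\<dots> = N choose 2" by (induction N) (auto simp: numeral_2_eq_2)
  finally have "card {(i, j). i < j \<and> j < N} = N choose 2" .
  moreover have "card T \<le> card {(i, j). i < j \<and> j < N}" unfolding T_def by (rule card_image_le[OF fin])
  ultimately have cT: "card T \<le> N choose 2" by simp
  have "Theta g \<in> mpol.span T" if g: "g \<in> G" for g
  proof -
    have gp: "g \<in> polys N" using g G_polys by auto
    have w: "Theta g \<in> forms 2" by (rule Theta_weight_eq[OF gp quadrics_G[OF g]])
    show ?thesis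
      unfolding T_def
    proof (rule quadratic_form_span[OF Theta_polys[OF gp] w])
      fix i j assume ij: "i \<le> j" "j < N" "var_exp j + var_exp i \<in> keys (Theta g)"
      then have "off_weight i (var_exp j + var_exp i) \<ge> 1"
        using I_off_weight[of i g] g G_subset_I by (auto simp: weight_ge_def)
      then have "i \<noteq> j" by (auto simp: off_weight_def exponent_degree_add lookup_add)
      then show "(i, j) \<in> {(i, j). i < j \<and> j < N}" using ij by simp
    qed
  qed
  then have "mpol.span T \<subseteq> mpol.span (Theta ` G)"
    using cT card_image[OF inj_Theta_G] card_G fin
    by (intro independent_card_eq_span independent_Theta_G) (auto simp: T_def)
  moreover have "mpol_var a * mpol_var b \<in> T"
    unfolding T_def using ab
    by (intro image_eqI[of _ _ "(min a b, max a b)"]) (auto simp: min_def max_def mult.commute)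
  ultimately show ?thesis using mpol.span_base by blast
qed

end

section \<open>Exponent vectors\<close>

lemma exponent_degree_lessThan: "keys e \<subseteq> {..<N} \<Longrightarrow> exponent_degree e = (\<Sum>i<N. lookup e i)"
  by (rule exponent_degree_sum) auto

text \<open>Take \<open>a\<close> and \<open>b\<close> with the two largest entries. Lowering them
  reduces the weights off \<open>a\<close> and off \<open>b\<close> by one only. For any other
  \<open>i\<close> the weight drops by two, but there
  \<open>3 * lookup e i \<le> exponent_degree e\<close>, and with the degree bound at least
  \<open>m\<close> is left. In this way a generator \<open>X_a X_b\<close> splits off a
  monomial.\<close>

lemma exponent_split_pair:
  assumes k: "keys e \<subseteq> {..<N}" and d: "2 * Suc m \<le> exponent_degree e"
    and w: "\<And>i. i < N \<Longrightarrow> Suc m \<le> off_weight i e"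
  obtains e' a b where "a < N" "b < N" "a \<noteq> b" "keys e' \<subseteq> {..<N}"
    "e = e' + var_exp a + var_exp b"
    "2 * m \<le> exponent_degree e'" "\<forall>i<N. m \<le> off_weight i e'"
proof -
  have E: "exponent_degree e = (\<Sum>i<N. lookup e i)" by (rule exponent_degree_lessThan[OF k])
  have ne: "{..<N} \<noteq> {}" using E d by auto
  obtain a where a: "a < N" "\<And>i. i < N \<Longrightarrow> lookup e i \<le> lookup e a"
    using obtains_MAX[of "{..<N}" "lookup e"] ne by (metis Max_ge finite_imageI finite_lessThan imageI lessThan_iff)
  have rest: "off_weight a e = (\<Sum>i\<in>{..<N} - {a}. lookup e i)"
    unfolding off_weight_def E using a(1) by (subst sum.remove[of _ a]) auto
  have ne': "{..<N} - {a} \<noteq> {}"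
  proof
    assume "{..<N} - {a} = {}"
    then have "off_weight a e = 0" using rest by (simp only: sum.empty)
    then show False using w[OF a(1)] by simp
  qed
  obtain b where b: "b < N" "b \<noteq> a" "\<And>i. i < N \<Longrightarrow> i \<noteq> a \<Longrightarrow> lookup e i \<le> lookup e b"
    using obtains_MAX[of "{..<N} - {a}" "lookup e"] ne'
    by (metis (no_types, lifting) DiffE DiffI Max_ge finite_Diff finite_imageI finite_lessThan imageI lessThan_iff singletonI singletonD)
  have bpos: "lookup e b \<ge> 1"
  proof (rule ccontr)
    assume "\<not> lookup e b \<ge> 1"
    then have "(\<Sum>i\<in>{..<N} - {a}. lookup e i) = 0" using b(3) by (intro sum.neutral) force
    then show False using rest w[OF a(1)] by simp
  qed
  have apos: "lookup e a \<ge> 1" using a(2)[OF b(1)] bpos by simp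
  define e' where "e' = e - var_exp a - var_exp b"
  have l: "lookup e' i = (if i = a \<or> i = b then lookup e i - 1 else lookup e i)" for i
    using b(2) by (auto simp: e'_def lookup_minus lookup_single when_def)
  have eq: "e = e' + var_exp a + var_exp b"
    by (rule poly_mapping_eqI) (use apos bpos b(2) in \<open>auto simp: lookup_add l lookup_single when_def\<close>)
  have k': "keys e' \<subseteq> {..<N}" 
  proof
    fix i assume "i \<in> keys e'"
    then have "i \<in> keys e" by (auto simp: in_keys_iff l split: if_splits)
    then show "i \<in> {..<N}" using k by blast
  qed
  have E': "exponent_degree e = exponent_degree e' + 2" by (subst eq) (simp add: exponent_degree_add)
  have "m \<le> off_weight i e'" if i: "i < N" for i
  proof (cases "i = a \<or> i = b")
    case True
    then show ?thesis
      using w[OF i] E' l[of i] apos bpos lookup_le_exponent_degree[of e i] lookup_le_exponent_degree[of e' i]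
      by (auto simp: off_weight_def)
  next
    case False
    have "(\<Sum>j\<in>{a, b, i}. lookup e j) \<le> (\<Sum>j<N. lookup e j)"
      by (rule sum_mono2) (use a(1) b(1) i in auto)
    then have "lookup e a + lookup e b + lookup e i \<le> exponent_degree e" using E False b(2) by simp
    then show ?thesis
      using w[OF i] E' l[of i] False a(2)[OF i] b(3)[OF i] d by (auto simp: off_weight_def)
  qed
  then show ?thesis using that[OF a(1) b(1) _ k' eq] b(2) E' d by simp
qed

lemma exists_bounded_exponent:
  assumes "s \<le> N * c"
  shows "\<exists>e. keys e \<subseteq> {..<N} \<and> exponent_degree e = s \<and> (\<forall>i. lookup e i \<le> c)"
  using assms
proof (induction s)
  case 0
  then show ?case by (intro exI[of _ 0]) (auto simp: exponent_degree_def)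
next
  case (Suc s)
  then obtain e where e: "keys e \<subseteq> {..<N}" "exponent_degree e = s" "\<And>i. lookup e i \<le> c" by auto
  have "\<exists>i<N. lookup e i < c"
  proof (rule ccontr)
    assume "\<not> (\<exists>i<N. lookup e i < c)"
    then have "c \<le> lookup e i" if "i < N" for i using that by (meson not_less)
    then have "(\<Sum>i<N. c) \<le> (\<Sum>i<N. lookup e i)" by (intro sum_mono) simp
    then show False using Suc.prems e exponent_degree_lessThan[OF e(1)] by simp
  qed
  then obtain i where i: "i < N" "lookup e i < c" by blast
  have "keys (e + var_exp i) \<subseteq> {..<N}" using keys_add[of e "var_exp i"] e(1) i(1) by auto
  moreover have "lookup (e + var_exp i) j \<le> c" for j
    using e(3)[of j] i(2) by (auto simp: lookup_add lookup_single when_def)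
  ultimately show ?case
    using e(2) by (intro exI[of _ "e + var_exp i"]) (auto simp: exponent_degree_add)
qed

text \<open>The bound is \<open>\<lceil>m N / (N - 1)\<rceil>\<close>, written in the form in which its complement to \<open>2 m\<close> appears in
  the theorem.\<close>

lemma exponent_degree_lower_bound:
  assumes N: "N \<ge> 2" and k: "keys e \<subseteq> {..<N}" and w: "\<And>i. i < N \<Longrightarrow> m \<le> off_weight i e"
  shows "2 * m - m * (N - 2) div (N - 1) \<le> exponent_degree e"
proof -
  define t where "t = m * (N - 2) div (N - 1)"
  have "m + lookup e i \<le> exponent_degree e" if "i < N" for i
    using w[OF that] lookup_le_exponent_degree[of e i] by (simp add: off_weight_def)
  then have "(\<Sum>i<N. m + lookup e i) \<le> (\<Sum>i<N. exponent_degree e)" by (intro sum_mono) auto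
  then have 1: "N * m + exponent_degree e \<le> N * exponent_degree e"
    by (simp add: sum.distrib exponent_degree_lessThan[OF k])
  obtain n where n: "N = n + 2" using N by (metis add.commute le_Suc_ex)
  have 2: "m * n < (n + 1) * (t + 1)"
    unfolding t_def n using dividend_less_times_div[of "n + 1" "m * n"] by (simp add: algebra_simps)
  have 3: "(n + 2) * m \<le> (n + 1) * exponent_degree e" using 1 n by (simp add: algebra_simps)
  have "2 * m \<le> t + exponent_degree e"
  proof (rule ccontr)
    assume "\<not> 2 * m \<le> t + exponent_degree e"
    then have "(n + 1) * (t + exponent_degree e + 1) \<le> (n + 1) * (2 * m)" by (intro mult_le_mono2) simp
    with 2 3 show False by (simp add: algebra_simps)
  qed
  then show ?thesis unfolding t_def by simp
qed

text \<open>Put \<open>c = m - t\<close>. The required degree is \<open>m + c\<close>, so entries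
  bounded by \<open>c\<close> leave weight at least \<open>m\<close> off every variable. There is
  room for such entries: \<open>m + c \<le> N * c\<close> is equivalent to
  \<open>(N - 1) * t \<le> m * (N - 2)\<close>.\<close>

lemma exists_extremal_exponent:
  assumes N: "N \<ge> 2"
  obtains e where "keys e \<subseteq> {..<N}" "exponent_degree e = 2 * m - m * (N - 2) div (N - 1)"
    "\<forall>i. m \<le> off_weight i e"
proof -
  define t where "t = m * (N - 2) div (N - 1)"
  obtain n where n: "N = n + 2" using N by (metis add.commute le_Suc_ex)
  have t: "(n + 1) * t \<le> m * n"
    using times_div_less_eq_dividend[of "Suc n" "m * n"] by (simp add: t_def n)
  have tm: "t \<le> m"
  proof (rule ccontr)
    assume "\<not> t \<le> m"
    then have "(n + 1) * (m + 1) \<le> (n + 1) * t" by (intro mult_le_mono2) simp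
    with t show False by (simp add: algebra_simps)
  qed
  then obtain c where c: "m = t + c" by (metis le_Suc_ex)
  have "m + c \<le> N * c" using t unfolding n c by (simp add: algebra_simps)
  then obtain e where e: "keys e \<subseteq> {..<N}" "exponent_degree e = m + c" "\<forall>i. lookup e i \<le> c"
    using exists_bounded_exponent[of "m + c" N c] by blast
  have "exponent_degree e = 2 * m - t" using e(2) c by linarith
  moreover have "m \<le> off_weight i e" for i 
  proof -
    have "lookup e i \<le> c" using e(3) by blast
    then show ?thesis using e(2) by (simp add: off_weight_def)
  qed
  ultimately show ?thesis using that e(1) unfolding t_def by blast
qed

context split_quadrics
begin

section \<open>Ordinary powers in the monomial model\<close>

abbreviation I_power :: "nat \<Rightarrow> 'k mpol set" where
  "I_power \<equiv> ideal_power (mpol_ring N) I"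

text \<open>This stands for the \<open>m\<close>-th power of the ideal in the model. The multiplier
  \<open>H\<close> is built in because \<open>Psi\<close> is not multiplicative; it also absorbs the
  scalars of the algebraic closure.\<close>

definition power_preimage :: "nat \<Rightarrow> 'k alg_closure mpol set" where
  "power_preimage m = {F \<in> polys N. \<forall>H\<in>polys N. Psi (H * F) \<in> I_power m}"

lemma ideal_power_I: "ideal (I_power m) (mpol_ring N)"
  by (rule ideal_ideal_power[OF ideal_I])

lemma power_preimage_sum: "(\<And>i. i \<in> A \<Longrightarrow> F i \<in> power_preimage m) \<Longrightarrow> (\<Sum>i\<in>A. F i) \<in> power_preimage m"
  by (auto simp: power_preimage_def sum_distrib_left Psi_sum intro!: ideal_sum[OF ideal_power_I])

text \<open>The claim is linear in the second factor, which lies in the span of the transformed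
  generators. For a single \<open>Theta g\<close> the factor \<open>g\<close> comes out of
  \<open>Psi\<close> and raises the power by one.\<close>

lemma power_preimage_pair:
  assumes F: "F \<in> power_preimage m" and ab: "a < N" "b < N" "a \<noteq> b"
  shows "F * (mpol_var a * mpol_var b) \<in> power_preimage (Suc m)"
proof -
  have span: "v \<in> {v. \<forall>H\<in>polys N. Psi (H * F * v) \<in> I_power (Suc m)}"
    if "v \<in> mpol.span (Theta ` G)" for v
  proof (rule subsetD[OF mpol_subspace_span_mono that], goal_cases)
    case 1
    have "Psi (H * F * Theta g) \<in> I_power (Suc m)" if "g \<in> G" "H \<in> polys N" for g H
    proof -
      have "Psi (H * F) \<in> I_power m" using F that by (simp add: power_preimage_def)
      then have "Psi (H * F) * g \<in> I_power (Suc m)"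
        by (rule ideal_power_SucI) (use that G_subset_I in auto)
      then show ?thesis using that G_polys by (simp add: Psi_mult_Theta subset_eq)
    qed
    then show ?case by auto
  next
    case 2
    have "Psi 0 = 0" by (simp add: Psi_def InvK_simps)
    then show ?case using ideal_zero[OF ideal_power_I] unfolding mem_Collect_eq mult_zero_right by metis
  next
    case (3 f g)
    have "Psi (H * F * (f + g)) = Psi (H * F * f) + Psi (H * F * g)" for H
      by (simp add: distrib_left Psi_def InvK_simps poly_retract_add)
    then show ?case using 3 ideal_add[OF ideal_power_I] unfolding mem_Collect_eq by metis
  next
    case (4 c f)
    have "Psi (H * F * (const c * f)) \<in> I_power (Suc m)" if "H \<in> polys N" for H
    proof -
      have "H * const c \<in> polys N" using that by auto
      then have "Psi (H * const c * F * f) \<in> I_power (Suc m)" using 4 by blast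
      then show ?thesis by (simp add: mult_ac)
    qed
    then show ?case by blast
  qed
  have "F * (mpol_var a * mpol_var b) \<in> polys N" using F ab by (auto simp: power_preimage_def)
  then show ?thesis
    using span[OF variable_pair_in_span[OF ab]] by (auto simp: power_preimage_def mult.assoc)
qed

lemma term_in_power_preimage:
  assumes "keys e \<subseteq> {..<N}" "2 * m \<le> exponent_degree e" "\<And>i. i < N \<Longrightarrow> m \<le> off_weight i e"
  shows "term_of e c \<in> power_preimage m"
  using assms
proof (induction m arbitrary: e)
  case 0
  have "Psi F \<in> I_power 0" if "F \<in> polys N" for F
    using Psi_polys[OF that] by (simp only: ideal_power_0)
  then show ?case using 0 polys_mult polys_term unfolding power_preimage_def by blast
next
  case (Suc m)
  obtain e' a b where e': "a < N" "b < N" "a \<noteq> b" "keys e' \<subseteq> {..<N}"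
    "e = e' + var_exp a + var_exp b"
    "2 * m \<le> exponent_degree e'" "\<forall>i<N. m \<le> off_weight i e'"
    by (rule exponent_split_pair[OF Suc.prems])
  have "term_of e' c * (mpol_var a * mpol_var b) \<in> power_preimage (Suc m)"
    by (rule power_preimage_pair[OF Suc.IH[OF e'(4,6) e'(7)[rule_format]] e'(1-3)])
  then show ?case by (simp add: e'(5) mpol_var_def mult_single add.assoc)
qed

lemma monomial_ideal_subset_power_preimage:
  assumes "F \<in> polys N" "F \<in> order_ge (2 * m)" "\<And>i. i < N \<Longrightarrow> F \<in> weight_ge (off_weight i) m"
  shows "F \<in> power_preimage m"
proof -
  have "(\<Sum>e\<in>keys F. term_of e (lookup F e)) \<in> power_preimage m"
    by (intro power_preimage_sum term_in_power_preimage) (use assms in \<open>auto simp: polys_iff weight_ge_def\<close>)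
  then show ?thesis by (simp add: sum_terms)
qed

text \<open>The hypotheses place every monomial of \<open>Theta f\<close> in the \<open>m\<close>-th
  power of the model, and \<open>Psi\<close> recovers \<open>f\<close> from
  \<open>Theta f\<close>.\<close>

lemma ideal_power_I_memI:
  assumes f: "f \<in> polys N" "f \<in> order_ge (2 * m)"
    and "\<And>i. i < N \<Longrightarrow> Theta f \<in> weight_ge (off_weight i) m"
  shows "f \<in> I_power m"
proof -
  have "Theta f \<in> power_preimage m"
    using assms Theta_weight_ge by (intro monomial_ideal_subset_power_preimage Theta_polys) auto
  then have "Psi (1 * Theta f) \<in> I_power m" unfolding power_preimage_def by blast
  then show ?thesis using f by (simp add: Psi_Theta)
qed

text \<open>For \<open>m = 1\<close> the order condition is automatic: a monomial that is not
  constant and not a pure power involves two different variables.\<close>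

lemma I_memI:
  assumes f: "f \<in> polys N" and w: "\<And>i. i < N \<Longrightarrow> Theta f \<in> weight_ge (off_weight i) 1"
  shows "f \<in> I"
proof -
  have "2 \<le> exponent_degree e" if e: "e \<in> keys (Theta f)" for e
  proof -
    have k: "keys e \<subseteq> {..<N}" using e Theta_polys[OF f] by (simp add: polys_iff)
    have o: "1 \<le> off_weight i e" if "i < N" for i using w[OF that] e by (simp add: weight_ge_def)
    have "keys e \<noteq> {}" using o[OF N_pos] by (auto simp: off_weight_def exponent_degree_def)
    then obtain i where i: "i \<in> keys e" by blast
    then have "lookup e i \<ge> 1" by (simp add: in_keys_iff)
    moreover have "i < N" using i k by auto
    ultimately show ?thesis using o[of i] by (simp add: off_weight_def)
  qed
  then have "Theta f \<in> order_ge 2" by (simp add: weight_ge_def)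
  then have "f \<in> I_power 1"
    using w Theta_weight_ge_iff[OF f] f by (intro ideal_power_I_memI) auto
  moreover have "I_power 1 \<subseteq> (if (1::nat) = 0 then polys N else I)"
    by (rule ideal_power_subset[where U = "\<lambda>n. if n = 0 then polys N else I"])
      (auto intro: I_add I_mult I_polys split: if_splits)
  ultimately show ?thesis by auto
qed

section \<open>The associated primes\<close>

text \<open>The prime of the \<open>i\<close>-th point, contracted to the base field. Different
  indices may give the same prime, as the points may be conjugate.\<close>

definition point_ideal :: "nat \<Rightarrow> 'k mpol set" where
  "point_ideal i = {f \<in> polys N. Theta f \<in> weight_ge (off_weight i) 1}"

lemma I_eq_Inter: "f \<in> I \<longleftrightarrow> f \<in> polys N \<and> (\<forall>i<N. f \<in> point_ideal i)"
  using I_memI I_off_weight I_polys by (auto simp: point_ideal_def)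

lemma primeideal_point_ideal: "primeideal (point_ideal i) (mpol_ring N)"
  unfolding primeideal_mpol_ring_iff
proof (intro conjI ballI impI)
  show "ideal (point_ideal i) (mpol_ring N)"
    unfolding ideal_mpol_ring_iff
  proof (intro conjI ballI)
    show "0 \<in> point_ideal i" by (simp add: point_ideal_def Theta_simps)
    fix r f :: "'k mpol" assume "r \<in> polys N" "f \<in> point_ideal i"
    then show "r * f \<in> point_ideal i"
      using weight_ge_mult[OF additive_weight_off weight_ge_zero, of "Theta f" i 1 "Theta r"]
      by (auto simp: point_ideal_def Theta_mult)
  qed (auto simp: point_ideal_def Theta_add intro: weight_ge_add)
  show "1 \<notin> point_ideal i"
    by (simp add: point_ideal_def Theta_simps weight_ge_def off_weight_def exponent_degree_def)
  fix a b assume ab: "a \<in> polys N" "b \<in> polys N" "a * b \<in> point_ideal i"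
  then have "Theta a * Theta b \<in> weight_ge (off_weight i) (0 + 1)" by (simp add: point_ideal_def Theta_mult)
  then have "Theta a \<notin> weight_ge (off_weight i) (Suc 0) \<Longrightarrow> Theta b \<in> weight_ge (off_weight i) 1"
    using weight_ge_cancel[OF additive_weight_off] by blast
  then show "a \<in> point_ideal i \<or> b \<in> point_ideal i" using ab by (auto simp: point_ideal_def)
qed

lemma form_in_point_ideal_iff:
  assumes "i < N" "f \<in> polys N" "f \<in> forms d"
  shows "f \<in> point_ideal i \<longleftrightarrow> subst to_ac (p i) f = 0"
proof -
  have "(\<forall>n. subst to_ac (p i) (form_part n f) = 0) \<longleftrightarrow> subst to_ac (p i) f = 0"
    by (auto simp: part_weight_eq[OF assms(3)] subst_0[OF ring_map_to_ac] split: if_splits)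
  then show ?thesis
    unfolding point_ideal_def using Theta_off_weight_ge_1_iff[OF assms(1,2)] assms(2) by simp
qed

text \<open>The values of forms are algebraic over the base field; the minimal polynomial of a nonzero
  value has a nonzero constant term.\<close>

lemma point_ideal_incomparable:
  assumes i: "i < N" and j: "j < N" and sub: "point_ideal j \<subseteq> point_ideal i"
  shows "point_ideal i \<subseteq> point_ideal j"
proof
  fix s assume s: "s \<in> point_ideal i"
  then have sp: "s \<in> polys N" by (simp add: point_ideal_def)
  show "s \<in> point_ideal j"
  proof (rule ccontr)
    assume "s \<notin> point_ideal j"
    then obtain d where d: "subst to_ac (p j) (form_part d s) \<noteq> 0"
      using sp Theta_off_weight_ge_1_iff[OF j sp] by (auto simp: point_ideal_def)
    define s1 where "s1 = form_part d s"
    define a where "a = subst to_ac (p j) s1"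
    have s1: "s1 \<in> polys N" "s1 \<in> forms d"
      unfolding s1_def by (rule part_polys[OF sp], rule part_in_weight_eq)
    have a0: "a \<noteq> 0" using d by (simp add: a_def s1_def)
    have s1i: "subst to_ac (p i) s1 = 0"
      using s Theta_off_weight_ge_1_iff[OF i sp] by (simp add: point_ideal_def s1_def)
    obtain g where g: "g \<noteq> 0" "poly (ac_poly g) a = 0"
      "\<And>f. poly (ac_poly f) a = 0 \<Longrightarrow> g dvd f"
      using minimal_annihilating_poly[of a] by metis
    have g0: "coeff g 0 \<noteq> 0"
    proof
      assume "coeff g 0 = 0"
      then obtain g' where g': "g = pCons 0 g'" by (metis pCons_cases coeff_pCons_0)
      then have "poly (ac_poly g') a = 0" using g(2) a0 by (simp add: map_poly_pCons)
      then have "g dvd g'" by (rule g(3))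
      moreover have "g' \<noteq> 0" using g' g(1) by auto
      ultimately have "degree g \<le> degree g'" by (simp add: dvd_imp_degree_le)
      then show False using g' \<open>g' \<noteq> 0\<close> by simp
    qed
    define n where "n = degree g"
    \<comment> \<open>Since \<open>ell\<close> is \<open>1\<close> at every point, the value of this
      form at \<open>p r\<close> is that of \<open>g\<close> at the value of \<open>s1\<close>. It
      vanishes at \<open>p j\<close>, while at \<open>p i\<close> it is the nonzero constant term of
      \<open>g\<close>.\<close>
    define S where "S = homogenized const s1 (ell ^ d) n g"
    have Sp: "S \<in> polys N" unfolding S_def using s1 ell_polys by (intro homogenized_polys) auto
    have Sw: "S \<in> forms (n * d)"
      unfolding S_def homogenized_def
    proof (rule weight_eq_sum)
      fix k assume "k \<in> {..n}"
      then have nd: "0 + k * d + (n - k) * (d * 1) = n * d" by (simp add: add_mult_distrib[symmetric])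
      have "const (coeff g k) * s1 ^ k * (ell ^ d) ^ (n - k) \<in>
          forms (0 + k * d + (n - k) * (d * 1))"
        using ell(1) s1(2)
        by (intro weight_eq_mult weight_eq_power weight_eq_const additive_weight_degree) (auto simp: linear_forms_def)
      then show "const (coeff g k) * s1 ^ k * (ell ^ d) ^ (n - k) \<in> forms (n * d)"
        unfolding nd .
    qed
    have val: "subst to_ac (p r) S = poly (ac_poly g) (subst to_ac (p r) s1)" if "r < N" for r
    proof -
      have rm: "ring_map (subst to_ac (p r))" by (rule ring_map_subst[OF ring_map_to_ac])
      have "subst to_ac (p r) (ell ^ d) = 1"
        using zero_p[OF that] by (simp add: ring_map_power[OF rm] zero_point_def)
      then have "subst to_ac (p r) S = homogenized to_ac (subst to_ac (p r) s1) 1 n g"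
        unfolding S_def by (simp add: ring_map_homogenized[OF rm] subst_const[OF ring_map_to_ac])
      also have "\<dots> = homogenized (\<lambda>c. c) (subst to_ac (p r) s1) 1 n (ac_poly g)"
        by (simp add: homogenized_map_poly)
      also have "\<dots> = poly (ac_poly g) (subst to_ac (p r) s1)"
        by (rule homogenized_eq_poly) (simp add: n_def degree_ac_poly)
      finally show ?thesis .
    qed
    have "S \<in> point_ideal j" using val[OF j] g(2) by (simp add: form_in_point_ideal_iff[OF j Sp Sw] a_def)
    then have "S \<in> point_ideal i" using sub by blast
    then have "poly (ac_poly g) 0 = 0"
      using val[OF i] s1i by (simp add: form_in_point_ideal_iff[OF i Sp Sw])
    then show False using g0 by (simp add: poly_0_coeff_0 coeff_map_poly)
  qed
qed

text \<open>By incomparability each of the other primes has an element outside this one. The product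
  \<open>x\<close> of these elements lies in all the other primes and not in this one, so
  \<open>r * x \<in> I\<close> tests membership of \<open>r\<close> in this prime alone. The set
  \<open>A\<close> leaves out indices that give the same prime.\<close>

lemma point_ideal_associated:
  assumes i: "i < N"
  obtains x where "x \<in> polys N" "{r \<in> polys N. r * x \<in> I} = point_ideal i"
proof -
  note prime = primeideal_point_ideal[of i, unfolded primeideal_mpol_ring_iff]
  define A where "A = {j. j < N \<and> point_ideal j \<noteq> point_ideal i}"
  have "\<exists>s. s \<in> point_ideal j \<and> s \<notin> point_ideal i" if "j \<in> A" for j
    using that point_ideal_incomparable[OF i, of j] by (auto simp: A_def)
  then obtain s where s: "\<And>j. j \<in> A \<Longrightarrow> s j \<in> point_ideal j" "\<And>j. j \<in> A \<Longrightarrow> s j \<notin> point_ideal i" by metis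
  have sp: "s j \<in> polys N" if "j \<in> A" for j using s(1)[OF that] by (simp add: point_ideal_def)
  define x where "x = (\<Prod>j\<in>A. s j)"
  have fin: "finite A" by (simp add: A_def)
  have xp: "x \<in> polys N" unfolding x_def using sp by (rule polys_prod)
  have xi: "x \<notin> point_ideal i"
  proof -
    have "(\<Prod>j\<in>B. s j) \<notin> point_ideal i \<and> (\<Prod>j\<in>B. s j) \<in> polys N" if "finite B" "B \<subseteq> A" for B
      using that
    proof (induction B rule: finite_induct)
      case (insert b B)
      then have "s b \<notin> point_ideal i" "s b \<in> polys N" "prod s B \<notin> point_ideal i" "prod s B \<in> polys N"
        using s sp by auto
      then have "s b * prod s B \<notin> point_ideal i" "s b * prod s B \<in> polys N" using prime by auto
      then show ?case using insert by simp
    qed (use prime in auto)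
    then show ?thesis unfolding x_def using fin by blast
  qed
  have xj: "x \<in> point_ideal j" if j: "j \<in> A" for j
  proof -
    have idj: "ideal (point_ideal j) (mpol_ring N)"
      using primeideal_point_ideal[of j] unfolding primeideal_mpol_ring_iff by blast
    have "x = prod s (A - {j}) * s j" unfolding x_def using prod.remove[OF fin j, of s] by (simp add: mult.commute)
    also have "\<dots> \<in> point_ideal j"
      by (rule ideal_mult[OF idj _ s(1)[OF j]]) (use sp in auto)
    finally show ?thesis .
  qed
  have "r * x \<in> I \<longleftrightarrow> r \<in> point_ideal i" if r: "r \<in> polys N" for r
  proof
    assume "r * x \<in> I"
    then have "r * x \<in> point_ideal i" using i I_eq_Inter by blast
    then show "r \<in> point_ideal i" using prime r xp xi by blast
  next
    assume ri: "r \<in> point_ideal i"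
    have "r * x \<in> point_ideal j" if "j < N" for j
    proof -
      have idj: "ideal (point_ideal j) (mpol_ring N)"
        using primeideal_point_ideal[of j] unfolding primeideal_mpol_ring_iff by blast
      show ?thesis
      proof (cases "j \<in> A")
        case True
        then show ?thesis using ideal_mult[OF idj r xj] by blast
      next
        case False
        then have "r \<in> point_ideal j" using ri that by (simp add: A_def)
        then have "x * r \<in> point_ideal j" by (rule ideal_mult[OF idj xp])
        then show ?thesis by (simp add: mult.commute)
      qed
    qed
    then show "r * x \<in> I" using I_eq_Inter r xp by blast
  qed
  moreover have "point_ideal i \<subseteq> polys N" by (auto simp: point_ideal_def)
  ultimately have "{r \<in> polys N. r * x \<in> I} = point_ideal i" by blast
  then show ?thesis using that xp by blast
qed

section \<open>Symbolic powers\<close>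

text \<open>The denominator \<open>s\<close> avoids the prime of the \<open>i\<close>-th point, so
  \<open>Theta s\<close> has order \<open>0\<close> with respect to \<open>off_weight i\<close>, and
  cancelling it does not lower the bound \<open>m\<close>.\<close>

lemma symbolic_power_off_weight:
  assumes f: "f \<in> symbolic_power (mpol_ring N) I m" and i: "i < N"
  shows "Theta f \<in> weight_ge (off_weight i) m"
proof -
  obtain x where x: "x \<in> polys N" "{r \<in> polys N. r * x \<in> I} = point_ideal i"
    by (rule point_ideal_associated[OF i])
  then obtain s where s: "s \<in> polys N" "s * x \<notin> I" "s * f \<in> I_power m"
    using f primeideal_point_ideal[of i] unfolding symbolic_power_eq[OF ideal_I] by auto
  then have "s \<notin> point_ideal i" using x(2) by blast
  then have "Theta s \<notin> weight_ge (off_weight i) (Suc 0)" using s(1) by (simp add: point_ideal_def)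
  moreover have "Theta s * Theta f \<in> weight_ge (off_weight i) (0 + m)"
    using s(3) ideal_power_off_weight[OF i, of m] by (auto simp: Theta_mult)
  ultimately show ?thesis using weight_ge_cancel[OF additive_weight_off] by blast
qed

text \<open>No associated prime contains all variables: every point has a nonzero coordinate because
  \<open>ell\<close> does not vanish there, so an \<open>x\<close> multiplied into \<open>I\<close>
  by all variables would lie in the ideal of every point and hence in \<open>I\<close>. A power of
  some variable thus serves as denominator.\<close>

lemma mem_symbolic_powerI:
  assumes f: "f \<in> polys N" and n: "\<And>r. r < N \<Longrightarrow> mpol_var r ^ n * f \<in> I_power m"
  shows "f \<in> symbolic_power (mpol_ring N) I m"
  unfolding symbolic_power_eq[OF ideal_I]
proof (intro CollectI conjI f ballI impI)
  fix x assume x: "x \<in> polys N" "primeideal {r \<in> polys N. r * x \<in> I} (mpol_ring N)"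
  note prime = x(2)[unfolded primeideal_mpol_ring_iff]
  have "\<exists>r<N. mpol_var r * x \<notin> I"
  proof (rule ccontr)
    assume "\<not> (\<exists>r<N. mpol_var r * x \<notin> I)"
    then have vx: "mpol_var r * x \<in> I" if "r < N" for r using that by blast
    have "x \<in> point_ideal i" if i: "i < N" for i
    proof -
      have "\<exists>r<N. p i r \<noteq> 0"
      proof (rule ccontr)
        assume "\<not> (\<exists>r<N. p i r \<noteq> 0)"
        then have "subst to_ac (p i) ell = subst to_ac (\<lambda>r. 0) ell"
          by (intro subst_cong_polys[OF ring_map_to_ac ell_polys]) auto
        also have "\<dots> = 0"
          unfolding subst_def monomial_value_def
        proof (rule sum.neutral, rule ballI)
          fix e assume "e \<in> keys ell"
          then have "exponent_degree e = 1" using ell(1) by (simp add: linear_forms_def weight_eq_def)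
          then obtain j where "e = var_exp j" by (rule exponent_degree_1E)
          then show "to_ac (lookup ell e) * (\<Prod>i\<in>keys e. 0 ^ lookup e i) = 0" by simp
        qed
        finally show False using zero_p[OF i] by (simp add: zero_point_def)
      qed
      then obtain r where r: "r < N" "p i r \<noteq> 0" by blast
      have "mpol_var r * x \<in> point_ideal i" using vx[OF r(1)] i I_eq_Inter by blast
      moreover have "mpol_var r \<notin> point_ideal i"
        using form_in_point_ideal_iff[OF i polys_var[OF r(1)] mpol_var_form] r(2)
        by (simp add: subst_var[OF ring_map_to_ac])
      ultimately show ?thesis
        using primeideal_point_ideal[of i] x(1) polys_var[OF r(1)] unfolding primeideal_mpol_ring_iff by blast
    qed
    then have "x \<in> I" using I_eq_Inter x(1) by blast
    then have "1 \<in> {r \<in> polys N. r * x \<in> I}" by simp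
    then show False using prime by blast
  qed
  then obtain r where r: "r < N" "mpol_var r * x \<notin> I" by blast
  have "mpol_var r ^ k \<notin> {r \<in> polys N. r * x \<in> I}" for k
  proof (induction k)
    case 0
    then show ?case using prime by simp
  next
    case (Suc k)
    have "mpol_var r ^ k \<in> polys N" "mpol_var r \<in> polys N" using polys_var[OF r(1)] by auto
    moreover have "mpol_var r \<notin> {r \<in> polys N. r * x \<in> I}" using r(2) by simp
    ultimately show ?case using prime Suc unfolding power_Suc by blast
  qed
  then have "mpol_var r ^ n * x \<notin> I" using polys_power[OF polys_var[OF r(1)]] by blast
  then show "\<exists>s\<in>polys N. s * x \<notin> I \<and> s * f \<in> I_power m"
    using n[OF r(1)] polys_power[OF polys_var[OF r(1)]] by blast
qed

text \<open>The extremal monomial lies in the symbolic power of the model, and a form of degree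
  \<open>t\<close> lifts it to order \<open>2 * m\<close>, into the ordinary power. The scalar
  \<open>c\<close> keeps its descent to the base field nonzero.\<close>

lemma symbolic_power_extremal_form:
  assumes N: "N \<ge> 2"
  obtains f where "f \<in> symbolic_power (mpol_ring N) I m" "f \<noteq> 0" "f \<in> polys N"
    "f \<in> forms (2 * m - m * (N - 2) div (N - 1))"
proof -
  let ?t = "m * (N - 2) div (N - 1)"
  obtain e where e: "keys e \<subseteq> {..<N}" "exponent_degree e = 2 * m - ?t" "\<forall>i. m \<le> off_weight i e"
    by (rule exists_extremal_exponent[OF N])
  define F :: "'k alg_closure mpol" where "F = term_of e 1"
  have F: "F \<in> polys N" "F \<in> forms (2 * m - ?t)" "F \<in> weight_ge (off_weight i) m" for i
    using e by (auto simp: F_def polys_iff weight_eq_def weight_ge_def)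
  have "InvK F \<noteq> 0"
  proof
    assume "InvK F = 0"
    then have "ThetaK (InvK F) = 0" by (simp add: ThetaK_simps)
    then show False using ThetaK_InvK[OF F(1)] by (simp add: F_def)
  qed
  then obtain c where c: "poly_retract (const c * InvK F) \<noteq> 0" by (rule poly_retract_const_nonzero)
  define f where "f = Psi (const c * F)"
  have fp: "f \<in> polys N" unfolding f_def using F by (intro Psi_polys) auto
  have "const c * F \<in> forms (2 * m - ?t)"
    by (rule forms_const_mult[OF F(2)])
  then have fw: "f \<in> forms (2 * m - ?t)"
    unfolding f_def Psi_def using F by (intro poly_retract_weight_eq InvK_weight_eq) auto
  have f0: "f \<noteq> 0" using c by (simp add: f_def Psi_def InvK_simps)
  have "mpol_var r ^ ?t * f \<in> I_power m" if r: "r < N" for r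
  proof -
    let ?s = "mpol_var r ^ ?t :: 'k mpol"
    have s: "?s \<in> polys N" "?s \<in> forms ?t"
      using polys_var[OF r] forms_power[OF mpol_var_form, of r ?t] by auto
    have Fs: "Theta ?s * F \<in> power_preimage m"
    proof (rule monomial_ideal_subset_power_preimage)
      show "Theta ?s * F \<in> polys N" using Theta_polys[OF s(1)] F by auto
      have "Theta ?s * F \<in> forms (?t + (2 * m - ?t))"
        by (rule forms_mult[OF Theta_weight_eq[OF s] F(2)])
      then show "Theta ?s * F \<in> order_ge (2 * m)"
        using weight_eq_imp_ge weight_ge_mono by fastforce
      fix i
      show "Theta ?s * F \<in> weight_ge (off_weight i) m"
        using weight_ge_mult[OF additive_weight_off weight_ge_zero F(3)] by simp
    qed
    have "Psi (const c * (Theta ?s * F)) \<in> I_power m"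
      using Fs by (simp add: power_preimage_def)
    also have "const c * (Theta ?s * F) = (const c * F) * Theta ?s" by (simp add: mult_ac)
    finally show ?thesis by (simp only: Psi_mult_Theta[OF s(1)] f_def mult.commute)
  qed
  then have "f \<in> symbolic_power (mpol_ring N) I m" by (rule mem_symbolic_powerI[OF fp])
  then show ?thesis using that f0 fp fw by blast
qed

text \<open>A multiplier of order \<open>t\<close> raises orders from at least
  \<open>2 * m - t\<close> to \<open>2 * m\<close>, which is all that separates the symbolic from
  the ordinary power. Conversely, by additivity of orders, a single nonzero form of degree
  \<open>2 * m - t\<close> in the symbolic power forces this order on the multiplier.\<close>

theorem annihilator_symbolic_mod_ordinary_power:
  assumes N: "N \<ge> 2"
  shows "annihilator (mpol_ring N)
      (quotient_module (mpol_ring N) (symbolic_power (mpol_ring N) I m) (ideal_power (mpol_ring N) I m)) =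
    ideal_power (mpol_ring N) (irrelevant_ideal N) (m * (N - 2) div (N - 1))"
  unfolding annihilator_quotient_module[OF ideal_power_I] irrelevant_ideal_power
proof (intro subset_antisym subsetI)
  let ?t = "m * (N - 2) div (N - 1)"
  fix s :: "'k mpol" assume "s \<in> polys N \<inter> order_ge ?t"
  then have s: "s \<in> polys N" "s \<in> order_ge ?t" by auto
  have "s * f \<in> ideal_power (mpol_ring N) I m" if f: "f \<in> symbolic_power (mpol_ring N) I m" for f
  proof -
    have fp: "f \<in> polys N" using f unfolding symbolic_power_eq[OF ideal_I] by blast
    have "Theta f \<in> order_ge (2 * m - ?t)"
      using exponent_degree_lower_bound[OF N, of _ m] symbolic_power_off_weight[OF f] Theta_polys[OF fp]
      by (simp add: weight_ge_def polys_iff)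
    then have "f \<in> order_ge (2 * m - ?t)" by (simp add: Theta_weight_ge_iff[OF fp])
    then have "s * f \<in> order_ge (?t + (2 * m - ?t))"
      by (rule order_ge_mult[OF s(2)])
    then have "s * f \<in> order_ge (2 * m)" by (rule weight_ge_mono) simp
    moreover have "Theta (s * f) \<in> weight_ge (off_weight i) m" if "i < N" for i
      using weight_ge_mult[OF additive_weight_off weight_ge_zero symbolic_power_off_weight[OF f that]]
      by (simp add: Theta_mult)
    ultimately show ?thesis using s fp by (intro ideal_power_I_memI) auto
  qed
  then show "s \<in> {r \<in> polys N. \<forall>x\<in>symbolic_power (mpol_ring N) I m. r * x \<in> ideal_power (mpol_ring N) I m}"
    using s by blast
next
  let ?t = "m * (N - 2) div (N - 1)"
  fix s :: "'k mpol" assume s: "s \<in> {r \<in> polys N. \<forall>x\<in>symbolic_power (mpol_ring N) I m. r * x \<in> ideal_power (mpol_ring N) I m}"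
  obtain f where f: "f \<in> symbolic_power (mpol_ring N) I m" "f \<noteq> 0" "f \<in> polys N"
    "f \<in> forms (2 * m - ?t)"
    by (rule symbolic_power_extremal_form[OF N])
  \<comment> \<open>The truncated difference \<open>2 * m - ?t\<close> has to be exact before it can
    be cancelled.\<close>
  have t: "?t \<le> 2 * m"
  proof -
    have "?t \<le> m * (N - 1) div (N - 1)" by (intro div_le_mono mult_le_mono2) simp
    then show ?thesis using N by simp
  qed
  have "s * f \<in> order_ge (2 * m)" using s f(1) ideal_power_degree[of m] by blast
  then have "f * s \<in> order_ge ((2 * m - ?t) + ?t)" using t by (simp add: mult.commute)
  moreover have "f \<notin> order_ge (Suc (2 * m - ?t))"
  proof -
    obtain e where "e \<in> keys f" using f(2) by (metis equals0I keys_eq_empty)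
    then show ?thesis using f(4) by (force simp: weight_eq_def weight_ge_def)
  qed
  ultimately have "s \<in> order_ge ?t" by (rule weight_ge_cancel[OF additive_weight_degree])
  then show "s \<in> polys N \<inter> order_ge ?t" using s by blast
qed

end

theorem theorem5p5:
  fixes I :: "('k::field mpol) set" and N m :: nat
  assumes "perfect_field TYPE('k)"
    and "N \<ge> 3"
    and "radical_ideal I (mpol_ring N)"
    and "homogeneous_ideal N I"
    and "ideal_height (mpol_ring N) I = enat (N - 1)"
    and "\<exists>G. finite G \<and> card G = N choose 2 \<and> (\<forall>g \<in> G. form_of_degree 2 g) \<and>
           minimal_generating_set (mpol_ring N) G I"
    and "m > 0"
  shows "annihilator (mpol_ring N)
           (quotient_module (mpol_ring N)
              (symbolic_power (mpol_ring N) I m) (ideal_power (mpol_ring N) I m)) =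
         ideal_power (mpol_ring N) (irrelevant_ideal N) (m * (N - 2) div (N - 1))"
proof -
  obtain G where G: "finite G" "card G = N choose 2" "\<forall>g \<in> G. form_of_degree 2 g"
    "minimal_generating_set (mpol_ring N) G I" using assms(6) by blast
  interpret radical_quadrics I G N
  proof (rule radical_quadrics.intro)
    show "ideal I (mpol_ring N)" using assms(3) by (simp add: radical_ideal_def)
    show "f \<in> I" if "f \<in> polys N" "f ^ n \<in> I" for f n
    proof -
      have "f \<in> ideal_radical (mpol_ring N) I"
        using that unfolding ideal_radical_def mpol_ring_pow by blast
      then show ?thesis using assms(3) by (simp add: radical_ideal_def)
    qed
    show "g \<in> forms 2" if "g \<in> G" for g
      using G(3) that by (simp add: form_of_degree_iff)
  qed (use G assms in auto)
  obtain p y where py: "dual_system N p y" "\<forall>r<N. mpol_var r = (\<Sum>j<N. const (p j r) * y j)"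
    by (rule dual_basis_exists)
  interpret split_quadrics I G N p y
    by (intro split_quadrics.intro split_quadrics_axioms.intro radical_quadrics_axioms) (use py in auto)
  show ?thesis using annihilator_symbolic_mod_ordinary_power assms(2) by simp
qed

end
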